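(* Let $1 \leq p < \infty$ and let $q$ be given by $\frac1p + \frac1q = 1$. Then the dual space of $L^p_{\mathrm{QHA}}$ is $L^q_{\mathrm{QHA}}$, with the duality pairing \[ \langle (f,A), (g,B) \rangle = \int_{\mathbb{R}^{2n}} f(x) g(x)\, dx + \operatorname{tr}(A B), \qquad (f,A)\in L^p_{\mathrm{QHA}},\ (g,B)\in L^q_{\mathrm{QHA}}; \] that is, the map $(g,B)\mapsto \langle\,\cdot\,,(g,B)\rangle$ is an isomorphism of $L^q_{\mathrm{QHA}}$ onto the space of bounded linear functionals on $L^p_{\mathrm{QHA}}$.
   Context: Let $n\ge 1$ and $H = L^2(\mathbb{R}^n)$. For $1\le p<\infty$, $T^p(H)$ denotes the Schatten $p$-class of $H$ with norm $\|A\|_{T^p} = (\operatorname{tr}|A|^p)^{1/p}$; in particular $T^1(H)$ is the space of trace-class operators. For $p=\infty$, $\|A\|_{T^\infty}$ is the operator norm, and $\|f\|_{L^\infty}$ is the essential supremum norm. The quantum noncommutative $L^p$-space is \[ L^p_{\mathrm{QHA}} = \left\{ (f, A) \in L^1(\mathbb{R}^{2n}) \oplus T^1(H) : \| (f,A) \|_{L^p} := \|f\|_{L^p(\mathbb{R}^{2n})} + \|A\|_{T^p} < \infty \right\}, \] equipped with the norm $\|\cdot\|_{L^p}$.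
   Formalization: The space L^p_QHA is taken as L^p ⊕ T^p (all measurable functions and all bounded operators of finite norm) instead of a subspace of L^1 ⊕ T^1; with the latter the claim fails, e.g. for p = 1 the functional (f,A) ↦ ∫f is represented only by g = 1, which is not in L^1. *)

theory Defs
  imports
    "HOL-Analysis.Analysis"
    "HOL-Probability.Essential_Supremum"
    "HOL-Computational_Algebra.Polynomial"
begin

section \<open>Complex vector spaces and complex inner products\<close>

class complex_vector = real_vector +
  fixes scaleC :: "complex \<Rightarrow> 'a \<Rightarrow> 'a"  (infixr \<open>*\<^sub>C\<close> 75)
  assumes scaleC_add_right: "c *\<^sub>C (x + y) = c *\<^sub>C x + c *\<^sub>C y"
    and scaleC_add_left: "(c + d) *\<^sub>C x = c *\<^sub>C x + d *\<^sub>C x"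
    and scaleC_scaleC: "c *\<^sub>C d *\<^sub>C x = (c * d) *\<^sub>C x"
    and scaleC_of_real: "complex_of_real r *\<^sub>C x = r *\<^sub>R x"

text \<open>The complex inner product is linear in the first and conjugate linear in the second
  argument. The underlying real Hilbert space structure is its real part, so that the norm is
  the usual one.\<close>

class complex_inner = complex_vector + real_inner +
  fixes cinner :: "'a \<Rightarrow> 'a \<Rightarrow> complex"
  assumes cinner_commute: "cinner x y = cnj (cinner y x)"
    and cinner_add_left: "cinner (x + y) z = cinner x z + cinner y z"
    and cinner_scaleC_left: "cinner (c *\<^sub>C x) y = c * cinner x y"
    and Re_cinner: "Re (cinner x y) = inner x y"

lemma cinner_same: "cinner x x = complex_of_real ((norm x)\<^sup>2)" for x :: "'a::complex_inner"
proof (rule complex_eqI)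
  show "Re (cinner x x) = Re (complex_of_real ((norm x)\<^sup>2))"
    by (simp add: Re_cinner power2_norm_eq_inner)
  have "Im (cinner x x) = - Im (cinner x x)"
    by (metis cinner_commute cnj.simps(2))
  then show "Im (cinner x x) = Im (complex_of_real ((norm x)\<^sup>2))"
    by simp
qed

lemma norm_scaleC: "norm (c *\<^sub>C x) = cmod c * norm x" for x :: "'a::complex_inner"
proof -
  have "cinner (c *\<^sub>C x) (c *\<^sub>C x) = c * cnj c * cinner x x"
    by (metis cinner_commute cinner_scaleC_left complex_cnj_mult mult.assoc)
  also have "\<dots> = complex_of_real ((cmod c * norm x)\<^sup>2)"
    by (simp only: cinner_same complex_norm_square[symmetric] of_real_mult[symmetric]
        power_mult_distrib)
  finally have "(norm (c *\<^sub>C x))\<^sup>2 = (cmod c * norm x)\<^sup>2"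
    by (simp only: cinner_same of_real_eq_iff)
  then show ?thesis
    by (simp add: power2_eq_iff_nonneg)
qed

lemma scaleC_scaleR_commute: "c *\<^sub>C r *\<^sub>R x = r *\<^sub>R c *\<^sub>C x" for x :: "'a::complex_vector"
  by (simp add: scaleC_of_real[symmetric] scaleC_scaleC mult.commute)

instantiation blinfun :: (real_normed_vector, complex_inner) complex_vector
begin

lift_definition scaleC_blinfun :: "complex \<Rightarrow> 'a \<Rightarrow>\<^sub>L 'b \<Rightarrow> 'a \<Rightarrow>\<^sub>L 'b" is "\<lambda>c A x. c *\<^sub>C A x"
proof -
  fix c :: complex and A :: "'a \<Rightarrow> 'b"
  assume "bounded_linear A"
  moreover have "bounded_linear (\<lambda>x::'b. c *\<^sub>C x)"
    by (rule bounded_linear_intro[where K = "cmod c"])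
      (auto simp: scaleC_add_right scaleC_scaleR_commute norm_scaleC mult.commute)
  ultimately show "bounded_linear (\<lambda>x. c *\<^sub>C A x)"
    by (rule bounded_linear_compose[rotated])
qed

instance
  by standard
    (transfer; simp add: fun_eq_iff scaleC_add_right scaleC_add_left scaleC_scaleC scaleC_of_real)+

end

instantiation prod :: (complex_vector, complex_vector) complex_vector
begin

definition "scaleC_prod c x = (c *\<^sub>C fst x, c *\<^sub>C snd x)"

instance
  by standard
    (simp_all add: scaleC_prod_def prod_eq_iff scaleC_add_right scaleC_add_left scaleC_scaleC
      scaleC_of_real)

end


section \<open>Complex Lebesgue spaces\<close>

definition ae_eq :: "('a::euclidean_space \<Rightarrow> complex) \<Rightarrow> ('a \<Rightarrow> complex) \<Rightarrow> bool" where
  "ae_eq f g \<longleftrightarrow> f \<in> borel_measurable lborel \<and> g \<in> borel_measurable lborel \<and>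
    (AE x in lborel. f x = g x)"

lemma part_equivp_ae_eq: "part_equivp (ae_eq :: ('a::euclidean_space \<Rightarrow> complex) \<Rightarrow> _)"
proof (rule part_equivpI)
  show "\<exists>f :: 'a \<Rightarrow> complex. ae_eq f f"
    by (rule exI[of _ "\<lambda>_. 0"]) (simp add: ae_eq_def)
  show "symp (ae_eq :: ('a \<Rightarrow> complex) \<Rightarrow> _)"
    by (rule sympI) (auto simp: ae_eq_def elim: eventually_mono)
  show "transp (ae_eq :: ('a \<Rightarrow> complex) \<Rightarrow> _)"
  proof (rule transpI)
    fix f g h :: "'a \<Rightarrow> complex"
    assume a: "ae_eq f g" "ae_eq g h"
    then have "AE x in lborel. f x = g x" "AE x in lborel. g x = h x"
      by (auto simp: ae_eq_def)
    then have "AE x in lborel. f x = h x"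
      by eventually_elim simp
    with a show "ae_eq f h"
      by (auto simp: ae_eq_def)
  qed
qed

lemma borel_measurable_cnj [measurable (raw)]:
  "f \<in> borel_measurable M \<Longrightarrow> (\<lambda>x. cnj (f x)) \<in> borel_measurable M"
  by (rule borel_measurable_continuous_on[where f = cnj]) (intro continuous_intros)

text \<open>Measurable functions modulo equality almost everywhere. Every Lebesgue measurable function
  agrees almost everywhere with a Borel measurable one, so nothing is lost by using Borel
  representatives.\<close>

quotient_type (overloaded) 'a ae_fun = "'a::euclidean_space \<Rightarrow> complex" / partial: ae_eq
  by (rule part_equivp_ae_eq)

instantiation ae_fun :: (euclidean_space) complex_vector
begin

lift_definition zero_ae_fun :: "'a ae_fun" is "\<lambda>_. 0"
  by (simp add: ae_eq_def)

lift_definition plus_ae_fun :: "'a ae_fun \<Rightarrow> 'a ae_fun \<Rightarrow> 'a ae_fun" is "\<lambda>f g x. f x + g x"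
  by (auto simp: ae_eq_def)

lift_definition minus_ae_fun :: "'a ae_fun \<Rightarrow> 'a ae_fun \<Rightarrow> 'a ae_fun" is "\<lambda>f g x. f x - g x"
  by (auto simp: ae_eq_def)

lift_definition uminus_ae_fun :: "'a ae_fun \<Rightarrow> 'a ae_fun" is "\<lambda>f x. - f x"
  by (auto simp: ae_eq_def)

lift_definition scaleR_ae_fun :: "real \<Rightarrow> 'a ae_fun \<Rightarrow> 'a ae_fun" is "\<lambda>r f x. r *\<^sub>R f x"
  by (auto simp: ae_eq_def)

lift_definition scaleC_ae_fun :: "complex \<Rightarrow> 'a ae_fun \<Rightarrow> 'a ae_fun" is "\<lambda>c f x. c * f x"
  by (auto simp: ae_eq_def)

instance
  by standard (transfer; force simp: ae_eq_def algebra_simps scaleR_conv_of_real)+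

end

lift_definition ae_mult :: "'a::euclidean_space ae_fun \<Rightarrow> 'a ae_fun \<Rightarrow> 'a ae_fun"
  is "\<lambda>f g x. f x * g x"
  by (auto simp: ae_eq_def)

lift_definition ae_cnj :: "'a::euclidean_space ae_fun \<Rightarrow> 'a ae_fun" is "\<lambda>f x. cnj (f x)"
  by (auto simp: ae_eq_def)

lift_definition ae_integrable :: "'a::euclidean_space ae_fun \<Rightarrow> bool" is "integrable lborel"
  by (rule integrable_cong_AE) (auto simp: ae_eq_def)

lift_definition ae_integral :: "'a::euclidean_space ae_fun \<Rightarrow> complex" is "integral\<^sup>L lborel"
  by (rule integral_cong_AE) (auto simp: ae_eq_def)

definition ennreal_powr :: "ennreal \<Rightarrow> real \<Rightarrow> ennreal" where
  "ennreal_powr x r = (if x = \<infinity> then \<infinity> else ennreal (enn2real x powr r))"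

lift_definition Lp_norm :: "ennreal \<Rightarrow> 'a::euclidean_space ae_fun \<Rightarrow> ennreal"
  is "\<lambda>p f. if p = \<infinity> then esssup lborel (\<lambda>x. ennreal (cmod (f x)))
    else ennreal_powr (\<integral>\<^sup>+ x. ennreal (cmod (f x) powr enn2real p) \<partial>lborel) (1 / enn2real p)"
proof -
  fix p and f g :: "'a \<Rightarrow> complex"
  assume fg: "ae_eq f g"
  then have [measurable]: "f \<in> borel_measurable lborel" "g \<in> borel_measurable lborel"
    by (auto simp: ae_eq_def)
  have ae: "AE x in lborel. f x = g x"
    using fg by (auto simp: ae_eq_def)
  have "esssup lborel (\<lambda>x. ennreal (cmod (f x))) = esssup lborel (\<lambda>x. ennreal (cmod (g x)))"
    by (rule esssup_AE_cong) (use ae in auto)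
  moreover have "(\<integral>\<^sup>+ x. ennreal (cmod (f x) powr enn2real p) \<partial>lborel) =
      (\<integral>\<^sup>+ x. ennreal (cmod (g x) powr enn2real p) \<partial>lborel)"
    by (rule nn_integral_cong_AE) (use ae in auto)
  ultimately show "(if p = \<infinity> then esssup lborel (\<lambda>x. ennreal (cmod (f x)))
      else ennreal_powr (\<integral>\<^sup>+ x. ennreal (cmod (f x) powr enn2real p) \<partial>lborel) (1 / enn2real p)) =
    (if p = \<infinity> then esssup lborel (\<lambda>x. ennreal (cmod (g x)))
      else ennreal_powr (\<integral>\<^sup>+ x. ennreal (cmod (g x) powr enn2real p) \<partial>lborel) (1 / enn2real p))"
    by simp
qed


section \<open>The Hilbert space of square integrable functions\<close>

definition square_integrable :: "'a::euclidean_space ae_fun \<Rightarrow> bool" where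
  "square_integrable f \<longleftrightarrow> ae_integrable (ae_mult f (ae_cnj f))"

lemma integrable_mult_cnj:
  assumes [measurable]: "f \<in> borel_measurable M" "g \<in> borel_measurable M"
    and f: "integrable M (\<lambda>x. f x * cnj (f x))" and g: "integrable M (\<lambda>x. g x * cnj (g x))"
  shows "integrable M (\<lambda>x. f x * cnj (g x))"
proof (rule Bochner_Integration.integrable_bound)
  show "integrable M (\<lambda>x. (cmod (f x))\<^sup>2 + (cmod (g x))\<^sup>2)"
    using integrable_norm[OF f] integrable_norm[OF g]
    by (intro Bochner_Integration.integrable_add) (simp_all add: norm_mult power2_eq_square)
  show "AE x in M. norm (f x * cnj (g x)) \<le> norm ((cmod (f x))\<^sup>2 + (cmod (g x))\<^sup>2)"
  proof (rule AE_I2)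
    fix x
    have "0 \<le> (cmod (f x) - cmod (g x))\<^sup>2" "0 \<le> cmod (f x) * cmod (g x)"
      by simp_all
    then have "cmod (f x) * cmod (g x) \<le> (cmod (f x))\<^sup>2 + (cmod (g x))\<^sup>2"
      unfolding power2_diff by linarith
    then show "norm (f x * cnj (g x)) \<le> norm ((cmod (f x))\<^sup>2 + (cmod (g x))\<^sup>2)"
      by (simp add: norm_mult)
  qed
qed measurable

lemma ae_integrable_mult_cnj:
  "square_integrable f \<Longrightarrow> square_integrable g \<Longrightarrow> ae_integrable (ae_mult f (ae_cnj g))"
  unfolding square_integrable_def
  by transfer (auto simp: ae_eq_def intro!: integrable_mult_cnj)

lemma square_integrable_iff: "Lp_norm 2 f < \<infinity> \<longleftrightarrow> square_integrable f"
  unfolding square_integrable_def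
proof transfer
  fix f :: "'a \<Rightarrow> complex"
  assume "ae_eq f f"
  then have [measurable]: "f \<in> borel_measurable borel"
    by (simp add: ae_eq_def)
  have "(\<integral>\<^sup>+ x. ennreal (cmod (f x) powr 2) \<partial>lborel) =
      (\<integral>\<^sup>+ x. ennreal (norm (f x * cnj (f x))) \<partial>lborel)"
    by (simp add: norm_mult powr_numeral power2_eq_square)
  then show "((if (2::ennreal) = \<infinity> then esssup lborel (\<lambda>x. ennreal (cmod (f x)))
      else ennreal_powr (\<integral>\<^sup>+ x. ennreal (cmod (f x) powr enn2real 2) \<partial>lborel)
        (1 / enn2real 2)) < \<infinity>) = integrable lborel (\<lambda>x. f x * cnj (f x))"
    by (simp add: ennreal_powr_def integrable_iff_bounded less_top)
qed

lemma ae_integral_add: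
  "ae_integrable f \<Longrightarrow> ae_integrable g \<Longrightarrow> ae_integral (f + g) = ae_integral f + ae_integral g"
  by transfer simp

lemma ae_integral_scaleC: "ae_integral (c *\<^sub>C f) = c * ae_integral f"
  by transfer simp

lemma ae_integral_cnj: "ae_integral (ae_cnj f) = cnj (ae_integral f)"
  by transfer simp

lemma ae_integrable_add: "ae_integrable f \<Longrightarrow> ae_integrable g \<Longrightarrow> ae_integrable (f + g)"
  by transfer simp

lemma ae_integrable_scaleC: "ae_integrable f \<Longrightarrow> ae_integrable (c *\<^sub>C f)"
  by transfer simp

lemma ae_mult_simps:
  "ae_mult (f + g) h = ae_mult f h + ae_mult g h"
  "ae_mult h (f + g) = ae_mult h f + ae_mult h g"
  "ae_mult (c *\<^sub>C f) h = c *\<^sub>C ae_mult f h"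
  "ae_mult h (c *\<^sub>C f) = c *\<^sub>C ae_mult h f"
  "ae_cnj (f + g) = ae_cnj f + ae_cnj g"
  "ae_cnj (c *\<^sub>C f) = cnj c *\<^sub>C ae_cnj f"
  "ae_cnj (ae_mult f g) = ae_mult (ae_cnj f) (ae_cnj g)"
  "ae_cnj (ae_cnj f) = f"
  "ae_mult f g = ae_mult g f"
  by (transfer; force simp: ae_eq_def algebra_simps)+

lemma square_integrable_add:
  "square_integrable f \<Longrightarrow> square_integrable g \<Longrightarrow> square_integrable (f + g)"
  using ae_integrable_mult_cnj[of f g] ae_integrable_mult_cnj[of g f]
  by (simp add: square_integrable_def ae_mult_simps(1-8) ae_integrable_add)

lemma square_integrable_scaleC: "square_integrable f \<Longrightarrow> square_integrable (c *\<^sub>C f)"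
  by (simp add: square_integrable_def ae_mult_simps(1-8) ae_integrable_scaleC)

lemma square_integrable_uminus: "square_integrable f \<Longrightarrow> square_integrable (- f)"
  using square_integrable_scaleC[of f "complex_of_real (- 1)"]
  by (simp only: scaleC_of_real scaleR_minus1_left)

lemma square_integrable_diff:
  "square_integrable f \<Longrightarrow> square_integrable g \<Longrightarrow> square_integrable (f - g)"
  using square_integrable_add[of f "- g"] square_integrable_uminus[of g] by simp

lemma square_integrable_0: "square_integrable 0"
  unfolding square_integrable_def by transfer simp

lemma Re_ae_integral_nonneg: "0 \<le> Re (ae_integral (ae_mult f (ae_cnj f)))"
proof transfer
  fix f :: "'a \<Rightarrow> complex"
  have eq: "f x * cnj (f x) = complex_of_real ((cmod (f x))\<^sup>2)" for x
    by (simp only: complex_norm_square)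
  show "0 \<le> Re (\<integral>x. f x * cnj (f x) \<partial>lborel)"
    by (simp only: eq integral_complex_of_real Re_complex_of_real) simp
qed

lemma Re_ae_integral_eq_0:
  assumes "square_integrable f" "Re (ae_integral (ae_mult f (ae_cnj f))) = 0"
  shows "f = 0"
  using assms unfolding square_integrable_def
proof transfer
  fix f :: "'a \<Rightarrow> complex"
  assume f: "ae_eq f f" "integrable lborel (\<lambda>x. f x * cnj (f x))"
    and 0: "Re (\<integral>x. f x * cnj (f x) \<partial>lborel) = 0"
  have eq: "Re (f x * cnj (f x)) = (cmod (f x))\<^sup>2" for x
    by (simp add: complex_norm_square[symmetric])
  have "integrable lborel (\<lambda>x. (cmod (f x))\<^sup>2)"
    using integrable_Re[OF f(2)] by (simp only: eq)
  moreover have "(\<integral>x. (cmod (f x))\<^sup>2 \<partial>lborel) = 0"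
    using 0 f(2) by (simp only: integral_Re[symmetric] eq)
  ultimately have "AE x in lborel. (cmod (f x))\<^sup>2 = 0"
    by (subst (asm) integral_nonneg_eq_0_iff_AE) auto
  then show "ae_eq f (\<lambda>_. 0)"
    using f(1) by (auto simp: ae_eq_def)
qed

typedef (overloaded) 'a L2 = "{f :: 'a::euclidean_space ae_fun. Lp_norm 2 f < \<infinity>}"
  morphisms ae_fun_of_L2 Abs_L2
  by (rule exI[of _ 0]) (simp only: mem_Collect_eq square_integrable_iff square_integrable_0)

lemma square_integrable_L2: "square_integrable (ae_fun_of_L2 x)"
  using ae_fun_of_L2[of x] by (simp add: square_integrable_iff[symmetric])

setup_lifting type_definition_L2

instantiation L2 :: (euclidean_space) complex_inner
begin

lift_definition zero_L2 :: "'a L2" is 0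
  by (simp only: square_integrable_iff square_integrable_0)

lift_definition plus_L2 :: "'a L2 \<Rightarrow> 'a L2 \<Rightarrow> 'a L2" is "(+)"
  by (simp only: square_integrable_iff square_integrable_add)

lift_definition minus_L2 :: "'a L2 \<Rightarrow> 'a L2 \<Rightarrow> 'a L2" is "(-)"
  by (simp only: square_integrable_iff square_integrable_diff)

lift_definition uminus_L2 :: "'a L2 \<Rightarrow> 'a L2" is uminus
  by (simp only: square_integrable_iff square_integrable_uminus)

lift_definition scaleC_L2 :: "complex \<Rightarrow> 'a L2 \<Rightarrow> 'a L2" is scaleC
  by (simp only: square_integrable_iff square_integrable_scaleC)

definition scaleR_L2 :: "real \<Rightarrow> 'a L2 \<Rightarrow> 'a L2" where
  "scaleR_L2 r x = complex_of_real r *\<^sub>C x"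

lift_definition cinner_L2 :: "'a L2 \<Rightarrow> 'a L2 \<Rightarrow> complex"
  is "\<lambda>f g. ae_integral (ae_mult f (ae_cnj g))" .

definition inner_L2 :: "'a L2 \<Rightarrow> 'a L2 \<Rightarrow> real" where
  "inner_L2 x y = Re (cinner x y)"

definition norm_L2 :: "'a L2 \<Rightarrow> real" where
  "norm_L2 x = sqrt (inner x x)"

definition sgn_L2 :: "'a L2 \<Rightarrow> 'a L2" where
  "sgn_L2 x = scaleR (inverse (norm x)) x"

definition dist_L2 :: "'a L2 \<Rightarrow> 'a L2 \<Rightarrow> real" where
  "dist_L2 x y = norm (x - y)"

definition uniformity_L2 :: "('a L2 \<times> 'a L2) filter" where
  "uniformity_L2 = (INF e\<in>{0 <..}. principal {(x, y). dist x y < e})"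

definition open_L2 :: "'a L2 set \<Rightarrow> bool" where
  "open_L2 U \<longleftrightarrow> (\<forall>x\<in>U. \<forall>\<^sub>F (x', y) in uniformity. x' = x \<longrightarrow> y \<in> U)"

instance
proof
  fix x y z :: "'a L2" and c d :: complex and r s :: real
  show "x + y + z = x + (y + z)" "x + y = y + x" "0 + x = x" "- x + x = 0" "x - y = x + - y"
    by (transfer; simp)+
  show C: "c *\<^sub>C (x + y) = c *\<^sub>C x + c *\<^sub>C y" for c and x y :: "'a L2"
    by transfer (rule scaleC_add_right)
  show C2: "(c + d) *\<^sub>C x = c *\<^sub>C x + d *\<^sub>C x" for c d and x :: "'a L2"
    by transfer (rule scaleC_add_left)
  show C3: "c *\<^sub>C d *\<^sub>C x = (c * d) *\<^sub>C x" for c d and x :: "'a L2"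
    by transfer (rule scaleC_scaleC)
  show "complex_of_real r *\<^sub>C x = r *\<^sub>R x"
    by (simp add: scaleR_L2_def)
  show "r *\<^sub>R (x + y) = r *\<^sub>R x + r *\<^sub>R y" "(r + s) *\<^sub>R x = r *\<^sub>R x + s *\<^sub>R x"
    "r *\<^sub>R s *\<^sub>R x = (r * s) *\<^sub>R x"
    by (simp_all add: scaleR_L2_def C C2 C3)
  show "1 *\<^sub>R x = x"
    unfolding scaleR_L2_def by transfer (simp only: scaleC_of_real scaleR_one)
  show comm: "cinner x y = cnj (cinner y x)" for x y :: "'a L2"
    by transfer (simp only: ae_integral_cnj[symmetric] ae_mult_simps(7,8), simp only: ae_mult_simps(9))
  show add: "cinner (x + y) z = cinner x z + cinner y z"
    using square_integrable_L2[of x] square_integrable_L2[of y] square_integrable_L2[of z]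
    by transfer (simp add: ae_mult_simps(1) ae_integral_add ae_integrable_mult_cnj)
  show scale: "cinner (c *\<^sub>C x) y = c * cinner x y" for c
    by transfer (simp add: ae_mult_simps(3) ae_integral_scaleC)
  show "Re (cinner x y) = x \<bullet> y"
    by (simp add: inner_L2_def)
  show "x \<bullet> y = y \<bullet> x"
    unfolding inner_L2_def by (subst comm) simp
  show "(x + y) \<bullet> z = x \<bullet> z + y \<bullet> z"
    by (simp add: inner_L2_def add)
  show "r *\<^sub>R x \<bullet> y = r * (x \<bullet> y)"
    by (simp add: inner_L2_def scaleR_L2_def scale)
  show "0 \<le> x \<bullet> x"
    unfolding inner_L2_def by transfer (rule Re_ae_integral_nonneg)
  have "x = 0" if "x \<bullet> x = 0"
    using that square_integrable_L2[of x] unfolding inner_L2_def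
    by transfer (auto intro: Re_ae_integral_eq_0)
  moreover have "(0 :: 'a L2) \<bullet> 0 = 0"
    unfolding inner_L2_def by transfer (transfer, simp)
  ultimately show "x \<bullet> x = 0 \<longleftrightarrow> x = 0"
    by auto
qed (simp_all only: norm_L2_def sgn_L2_def dist_L2_def uniformity_L2_def open_L2_def)

end


section \<open>Schatten classes\<close>

text \<open>\<^typ>\<open>'a \<Rightarrow>\<^sub>L 'a\<close> only enforces real linearity.\<close>

definition bounded_ops :: "('a::complex_inner \<Rightarrow>\<^sub>L 'a) set" where
  "bounded_ops = {A. \<forall>c x. blinfun_apply A (c *\<^sub>C x) = c *\<^sub>C blinfun_apply A x}"

definition orthonormal_basis :: "'a::complex_inner set \<Rightarrow> bool" where
  "orthonormal_basis E \<longleftrightarrow>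
    (\<forall>x\<in>E. \<forall>y\<in>E. cinner x y = (if x = y then 1 else 0)) \<and>
    (\<forall>x. (\<forall>e\<in>E. cinner x e = 0) \<longrightarrow> x = 0)"

definition op_adjoint :: "('a::complex_inner \<Rightarrow>\<^sub>L 'a) \<Rightarrow> ('a \<Rightarrow>\<^sub>L 'a)" where
  "op_adjoint A = (THE B. \<forall>x y. cinner (blinfun_apply A x) y = cinner x (blinfun_apply B y))"

definition op_poly :: "real poly \<Rightarrow> ('a::real_normed_vector \<Rightarrow>\<^sub>L 'a) \<Rightarrow> ('a \<Rightarrow>\<^sub>L 'a)" where
  "op_poly u T = (\<Sum>k\<le>degree u. coeff u k *\<^sub>R ((o\<^sub>L) T ^^ k) id_blinfun)"

text \<open>The continuous functional calculus for a positive operator \<open>T\<close>, whose spectrum lies in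
  \<open>[0, \<parallel>T\<parallel>]\<close>: \<open>f(T)\<close> is the limit in operator norm of \<open>u\<^sub>k(T)\<close> for every sequence of polynomials
  \<open>u\<^sub>k\<close> converging to \<open>f\<close> uniformly on \<open>[0, \<parallel>T\<parallel>]\<close>.\<close>

definition op_fun :: "(real \<Rightarrow> real) \<Rightarrow> ('a::real_normed_vector \<Rightarrow>\<^sub>L 'a) \<Rightarrow> ('a \<Rightarrow>\<^sub>L 'a)" where
  "op_fun f T = (THE S. \<forall>u :: nat \<Rightarrow> real poly.
    uniform_limit {0..norm T} (\<lambda>k x. poly (u k) x) f sequentially \<longrightarrow>
    (\<lambda>k. op_poly (u k) T) \<longlonglongrightarrow> S)"

definition op_abs :: "('a::complex_inner \<Rightarrow>\<^sub>L 'a) \<Rightarrow> ('a \<Rightarrow>\<^sub>L 'a)" where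
  "op_abs A = op_fun sqrt (op_adjoint A o\<^sub>L A)"

text \<open>Traces are computed in one arbitrary orthonormal basis; they do not depend on it for positive
  operators, where the value may be infinite, nor for trace class operators.\<close>

definition pos_trace :: "('a::complex_inner \<Rightarrow>\<^sub>L 'a) \<Rightarrow> ennreal" where
  "pos_trace T = (\<Sum>\<^sub>\<infinity>e\<in>(SOME E. orthonormal_basis E). ennreal (Re (cinner (T e) e)))"

definition op_trace :: "('a::complex_inner \<Rightarrow>\<^sub>L 'a) \<Rightarrow> complex" where
  "op_trace A = (\<Sum>\<^sub>\<infinity>e\<in>(SOME E. orthonormal_basis E). cinner (A e) e)"

definition schatten_norm :: "ennreal \<Rightarrow> ('a::complex_inner \<Rightarrow>\<^sub>L 'a) \<Rightarrow> ennreal" where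
  "schatten_norm p A = (if p = \<infinity> then ennreal (norm A)
    else ennreal_powr (pos_trace (op_fun (\<lambda>t. t powr enn2real p) (op_abs A))) (1 / enn2real p))"

definition schatten_class :: "ennreal \<Rightarrow> ('a::complex_inner \<Rightarrow>\<^sub>L 'a) set" where
  "schatten_class p = {A \<in> bounded_ops. schatten_norm p A < \<infinity>}"


section \<open>Quantum noncommutative Lebesgue spaces\<close>

text \<open>Functions on the phase space \<open>\<real>\<^sup>2\<^sup>n\<close> paired with operators on \<open>L\<^sup>2(\<real>\<^sup>n)\<close>.\<close>

type_synonym 'n qha =
  "(real ^ ('n + 'n)) ae_fun \<times> ((real ^ 'n) L2 \<Rightarrow>\<^sub>L (real ^ 'n) L2)"

definition qha_norm :: "ennreal \<Rightarrow> 'n::finite qha \<Rightarrow> ennreal" where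
  "qha_norm p x = Lp_norm p (fst x) + schatten_norm p (snd x)"

text \<open>The ambient space consists of all pairs of a measurable function and a bounded operator, so
  this is \<open>L\<^sup>p \<oplus> T\<^sup>p\<close>, where \<open>T\<^sup>\<infinity>\<close> is the space of all bounded operators. Elements of
  \<open>L\<^sup>1 \<oplus> T\<^sup>1\<close> alone would not be enough for duality: for \<open>p = 1\<close>, the functional
  \<open>(f, A) \<mapsto> \<integral> f + tr A\<close> is represented by \<open>(1, I)\<close> only.\<close>

definition Lp_QHA :: "ennreal \<Rightarrow> 'n::finite qha set" where
  "Lp_QHA p = {(f, A). A \<in> bounded_ops \<and> qha_norm p (f, A) < \<infinity>}"

definition qha_pairing :: "'n::finite qha \<Rightarrow> 'n qha \<Rightarrow> complex" where
  "qha_pairing x y = ae_integral (ae_mult (fst x) (fst y)) + op_trace (snd x o\<^sub>L snd y)"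

text \<open>Functionals on \<open>Lp_QHA p\<close> are functions on the ambient space that are \<open>undefined\<close> outside
  \<open>Lp_QHA p\<close>, so that equality of functionals is equality on \<open>Lp_QHA p\<close>.\<close>

definition qha_dual :: "ennreal \<Rightarrow> ('n::finite qha \<Rightarrow> complex) set" where
  "qha_dual p = {\<phi> \<in> extensional (Lp_QHA p).
    (\<forall>x\<in>Lp_QHA p. \<forall>y\<in>Lp_QHA p. \<phi> (x + y) = \<phi> x + \<phi> y) \<and>
    (\<forall>c. \<forall>x\<in>Lp_QHA p. \<phi> (c *\<^sub>C x) = c * \<phi> x) \<and>
    (\<exists>C. \<forall>x\<in>Lp_QHA p. cmod (\<phi> x) \<le> C * enn2real (qha_norm p x))}"

definition qha_dual_norm :: "ennreal \<Rightarrow> ('n::finite qha \<Rightarrow> complex) \<Rightarrow> ennreal" where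
  "qha_dual_norm p \<phi> = (SUP x\<in>{x \<in> Lp_QHA p. qha_norm p x \<le> 1}. ennreal (cmod (\<phi> x)))"

definition qha_dual_map :: "ennreal \<Rightarrow> 'n::finite qha \<Rightarrow> ('n qha \<Rightarrow> complex)" where
  "qha_dual_map p y = restrict (\<lambda>x. qha_pairing x y) (Lp_QHA p)"

end

theory Submission
  imports Defs "HOL-Computational_Algebra.Fundamental_Theorem_Algebra"
begin

text \<open>The pairing splits into the pairing of \<open>L\<^sup>p\<close> with \<open>L\<^sup>q\<close> and the trace pairing of
\<open>T\<^sup>p\<close> with \<open>T\<^sup>q\<close>, and a functional on a direct sum is a pair of functionals, so the
theorem is the conjunction of the two classical dualities. The dual of the sum norm is the maximum of
the two dual norms, which accounts for the constant \<open>1/2\<close> in the lower norm bound.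

Both dualities are proved in the same three steps.
  \<^item> Hoelder's inequality makes the pairing well defined and bounded
    (\<open>Lp_Holder\<close>, \<open>schatten_compose\<close>, \<open>schatten_trace_bound\<close>).
  \<^item> Hoelder's inequality is sharp: if the pairings of an element with explicit test elements are at
    most \<open>C\<close> times their norms, then its \<open>q\<close>-norm is at most \<open>C\<close>
    (\<open>Lp_norm_le_of_pairing\<close>, \<open>schatten_norm_le_of_pairing\<close>). The extremal test element is the
    conjugate phase of \<open>g\<close> times \<open>|g|\<close> to the power \<open>q - 1\<close>, suitably truncated, and its analogue of
    finite rank. This gives injectivity and the lower norm bound.
  \<^item> A given functional is represented on the test elements, by the Radon-Nikodym theorem for functions
    and by the sesquilinear form of its values on rank one operators for operators. By the second step
    the representing element has finite \<open>q\<close>-norm, and since \<open>p < \<infinity>\<close> the test elements are dense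
    (\<open>Lp_functional_representation\<close>, \<open>schatten_functional_representation\<close>).

Schatten norms become tractable through singular bases. An operator \<open>A\<close> of finite Schatten norm is
compact, so \<open>A\<^sup>*A\<close> has an orthonormal basis of eigenvectors \<open>e\<close>; on such a basis the images \<open>A e\<close> are
pairwise orthogonal, and the Schatten norm of \<open>A\<close> is the \<open>p\<close>-norm of the family of numbers
\<open>\<parallel>A e\<parallel>\<close> (\<open>schatten_norm_singular\<close>). Everything about Schatten norms then follows from one inequality,
\<open>schatten_pairing_bound\<close>: the matrix entries of \<open>A\<close> along two Bessel families are dominated by averages of the
singular values with doubly substochastic weights, so that Jensen's inequality bounds their
\<open>p\<close>-norm. It replaces the triangle inequality, proves Hoelder's inequality for products, and shows that
traces converge absolutely in every orthonormal basis.

The functional calculus that defines \<open>|A|\<^sup>p\<close> rests on the bound of \<open>\<parallel>u(T)\<parallel>\<close> by the maximum of \<open>|u|\<close>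
over \<open>[0, \<parallel>T\<parallel>]\<close> for polynomials \<open>u\<close>, which is spectral mapping in disguise
(\<open>op_poly_norm_le\<close>). The operator theory needs a complete space; completeness of the space of square
integrable functions comes for free from the duality of functions at \<open>p = 2\<close>, since a dual space is
complete (\<open>L2_Cauchy_convergent\<close>).\<close>

section \<open>Complex Hilbert spaces\<close>

lemma cinner_zero_left [simp]: "cinner 0 y = 0" for y :: "'a::complex_inner"
  using cinner_add_left[of 0 0 y] by simp

lemma cinner_zero_right [simp]: "cinner y 0 = 0" for y :: "'a::complex_inner"
  by (subst cinner_commute) simp

lemma cinner_add_right: "cinner x (y + z) = cinner x y + cinner x z" for x :: "'a::complex_inner"
  by (metis cinner_add_left cinner_commute complex_cnj_add)

lemma cinner_scaleC_right: "cinner x (c *\<^sub>C y) = cnj c * cinner x y" for x :: "'a::complex_inner"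
  by (metis cinner_scaleC_left cinner_commute complex_cnj_mult)

lemma cmod_cinner_le: "cmod (cinner x y) \<le> norm x * norm y" for x :: "'a::complex_inner"
proof (cases "cinner x y = 0")
  case False
  define c where "c = cnj (cinner x y) / cmod (cinner x y)"
  have c: "cmod c = 1" using False by (simp add: c_def norm_divide)
  have "cinner (c *\<^sub>C x) y = cmod (cinner x y)"
    using False by (simp add: c_def cinner_scaleC_left complex_norm_square[symmetric]
        mult.commute power2_eq_square)
  then have "cmod (cinner x y) = inner (c *\<^sub>C x) y"
    by (metis Re_cinner Re_complex_of_real)
  also have "\<dots> \<le> norm (c *\<^sub>C x) * norm y"
    by (rule norm_cauchy_schwarz)
  finally show ?thesis by (simp add: norm_scaleC c)
qed simp

lemma bounded_bilinear_cinner: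
  "bounded_bilinear (cinner :: 'a::complex_inner \<Rightarrow> 'a \<Rightarrow> complex)"
proof
  show "\<exists>K. \<forall>a b :: 'a. norm (cinner a b) \<le> norm a * norm b * K"
    by (rule exI[of _ 1]) (simp add: cmod_cinner_le)
qed (simp_all add: cinner_add_left cinner_add_right scaleC_of_real[symmetric] cinner_scaleC_left
    cinner_scaleC_right scaleR_conv_of_real)

interpretation cinner: bounded_bilinear "cinner :: 'a::complex_inner \<Rightarrow> 'a \<Rightarrow> complex"
  by (rule bounded_bilinear_cinner)

lemma scaleC_one [simp]: "1 *\<^sub>C x = x" for x :: "'a::complex_vector"
  using scaleC_of_real[of 1 x] by simp

lemma scaleC_zero_left [simp]: "0 *\<^sub>C x = 0" for x :: "'a::complex_vector"
  using scaleC_of_real[of 0 x] by simp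

lemma scaleC_zero_right [simp]: "c *\<^sub>C 0 = 0" for c :: complex
  using scaleC_add_right[of c 0 0] by simp

lemma scaleC_minus1: "(- 1) *\<^sub>C x = - x" for x :: "'a::complex_vector"
  using scaleC_of_real[of "- 1" x] by simp

lemma scaleC_diff_right: "c *\<^sub>C (x - y) = c *\<^sub>C x - c *\<^sub>C y" for x :: "'a::complex_vector"
  by (metis add_diff_cancel_right' diff_add_cancel scaleC_add_right)

lemma bounded_linear_scaleC_left: "bounded_linear (\<lambda>c. c *\<^sub>C (x::'a::complex_inner))"
  by (rule bounded_linear_intro[where K = "norm x"])
    (auto simp: scaleC_add_left norm_scaleC scaleC_of_real[symmetric] scaleC_scaleC
      scaleR_conv_of_real)

lemma bounded_linear_scaleC_right: "bounded_linear (\<lambda>x::'a::complex_inner. c *\<^sub>C x)"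
  by (rule bounded_linear_intro[where K = "cmod c"])
    (auto simp: scaleC_add_right scaleC_scaleR_commute norm_scaleC)

lemma cinner_ext:
  fixes x y :: "'a::complex_inner"
  assumes "\<And>z. cinner x z = cinner y z"
  shows "x = y"
proof -
  have "cinner (x - y) (x - y) = 0"
    using assms by (simp add: cinner.diff_left)
  then show ?thesis by (simp add: cinner_same)
qed

lemma cmod_cinner_same: "cmod (cinner x x) = (norm x)\<^sup>2" for x :: "'a::complex_inner"
  by (simp add: cinner_same norm_power)

subsection \<open>Orthonormal sets\<close>

definition ortho_set :: "'a::complex_inner set \<Rightarrow> bool" where
  "ortho_set E \<longleftrightarrow> (\<forall>x\<in>E. \<forall>y\<in>E. cinner x y = (if x = y then 1 else 0))"

lemma orthonormal_basisD: "orthonormal_basis E \<Longrightarrow> ortho_set E"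
  by (simp add: orthonormal_basis_def ortho_set_def)

lemma ortho_set_subset: "ortho_set E \<Longrightarrow> F \<subseteq> E \<Longrightarrow> ortho_set F"
  unfolding ortho_set_def by blast

lemma ortho_set_cinner: "ortho_set E \<Longrightarrow> x \<in> E \<Longrightarrow> y \<in> E \<Longrightarrow> cinner x y = (if x = y then 1 else 0)"
  unfolding ortho_set_def by blast

lemma ortho_set_norm: "ortho_set E \<Longrightarrow> x \<in> E \<Longrightarrow> norm x = 1"
  by (metis Re_cinner norm_eq_1 one_complex.sel(1) ortho_set_cinner)

lemma cinner_sum_ortho:
  assumes "ortho_set F" "finite F" "e \<in> F"
  shows "cinner (\<Sum>x\<in>F. c x *\<^sub>C x) e = c e"
proof -
  have "cinner (\<Sum>x\<in>F. c x *\<^sub>C x) e = (\<Sum>x\<in>F. c x * (if x = e then 1 else 0))"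
    unfolding cinner.sum_left
    by (rule sum.cong) (use assms in \<open>auto simp: cinner_scaleC_left ortho_set_def\<close>)
  also have "\<dots> = c e" using assms by (simp add: sum.delta' if_distrib cong: if_cong)
  finally show ?thesis .
qed

lemma norm_sum_ortho:
  assumes "ortho_set F" "finite F"
  shows "(norm (\<Sum>x\<in>F. c x *\<^sub>C x))\<^sup>2 = (\<Sum>x\<in>F. (cmod (c x))\<^sup>2)"
proof -
  let ?S = "\<Sum>x\<in>F. c x *\<^sub>C x"
  have "cinner ?S ?S = (\<Sum>x\<in>F. cnj (c x) * cinner ?S x)"
    by (simp add: cinner.sum_right cinner_scaleC_right)
  also have "\<dots> = (\<Sum>x\<in>F. complex_of_real ((cmod (c x))\<^sup>2))"
    by (rule sum.cong) (use assms in \<open>auto simp: cinner_sum_ortho complex_norm_square[symmetric] mult.commute\<close>)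
  finally have "complex_of_real ((norm ?S)\<^sup>2) = complex_of_real (\<Sum>x\<in>F. (cmod (c x))\<^sup>2)"
    by (simp add: cinner_same)
  then show ?thesis by (simp only: of_real_eq_iff)
qed

lemma bessel:
  assumes F: "ortho_set F" "finite F"
  shows "(\<Sum>e\<in>F. (cmod (cinner x e))\<^sup>2) \<le> (norm x)\<^sup>2"
proof -
  let ?P = "\<Sum>e\<in>F. cinner x e *\<^sub>C e"
  have "cinner (x - ?P) e = 0" if "e \<in> F" for e
    using that F by (simp add: cinner.diff_left cinner_sum_ortho)
  then have "cinner (x - ?P) ?P = 0"
    by (simp add: cinner.sum_right cinner_scaleC_right)
  then have "inner (x - ?P) ?P = 0"
    by (metis Re_cinner zero_complex.sel(1))
  then have "(norm ((x - ?P) + ?P))\<^sup>2 = (norm (x - ?P))\<^sup>2 + (norm ?P)\<^sup>2"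
    by (intro norm_add_Pythagorean) (simp add: orthogonal_def)
  then have "(norm x)\<^sup>2 = (norm (x - ?P))\<^sup>2 + (norm ?P)\<^sup>2" by simp
  then show ?thesis by (simp add: norm_sum_ortho F)
qed

lemma summable_on_small_tail:
  fixes f :: "'b \<Rightarrow> real"
  assumes f: "f summable_on E" "\<And>e. e \<in> E \<Longrightarrow> f e \<ge> 0" and "\<epsilon> > 0"
  obtains F where "finite F" "F \<subseteq> E" "\<And>G. finite G \<Longrightarrow> G \<subseteq> E - F \<Longrightarrow> sum f G \<le> \<epsilon>"
proof -
  obtain F where F: "finite F" "F \<subseteq> E" "dist (sum f F) (infsum f E) \<le> \<epsilon>"
    using infsum_finite_approximation[OF f(1) assms(3)] by blast
  show thesis
  proof (rule that[OF F(1,2)])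
    fix G assume G: "finite G" "G \<subseteq> E - F"
    have "sum f F + sum f G = sum f (F \<union> G)"
      using G F by (intro sum.union_disjoint[symmetric]) auto
    also have "\<dots> \<le> infsum f E"
      using G F f by (intro finite_sum_le_infsum) auto
    finally show "sum f G \<le> \<epsilon>" using F(3) by (simp add: dist_real_def)
  qed
qed

lemma summable_on_bounded_sums:
  fixes f :: "'b \<Rightarrow> real"
  assumes "\<And>e. e \<in> E \<Longrightarrow> f e \<ge> 0" "\<And>F. finite F \<Longrightarrow> F \<subseteq> E \<Longrightarrow> sum f F \<le> K"
  shows "f summable_on E"
  using assms by (intro nonneg_bdd_above_summable_on bdd_aboveI2[where M = K]) auto

text \<open>Finite partial sums differ, by Pythagoras, by the square root of a tail of the square summable
coefficients, so the net of partial sums is Cauchy.\<close>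

lemma ortho_series_summable:
  fixes E :: "'a::{complex_inner,banach} set"
  assumes E: "ortho_set E"
    and K: "\<And>F. finite F \<Longrightarrow> F \<subseteq> E \<Longrightarrow> (\<Sum>e\<in>F. (cmod (c e))\<^sup>2) \<le> K"
  shows "(\<lambda>e. c e *\<^sub>C e) summable_on E"
proof -
  let ?f = "\<lambda>e. c e *\<^sub>C e"
  have s: "(\<lambda>e. (cmod (c e))\<^sup>2) summable_on E"
    by (rule summable_on_bounded_sums[where K = K]) (auto intro: K)
  have "\<exists>P. eventually P (finite_subsets_at_top E) \<and>
      (\<forall>F F'. P F \<and> P F' \<longrightarrow> dist (sum ?f F) (sum ?f F') < d)" if "d > 0" for d
  proof -
    obtain F0 where F0: "finite F0" "F0 \<subseteq> E"
      "\<And>G. finite G \<Longrightarrow> G \<subseteq> E - F0 \<Longrightarrow> (\<Sum>e\<in>G. (cmod (c e))\<^sup>2) \<le> (d/3)\<^sup>2"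
      using summable_on_small_tail[OF s, of "(d/3)\<^sup>2"] \<open>d > 0\<close> by auto
    have near: "dist (sum ?f F) (sum ?f F0) \<le> d/3" if F: "finite F" "F0 \<subseteq> F" "F \<subseteq> E" for F
    proof -
      have "sum ?f F - sum ?f F0 = sum ?f (F - F0)"
        using F by (simp add: sum_diff)
      moreover have "(norm (sum ?f (F - F0)))\<^sup>2 \<le> (d/3)\<^sup>2"
        using F E by (subst norm_sum_ortho) (auto intro!: F0 intro: ortho_set_subset)
      ultimately show ?thesis
        using \<open>d > 0\<close> by (simp add: dist_norm power2_le_iff_abs_le)
    qed
    have "dist (sum ?f F) (sum ?f F') < d"
      if "finite F" "F0 \<subseteq> F" "F \<subseteq> E" "finite F'" "F0 \<subseteq> F'" "F' \<subseteq> E" for F F'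
      using near[of F] near[of F'] that \<open>d > 0\<close> dist_triangle2[of "sum ?f F" "sum ?f F'" "sum ?f F0"]
      by linarith
    then show ?thesis
      using F0(1,2)
      by (intro exI[of _ "\<lambda>F. finite F \<and> F0 \<subseteq> F \<and> F \<subseteq> E"])
        (auto simp: eventually_finite_subsets_at_top)
  qed
  then have "cauchy_filter (filtermap (sum ?f) (finite_subsets_at_top E))"
    by (simp add: cauchy_filter_metric_filtermap)
  moreover have "complete (UNIV::'a set)"
    by (meson Cauchy_convergent UNIV_I complete_def convergent_def)
  ultimately obtain L' where "(sum ?f \<longlongrightarrow> L') (finite_subsets_at_top E)"
    using complete_uniform[where S=UNIV] by (force simp add: filterlim_def)
  then show ?thesis
    using summable_on_def has_sum_def by blast
qed

lemma has_sum_single: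
  "x \<in> A \<Longrightarrow> (\<And>y. y \<in> A \<Longrightarrow> y \<noteq> x \<Longrightarrow> f y = 0) \<Longrightarrow> (f has_sum (f x :: 'b::{topological_comm_monoid_add,t2_space})) A"
  by (rule has_sum_finite_neutralI[where B = "{x}"]) auto

lemma ortho_series_coeff:
  assumes E: "ortho_set E" and s: "((\<lambda>e. c e *\<^sub>C e) has_sum s) E" and "e \<in> E"
  shows "cinner s e = c e"
proof -
  have "((\<lambda>x. cinner (c x *\<^sub>C x) e) has_sum cinner s e) E"
    by (rule has_sum_bounded_linear[OF cinner.bounded_linear_left s])
  moreover have "((\<lambda>x. cinner (c x *\<^sub>C x) e) has_sum cinner (c e *\<^sub>C e) e) E"
    using E \<open>e \<in> E\<close> by (intro has_sum_single) (auto simp: cinner_scaleC_left ortho_set_def)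
  ultimately have "cinner s e = cinner (c e *\<^sub>C e) e"
    by (rule has_sum_unique)
  then show ?thesis using E \<open>e \<in> E\<close> by (simp add: cinner_scaleC_left ortho_set_def)
qed

text \<open>The difference of \<open>x\<close> and the sum
of its Fourier series is orthogonal to every basis vector, hence zero by maximality of the basis.\<close>

lemma onb_expansion:
  fixes x :: "'a::{complex_inner,banach}"
  assumes E: "orthonormal_basis E"
  shows "((\<lambda>e. cinner x e *\<^sub>C e) has_sum x) E"
proof -
  note oE = orthonormal_basisD[OF E]
  have "(\<lambda>e. cinner x e *\<^sub>C e) summable_on E"
    by (rule ortho_series_summable[OF oE, where K = "(norm x)\<^sup>2"]) (auto intro!: bessel ortho_set_subset[OF oE])
  then obtain s where s: "((\<lambda>e. cinner x e *\<^sub>C e) has_sum s) E"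
    by (auto simp: summable_on_def)
  have "cinner (x - s) e = 0" if "e \<in> E" for e
    using ortho_series_coeff[OF oE s that] by (simp add: cinner.diff_left)
  then have "x - s = 0" using E unfolding orthonormal_basis_def by blast
  with s show ?thesis by simp
qed

lemma parseval:
  fixes x :: "'a::{complex_inner,banach}"
  assumes "orthonormal_basis E"
  shows "((\<lambda>e. cinner x e * cinner e y) has_sum cinner x y) E"
  using has_sum_bounded_linear[OF cinner.bounded_linear_left onb_expansion[OF assms, of x], of y]
  by (simp add: cinner_scaleC_left)

lemma parseval_norm:
  fixes x :: "'a::{complex_inner,banach}"
  assumes "orthonormal_basis E"
  shows "((\<lambda>e. (cmod (cinner x e))\<^sup>2) has_sum (norm x)\<^sup>2) E"
proof -
  have "((\<lambda>e. Re (cinner x e * cinner e x)) has_sum Re (cinner x x)) E"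
    by (rule has_sum_Re[OF parseval[OF assms]])
  moreover have "Re (cinner x e * cinner e x) = (cmod (cinner x e))\<^sup>2" for e
    by (metis cinner_commute complex_norm_square Re_complex_of_real)
  ultimately show ?thesis by (simp add: cinner_same)
qed

text \<open>Zorn's lemma relative to a set \<open>S\<close>: with all vectors for \<open>S\<close> it yields orthonormal bases, with the
eigenvectors of an operator for \<open>S\<close> it yields the spectral theorem.\<close>

lemma ortho_set_maximal:
  assumes "ortho_set F" "F \<subseteq> S"
  obtains E where "F \<subseteq> E" "E \<subseteq> S" "ortho_set E"
    "\<forall>E'. ortho_set E' \<longrightarrow> E \<subseteq> E' \<longrightarrow> E' \<subseteq> S \<longrightarrow> E' = E"
proof -
  let ?A = "{E. F \<subseteq> E \<and> E \<subseteq> S \<and> ortho_set E}"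
  have "\<exists>M\<in>?A. \<forall>X\<in>?A. M \<subseteq> X \<longrightarrow> X = M"
  proof (rule subset_Zorn_nonempty)
    show "?A \<noteq> {}" using assms by auto
    fix C assume C: "C \<noteq> {}" "subset.chain ?A C"
    then have sub: "C \<subseteq> ?A" and ch: "\<And>X Y. X \<in> C \<Longrightarrow> Y \<in> C \<Longrightarrow> X \<subseteq> Y \<or> Y \<subseteq> X"
      by (auto simp: subset_chain_def)
    have "ortho_set (\<Union>C)"
      unfolding ortho_set_def
    proof (intro ballI)
      fix x y assume "x \<in> \<Union>C" "y \<in> \<Union>C"
      then obtain X Y where XY: "X \<in> C" "Y \<in> C" "x \<in> X" "y \<in> Y" by auto
      then obtain Z where "Z \<in> C" "x \<in> Z" "y \<in> Z" using ch[of X Y] by auto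
      then show "cinner x y = (if x = y then 1 else 0)" using sub by (auto simp: ortho_set_def)
    qed
    then show "\<Union>C \<in> ?A" using sub C(1) by auto
  qed
  then obtain M where M: "F \<subseteq> M" "M \<subseteq> S" "ortho_set M"
    "\<And>X. F \<subseteq> X \<Longrightarrow> X \<subseteq> S \<Longrightarrow> ortho_set X \<Longrightarrow> M \<subseteq> X \<Longrightarrow> X = M" by auto
  show thesis using that[OF M(1-3)] M(1,4) by (meson subset_trans)
qed

lemma ortho_set_insert:
  assumes "ortho_set E" "norm x = 1" "\<And>e. e \<in> E \<Longrightarrow> cinner x e = 0"
  shows "ortho_set (insert x E)"
proof -
  have 1: "cinner e x = 0" if "e \<in> E" for e
    using assms(3)[OF that] by (metis cinner_commute complex_cnj_zero)
  have 2: "cinner x x = 1" using assms(2) by (simp add: cinner_same)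
  have *: "cinner a b = (if a = b then 1 else 0)"
    if ab: "a \<in> insert x E" "b \<in> insert x E" for a b
  proof -
    consider "a = x" "b = x" | "a = x" "b \<noteq> x" "b \<in> E" | "a \<noteq> x" "b = x" "a \<in> E" | "a \<in> E" "b \<in> E"
      using ab by blast
    then show ?thesis
      by cases (use 1 2 assms(3) ortho_set_cinner[OF assms(1)] in simp_all)
  qed
  show ?thesis unfolding ortho_set_def by (intro ballI) (rule *)
qed

lemma ortho_set_extend:
  assumes "ortho_set (F::'a::complex_inner set)"
  obtains E where "F \<subseteq> E" "orthonormal_basis E"
proof -
  obtain E where E1: "F \<subseteq> E" and E: "ortho_set E"
    "\<forall>E'. ortho_set E' \<longrightarrow> E \<subseteq> E' \<longrightarrow> E' \<subseteq> UNIV \<longrightarrow> E' = E"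
    using ortho_set_maximal[OF assms subset_UNIV] by metis
  have "x = 0" if x: "\<forall>e\<in>E. cinner x e = 0" for x
  proof (rule ccontr)
    assume "x \<noteq> 0"
    define u where "u = complex_of_real (1 / norm x) *\<^sub>C x"
    have u: "norm u = 1" using \<open>x \<noteq> 0\<close> by (simp add: u_def norm_scaleC norm_divide)
    have ue: "cinner u e = 0" if "e \<in> E" for e using x that by (simp add: u_def cinner_scaleC_left)
    have "insert u E = E" using ortho_set_insert[OF E(1) u ue] by (intro E(2)[rule_format]) auto
    then have "cinner u u = 0" using ue by blast
    then show False using u by (simp add: cinner_same)
  qed
  then have "orthonormal_basis E" using E(1) by (simp add: orthonormal_basis_def ortho_set_def)
  then show thesis using that E1 by blast
qed

lemma some_orthonormal_basis: "orthonormal_basis (SOME E :: 'a::complex_inner set. orthonormal_basis E)"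
  by (rule someI_ex) (metis ortho_set_def ortho_set_extend empty_iff)

subsection \<open>Bounded operators and adjoints\<close>

lemma bounded_opsD: "A \<in> bounded_ops \<Longrightarrow> blinfun_apply A (c *\<^sub>C x) = c *\<^sub>C blinfun_apply A x"
  by (simp add: bounded_ops_def)

lemma bounded_ops_zero [simp]: "0 \<in> bounded_ops"
  by (simp add: bounded_ops_def)

lemma bounded_ops_add: "A \<in> bounded_ops \<Longrightarrow> B \<in> bounded_ops \<Longrightarrow> A + B \<in> bounded_ops"
  by (simp add: bounded_ops_def blinfun.add_left scaleC_add_right)

lemma bounded_ops_diff: "A \<in> bounded_ops \<Longrightarrow> B \<in> bounded_ops \<Longrightarrow> A - B \<in> bounded_ops"
  by (simp add: bounded_ops_def blinfun.diff_left scaleC_diff_right)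

lemma bounded_ops_scaleC: "A \<in> bounded_ops \<Longrightarrow> c *\<^sub>C A \<in> bounded_ops"
  by (simp add: bounded_ops_def scaleC_blinfun.rep_eq scaleC_scaleC mult.commute)

lemma bounded_ops_compose: "A \<in> bounded_ops \<Longrightarrow> B \<in> bounded_ops \<Longrightarrow> A o\<^sub>L B \<in> bounded_ops"
  by (simp add: bounded_ops_def)

lemma op_expansion:
  fixes A :: "'a::{complex_inner,banach} \<Rightarrow>\<^sub>L 'a"
  assumes "A \<in> bounded_ops" "orthonormal_basis E"
  shows "((\<lambda>e. cinner x e *\<^sub>C A e) has_sum A x) E"
  using has_sum_bounded_linear[OF blinfun.bounded_linear_right onb_expansion[OF assms(2)], of A x]
  by (simp add: bounded_opsD[OF assms(1)])

text \<open>The representing vector has the Fourier coefficients \<open>cnj (l e)\<close>. They are square summable: applying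
\<open>l\<close> to the finite sum of \<open>cnj (l e) *\<^sub>C e\<close> gives the sum \<open>s\<close> of their squares, which the bound turns into
\<open>s \<le> C * sqrt s\<close>.\<close>

lemma riesz:
  fixes l :: "'a::{complex_inner,banach} \<Rightarrow> complex"
  assumes add: "\<And>x y. l (x + y) = l x + l y" and scale: "\<And>c x. l (c *\<^sub>C x) = c * l x"
    and bound: "\<And>x. cmod (l x) \<le> C * norm x"
  shows "\<exists>b. \<forall>x. l x = cinner x b"
proof -
  let ?E = "SOME E :: 'a set. orthonormal_basis E"
  note onb = some_orthonormal_basis[where 'a = 'a] and oE = orthonormal_basisD[OF some_orthonormal_basis[where 'a = 'a]]
  have lin: "bounded_linear l"
    by (rule bounded_linear_intro[where K = C])
      (auto simp: add scale scaleC_of_real[symmetric] scaleR_conv_of_real bound mult.commute)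
  have lsum: "l (sum f F) = (\<Sum>i\<in>F. l (f i))" for f and F :: "'a set"
    using lin by (simp add: bounded_linear.linear linear_sum)
  have "(\<Sum>e\<in>F. (cmod (cnj (l e)))\<^sup>2) \<le> C\<^sup>2" if F: "finite F" "F \<subseteq> ?E" for F
  proof -
    let ?S = "\<Sum>e\<in>F. (cmod (l e))\<^sup>2"
    let ?x = "\<Sum>e\<in>F. cnj (l e) *\<^sub>C e"
    have "l ?x = complex_of_real ?S"
      by (simp add: lsum scale complex_norm_square[symmetric] mult.commute del: of_real_power)
    then have "?S = cmod (l ?x)" by (simp only: norm_of_real) (simp add: sum_nonneg)
    also have "\<dots> \<le> C * norm ?x" by (rule bound)
    finally have 1: "?S \<le> C * norm ?x" .
    have 2: "(norm ?x)\<^sup>2 = ?S"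
      using norm_sum_ortho[OF ortho_set_subset[OF oE F(2)] F(1), of "\<lambda>e. cnj (l e)"] by simp
    have "norm ?x \<le> C" if "norm ?x > 0"
      using 1[folded 2, unfolded power2_eq_square] that by (rule mult_right_le_imp_le)
    then have "(norm ?x)\<^sup>2 \<le> C\<^sup>2" by (cases "norm ?x > 0") (auto intro: power_mono)
    with 2 show ?thesis by simp
  qed
  then have "(\<lambda>e. cnj (l e) *\<^sub>C e) summable_on ?E"
    by (rule ortho_series_summable[OF oE])
  then obtain b where b: "((\<lambda>e. cnj (l e) *\<^sub>C e) has_sum b) ?E" by (auto simp: summable_on_def)
  have "l x = cinner x b" for x
  proof -
    have eb: "cinner e b = l e" if "e \<in> ?E" for e
      using ortho_series_coeff[OF oE b that] by (subst cinner_commute) simp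
    have "((\<lambda>e. cinner x e * cinner e b) has_sum cinner x b) ?E" by (rule parseval[OF onb])
    moreover have "((\<lambda>e. l (cinner x e *\<^sub>C e)) has_sum l x) ?E"
      by (rule has_sum_bounded_linear[OF lin onb_expansion[OF onb]])
    ultimately show ?thesis
      using has_sum_unique has_sum_cong[of ?E "\<lambda>e. cinner x e * cinner e b" "\<lambda>e. l (cinner x e *\<^sub>C e)"]
      by (metis (no_types, lifting) eb scale)
  qed
  then show ?thesis by blast
qed

lemma norm_le_of_form:
  fixes B :: "'a::complex_inner \<Rightarrow>\<^sub>L 'a"
  assumes "\<And>x y. cmod (cinner (B x) y) \<le> C * norm x * norm y" "C \<ge> 0"
  shows "norm B \<le> C"
proof (rule norm_blinfun_bound[OF assms(2)])
  fix x
  have "norm (B x) * norm (B x) \<le> C * norm x * norm (B x)"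
    using assms(1)[of x "B x"] by (simp add: cmod_cinner_same power2_eq_square)
  then show "norm (B x) \<le> C * norm x"
    by (cases "B x = 0") (auto simp: assms(2))
qed

lemma op_of_form:
  fixes S :: "'a::{complex_inner,banach} \<Rightarrow> 'a \<Rightarrow> complex"
  assumes add: "\<And>x x' y. S (x + x') y = S x y + S x' y"
    and scale: "\<And>c x y. S (c *\<^sub>C x) y = c * S x y"
    and add': "\<And>x y y'. S x (y + y') = S x y + S x y'"
    and scale': "\<And>c x y. S x (c *\<^sub>C y) = cnj c * S x y"
    and bound: "\<And>x y. cmod (S x y) \<le> C * norm x * norm y"
  shows "\<exists>B\<in>bounded_ops. \<forall>x y. cinner (blinfun_apply B x) y = S x y"
proof -
  have "\<exists>b. \<forall>y. cnj (S x y) = cinner y b" for x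
    by (rule riesz[where C = "C * norm x"]) (simp_all add: add' scale' bound)
  then obtain B where B': "\<And>x y. cnj (S x y) = cinner y (B x)" by metis
  have B: "cinner (B x) y = S x y" for x y
    by (metis B' cinner_commute complex_cnj_cnj)
  have addB: "B (x + x') = B x + B x'" for x x'
    by (rule cinner_ext) (simp add: B add cinner_add_left)
  have scaleB: "B (c *\<^sub>C x) = c *\<^sub>C B x" for c x
    by (rule cinner_ext) (simp add: B scale cinner_scaleC_left)
  have C: "norm (B x) \<le> norm x * C" for x
  proof -
    have "norm (B x) * norm (B x) \<le> C * norm x * norm (B x)"
      using bound[of x "B x"] by (simp add: B[symmetric] cmod_cinner_same power2_eq_square)
    moreover have "0 \<le> norm x * C"
    proof (cases "x = 0")
      case False
      have "0 \<le> C * norm x * norm x" using bound[of x x] norm_ge_zero order_trans by blast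
      with False show ?thesis by (simp add: zero_le_mult_iff mult.commute)
    qed simp
    ultimately show ?thesis
      by (cases "B x = 0") (auto simp: mult.commute)
  qed
  have "bounded_linear B"
    by (rule bounded_linear_intro[where K = C])
      (auto simp: addB C scaleC_of_real[symmetric] scaleB)
  then show ?thesis
    by (intro bexI[of _ "Blinfun B"])
      (auto simp: bounded_linear_Blinfun_apply B scaleB bounded_ops_def)
qed

text \<open>The form \<open>(x, y) \<mapsto> cinner x (A y)\<close> is bounded and sesquilinear, so an operator \<open>B\<close> represents it;
\<open>B\<close> is the unique operator picked by the definite description in \<open>op_adjoint\<close>.\<close>

lemma op_adjoint_exists:
  fixes A :: "'a::{complex_inner,banach} \<Rightarrow>\<^sub>L 'a"
  assumes "A \<in> bounded_ops"
  shows "op_adjoint A \<in> bounded_ops \<and> (\<forall>x y. cinner (A x) y = cinner x (op_adjoint A y))"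
proof -
  have "cmod (cinner x (A y)) \<le> norm A * norm x * norm y" for x y
    using order_trans[OF cmod_cinner_le[of x "A y"] mult_left_mono[OF norm_blinfun[of A y] norm_ge_zero[of x]]]
    by (simp add: mult_ac)
  then have "\<exists>B\<in>bounded_ops. \<forall>x y. cinner (blinfun_apply B x) y = cinner x (A y)"
    by (intro op_of_form[where C = "norm A"])
      (auto simp: cinner_add_left cinner_scaleC_left blinfun.add_right cinner_add_right
        bounded_opsD[OF assms] cinner_scaleC_right)
  then obtain B where B: "B \<in> bounded_ops" "\<And>x y. cinner (blinfun_apply B x) y = cinner x (A y)" by auto
  have B2: "cinner (A x) y = cinner x (B y)" for x y
    by (metis B(2) cinner_commute)
  have "op_adjoint A = B"
    unfolding op_adjoint_def
  proof (rule the_equality)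
    fix B' assume B': "\<forall>x y. cinner (A x) y = cinner x (blinfun_apply B' y)"
    show "B' = B"
    proof (rule blinfun_eqI, rule cinner_ext)
      fix y z
      show "cinner (B' y) z = cinner (B y) z" by (metis B' B2 cinner_commute)
    qed
  qed (simp add: B2)
  with B B2 show ?thesis by simp
qed

lemmas op_adjoint_bounded_ops = op_adjoint_exists[THEN conjunct1]
lemmas cinner_op_adjoint = op_adjoint_exists[THEN conjunct2, rule_format]

section \<open>Continuous functional calculus of a positive operator\<close>

definition selfadj :: "('a::complex_inner \<Rightarrow>\<^sub>L 'a) \<Rightarrow> bool" where
  "selfadj T \<longleftrightarrow> (\<forall>x y. cinner (T x) y = cinner x (T y))"

definition pos_op :: "('a::complex_inner \<Rightarrow>\<^sub>L 'a) \<Rightarrow> bool" where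
  "pos_op T \<longleftrightarrow> T \<in> bounded_ops \<and> selfadj T \<and> (\<forall>x. 0 \<le> inner (T x) x)"

lemma selfadjD: "selfadj T \<Longrightarrow> cinner (blinfun_apply T x) y = cinner x (blinfun_apply T y)"
  by (simp add: selfadj_def)

lemma selfadj_inner: "selfadj T \<Longrightarrow> inner (blinfun_apply T x) y = inner x (blinfun_apply T y)"
  by (metis Re_cinner selfadjD)

lemma inner_op_le: "inner (blinfun_apply T x) x \<le> norm T * (norm x)\<^sup>2"
proof -
  have "inner (T x) x \<le> norm (T x) * norm x" by (rule norm_cauchy_schwarz)
  also have "\<dots> \<le> norm T * norm x * norm x" by (intro mult_right_mono norm_blinfun norm_ge_zero)
  finally show ?thesis by (simp add: power2_eq_square)
qed

subsection \<open>Polynomials of an operator\<close>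

lemma op_poly_apply_ge:
  assumes "degree u \<le> n"
  shows "op_poly u T x = (\<Sum>k\<le>n. coeff u k *\<^sub>R (blinfun_apply T ^^ k) x)"
proof -
  have pow: "blinfun_apply (((o\<^sub>L) T ^^ k) id_blinfun) x = (blinfun_apply T ^^ k) x" for k
    by (induction k) auto
  have "op_poly u T x = (\<Sum>k\<le>degree u. coeff u k *\<^sub>R (blinfun_apply T ^^ k) x)"
    by (simp add: op_poly_def blinfun.sum_left blinfun.scaleR_left pow)
  also have "\<dots> = (\<Sum>k\<le>n. coeff u k *\<^sub>R (blinfun_apply T ^^ k) x)"
    using assms by (intro sum.mono_neutral_left) (auto simp: coeff_eq_0)
  finally show ?thesis .
qed

lemma op_poly_0 [simp]: "op_poly 0 T = 0"
  by (simp add: op_poly_def)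

lemma op_poly_add: "op_poly (u + v) T = op_poly u T + op_poly v T"
proof (rule blinfun_eqI)
  fix x
  let ?n = "max (degree u) (degree v)"
  have "degree (u + v) \<le> ?n" by (rule degree_add_le) auto
  then show "blinfun_apply (op_poly (u + v) T) x = blinfun_apply (op_poly u T + op_poly v T) x"
    by (simp add: blinfun.add_left op_poly_apply_ge[where n = ?n] sum.distrib scaleR_add_left)
qed

lemma op_poly_smult: "op_poly (smult c u) T = c *\<^sub>R op_poly u T"
proof (rule blinfun_eqI)
  fix x
  show "blinfun_apply (op_poly (smult c u) T) x = blinfun_apply (c *\<^sub>R op_poly u T) x"
    by (simp add: blinfun.scaleR_left op_poly_apply_ge[where n = "degree u"] degree_smult_le
        scaleR_sum_right)
qed

lemma op_poly_minus: "op_poly (- u) T = - op_poly u T"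
  using op_poly_smult[of "- 1" u T] by simp

lemma op_poly_diff: "op_poly (u - v) T = op_poly u T - op_poly v T"
  using op_poly_add[of u "- v" T] by (simp add: op_poly_minus)

lemma op_poly_pCons: "op_poly (pCons a u) T x = a *\<^sub>R x + T (op_poly u T x)"
proof -
  have "op_poly (pCons a u) T x
      = (\<Sum>k\<le>Suc (degree u). coeff (pCons a u) k *\<^sub>R (blinfun_apply T ^^ k) x)"
    by (rule op_poly_apply_ge) (rule degree_pCons_le)
  also have "\<dots> = a *\<^sub>R x + (\<Sum>k\<le>degree u. coeff u k *\<^sub>R T ((blinfun_apply T ^^ k) x))"
    by (subst sum.atMost_Suc_shift) simp
  also have "\<dots> = a *\<^sub>R x + T (op_poly u T x)"
    by (simp add: op_poly_apply_ge[OF order_refl] blinfun.sum_right blinfun.scaleR_right)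
  finally show ?thesis .
qed

lemma op_poly_mult: "op_poly (u * v) T x = op_poly u T (op_poly v T x)"
  by (induction u)
    (simp_all add: mult_pCons_left op_poly_add op_poly_smult op_poly_pCons blinfun.add_left
      blinfun.scaleR_left)

lemma op_poly_commute: "op_poly u T (T x) = T (op_poly u T x)"
proof (induction u)
  case (pCons a u)
  then show ?case by (simp add: op_poly_pCons blinfun.add_right blinfun.scaleR_right)
qed simp

lemma op_poly_selfadj: "selfadj T \<Longrightarrow> selfadj (op_poly u T)"
proof (induction u)
  case 0
  then show ?case by (simp add: selfadj_def)
next
  case (pCons a u)
  then show ?case
    by (simp add: selfadj_def op_poly_pCons cinner_add_left cinner_add_right cinner.scaleR_left
        cinner.scaleR_right op_poly_commute)
qed

lemma op_poly_bounded_ops: "T \<in> bounded_ops \<Longrightarrow> op_poly u T \<in> bounded_ops"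
proof (induction u)
  case (pCons a u)
  then show ?case
    by (simp add: bounded_ops_def op_poly_pCons scaleC_scaleR_commute scaleC_add_right)
qed simp

lemma op_poly_eigen: "blinfun_apply T x = s *\<^sub>R x \<Longrightarrow> op_poly u T x = poly u s *\<^sub>R x"
  by (induction u) (simp_all add: op_poly_pCons blinfun.scaleR_right scaleR_add_left mult.commute)

subsection \<open>The norm of a polynomial of a positive operator\<close>

lemma map_poly_of_real_add:
  "map_poly complex_of_real (p + q) = map_poly complex_of_real p + map_poly complex_of_real q"
  by (rule poly_eqI) (simp add: coeff_map_poly)

lemma map_poly_of_real_mult:
  "map_poly complex_of_real (p * q) = map_poly complex_of_real p * map_poly complex_of_real q"
proof (induction p)
  case (pCons a p)
  have "map_poly complex_of_real (smult a q) = smult (complex_of_real a) (map_poly complex_of_real q)"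
    by (rule poly_eqI) (simp add: coeff_map_poly)
  with pCons show ?case
    by (simp add: map_poly_of_real_add map_poly_pCons)
qed simp

text \<open>A complex root exists. If it is real it splits off a linear factor; otherwise it is also a root of the
real quadratic whose roots are it and its conjugate, and the remainder modulo this quadratic is a real polynomial of degree
at most one with a non-real root, hence zero.\<close>

lemma real_poly_factor:
  fixes w :: "real poly"
  assumes "degree w > 0"
  obtains r v where "w = [:- r, 1:] * v" "degree v < degree w"
  | a c v where "c \<noteq> 0" "w = [:a\<^sup>2 + c\<^sup>2, - 2 * a, 1:] * v" "degree v < degree w"
proof -
  let ?m = "map_poly complex_of_real"
  have w0: "w \<noteq> 0" using assms by auto
  have "degree (?m w) = degree w" by (rule degree_map_poly) simp
  then have "\<not> constant (poly (?m w))" using assms by (simp add: constant_degree)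
  then obtain z where z: "poly (?m w) z = 0" using fundamental_theorem_of_algebra by blast
  show thesis
  proof (cases "Im z = 0")
    case True
    then have z_eq: "z = complex_of_real (Re z)" by (simp add: complex_eq_iff)
    have "complex_of_real (poly p r) = poly (?m p) (complex_of_real r)" for p r
      by (induction p) (simp_all add: map_poly_pCons)
    then have "poly w (Re z) = 0" using z z_eq by (metis of_real_eq_0_iff)
    then obtain v where v: "w = [:- Re z, 1:] * v" by (metis dvdE poly_eq_0_iff_dvd)
    have "degree v < degree w"
      using w0 unfolding v by (subst degree_mult_eq) auto
    with v that(1) show ?thesis by blast
  next
    case False
    define d where "d = [:(Re z)\<^sup>2 + (Im z)\<^sup>2, - 2 * Re z, 1:]"
    have dz: "poly (?m d) z = 0"
      by (simp add: d_def map_poly_pCons complex_eq_iff power2_eq_square algebra_simps)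
    have dd: "degree d = 2" by (simp add: d_def)
    then have d0: "d \<noteq> 0" by auto
    define m where "m = w mod d"
    have "degree m < 2 \<or> m = 0"
      using degree_mod_less[OF d0, of w] by (auto simp: m_def dd)
    then have "degree m \<le> 1" by auto
    then obtain a b where m: "m = [:a, b:]"
      by (metis One_nat_def degree_pCons_eq_if le_zero_eq not_less_eq_eq pCons_cases degree_0_id
          nat.simps(3) Suc_le_mono degree_eq_zeroE pCons_0_0)
    have "w = w div d * d + m" by (simp add: m_def)
    then have "poly (?m w) z = poly (?m m) z"
      by (metis (no_types, lifting) add_0 dz map_poly_of_real_add map_poly_of_real_mult mult_zero_right
          poly_add poly_mult)
    then have "complex_of_real a + z * complex_of_real b = 0"
      using z by (simp add: m map_poly_pCons)
    then have "a + Re z * b = 0" "Im z * b = 0" by (simp_all add: complex_eq_iff)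
    then have "m = 0" using False by (simp add: m)
    then have v: "w = d * (w div d)" by (simp add: m_def mod_eq_0_iff_dvd)
    then have "w div d \<noteq> 0" using w0 by force
    then have "degree (d * (w div d)) = 2 + degree (w div d)"
      using d0 by (simp add: degree_mult_eq dd)
    then have "degree (w div d) < degree w"
      using v by simp
    then show ?thesis using that(2)[OF False, of "Re z" "w div d"] v by (simp add: d_def)
  qed
qed

lemma bounded_below_of_inner:
  fixes y z :: "'a::real_inner"
  assumes "d * (norm y)\<^sup>2 \<le> inner z y"
  shows "d * norm y \<le> norm z"
proof (cases "y = 0")
  case False
  have "d * norm y * norm y \<le> norm z * norm y"
    using assms norm_cauchy_schwarz[of z y] by (simp add: power2_eq_square)
  with False show ?thesis by simp
qed simp

text \<open>Spectral mapping in elementary form: if \<open>w\<close> has no root where the spectrum of \<open>T\<close> can lie, then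
each factor of \<open>w\<close> is bounded below as an operator. A factor \<open>T - r\<close> with \<open>r < 0\<close> or \<open>r > \<parallel>T\<parallel>\<close> is definite
because \<open>0 \<le> T \<le> \<parallel>T\<parallel>\<close>, and a quadratic factor \<open>(T - a)\<^sup>2 + c\<^sup>2\<close> is at least \<open>c\<^sup>2\<close>.\<close>

lemma op_poly_bounded_below:
  fixes T :: "'a::complex_inner \<Rightarrow>\<^sub>L 'a"
  assumes T: "pos_op T"
  shows "\<forall>t\<in>{0..norm T}. poly w t \<noteq> 0 \<Longrightarrow> \<exists>\<delta>>0. \<forall>x. \<delta> * norm x \<le> norm (op_poly w T x)"
proof (induction "degree w" arbitrary: w rule: less_induct)
  case less
  have sa: "selfadj T" and pos: "0 \<le> inner (T x) x" for x using T by (auto simp: pos_op_def)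
  have step: ?case
    if w: "w = d * v" and v: "degree v < degree w" and \<epsilon>: "\<epsilon> > 0"
      and d: "\<And>y. \<epsilon> * norm y \<le> norm (op_poly d T y)" for d v \<epsilon>
  proof -
    have "\<forall>t\<in>{0..norm T}. poly v t \<noteq> 0" using less.prems w by auto
    then obtain \<delta> where \<delta>: "\<delta> > 0" "\<And>x. \<delta> * norm x \<le> norm (op_poly v T x)"
      using less.hyps[OF v] by blast
    have "\<epsilon> * \<delta> * norm x \<le> norm (op_poly w T x)" for x
    proof -
      have "\<epsilon> * (\<delta> * norm x) \<le> \<epsilon> * norm (op_poly v T x)"
        using \<delta>(2)[of x] \<epsilon> by (intro mult_left_mono) auto
      also have "\<dots> \<le> norm (op_poly w T x)" unfolding w op_poly_mult by (rule d)
      finally show ?thesis by (simp add: mult.assoc)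
    qed
    then show ?thesis using \<epsilon> \<delta>(1) by (intro exI[of _ "\<epsilon> * \<delta>"]) simp
  qed
  show ?case
  proof (cases "degree w = 0")
    case True
    then obtain c where c: "w = [:c:]" by (rule degree_eq_zeroE)
    then have "c \<noteq> 0" using less.prems by (auto dest: bspec[of _ _ 0])
    then show ?thesis
      by (intro exI[of _ "\<bar>c\<bar>"]) (simp add: c op_poly_pCons)
  next
    case False
    then have "degree w > 0" by simp
    then show ?thesis
    proof (cases rule: real_poly_factor)
      case (1 r v)
      have op: "op_poly [:- r, 1:] T y = T y - r *\<^sub>R y" for y
        by (simp add: op_poly_pCons)
      have "r \<notin> {0..norm T}" using less.prems 1(1) by auto
      then consider "r < 0" | "r > norm T" by fastforce
      then show ?thesis
      proof cases
        case a: 1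
        show ?thesis
        proof (rule step[OF 1, of "- r"])
          fix y
          have "- r * (norm y)\<^sup>2 \<le> inner (op_poly [:- r, 1:] T y) y"
            using pos[of y] by (simp add: op inner_diff_left power2_norm_eq_inner)
          then show "- r * norm y \<le> norm (op_poly [:- r, 1:] T y)" by (rule bounded_below_of_inner)
        qed (use a in simp)
      next
        case a: 2
        show ?thesis
        proof (rule step[OF 1, of "r - norm T"])
          fix y
          have "(r - norm T) * (norm y)\<^sup>2 \<le> inner (- op_poly [:- r, 1:] T y) y"
            using inner_op_le[of T y]
            by (simp add: op inner_diff_left power2_norm_eq_inner left_diff_distrib)
          from bounded_below_of_inner[OF this]
          show "(r - norm T) * norm y \<le> norm (op_poly [:- r, 1:] T y)" by simp
        qed (use a in simp)
      qed
    next
      case (2 a c v)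
      show ?thesis
      proof (rule step[OF 2(2,3), of "c\<^sup>2"])
        fix y
        have "inner (op_poly [:a\<^sup>2 + c\<^sup>2, - 2 * a, 1:] T y) y
            = (norm (T y - a *\<^sub>R y))\<^sup>2 + c\<^sup>2 * (norm y)\<^sup>2"
          unfolding power2_norm_eq_inner using selfadj_inner[OF sa, of "T y" y]
          by (simp add: op_poly_pCons inner_diff_left inner_diff_right
              inner_add_left blinfun.diff_right blinfun.scaleR_right blinfun.add_right
              blinfun.minus_right inner_commute algebra_simps power2_eq_square)
        then have "c\<^sup>2 * (norm y)\<^sup>2 \<le> inner (op_poly [:a\<^sup>2 + c\<^sup>2, - 2 * a, 1:] T y) y" by simp
        then show "c\<^sup>2 * norm y \<le> norm (op_poly [:a\<^sup>2 + c\<^sup>2, - 2 * a, 1:] T y)"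
          by (rule bounded_below_of_inner)
      qed (use 2 in simp)
    qed
  qed
qed

text \<open>Let \<open>S = u(T)\<close> and \<open>\<sigma> = \<parallel>S\<parallel>\<close>. Vectors on which \<open>S\<close> nearly attains its norm are approximate
eigenvectors of \<open>S\<^sup>2\<close> for \<open>\<sigma>\<^sup>2\<close>, so \<open>\<sigma>\<^sup>2 - S\<^sup>2\<close> is not bounded below. If \<open>|u| < \<sigma>\<close> on the whole interval,
this contradicts the previous lemma applied to the polynomial \<open>\<sigma>\<^sup>2 - u\<^sup>2\<close>.\<close>

lemma op_poly_norm_le:
  fixes T :: "'a::complex_inner \<Rightarrow>\<^sub>L 'a"
  assumes T: "pos_op T" and u: "\<And>t. t \<in> {0..norm T} \<Longrightarrow> \<bar>poly u t\<bar> \<le> s"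
  shows "norm (op_poly u T) \<le> s"
proof (rule ccontr)
  define S where "S = op_poly u T"
  define \<sigma> where "\<sigma> = norm S"
  assume "\<not> norm (op_poly u T) \<le> s"
  then have \<sigma>s: "\<sigma> > s" by (simp add: \<sigma>_def S_def)
  have "s \<ge> 0" using u[of 0] by (simp add: order_trans[OF abs_ge_zero])
  with \<sigma>s have \<sigma>: "\<sigma> > 0" by simp
  have sa: "selfadj S" unfolding S_def using T by (intro op_poly_selfadj) (simp add: pos_op_def)
  define w where "w = [:\<sigma>\<^sup>2:] - u * u"
  have "poly w t > 0" if "t \<in> {0..norm T}" for t
  proof -
    have "\<bar>poly u t\<bar> < \<sigma>" using u[OF that] \<sigma>s by simp
    then have "\<bar>poly u t\<bar>\<^sup>2 < \<sigma>\<^sup>2" by (intro power_strict_mono) auto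
    then show ?thesis by (simp add: w_def power2_eq_square)
  qed
  then have "\<forall>t\<in>{0..norm T}. poly w t \<noteq> 0" by force
  from op_poly_bounded_below[OF T this]
  obtain \<delta> where \<delta>: "\<delta> > 0" "\<And>x. \<delta> * norm x \<le> norm (op_poly w T x)" by blast
  have wx: "op_poly w T x = \<sigma>\<^sup>2 *\<^sub>R x - S (S x)" for x
    by (simp add: w_def op_poly_diff blinfun.diff_left op_poly_mult S_def op_poly_pCons)
  have key: "(norm (S x))\<^sup>2 \<le> (\<sigma>\<^sup>2 - \<delta>\<^sup>2 / \<sigma>\<^sup>2) * (norm x)\<^sup>2" for x
  proof -
    have "\<delta>\<^sup>2 * (norm x)\<^sup>2 \<le> (norm (op_poly w T x))\<^sup>2"
      using \<delta> by (subst power_mult_distrib[symmetric]) (intro power_mono, auto)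
    also have "\<dots> = \<sigma>\<^sup>2 * \<sigma>\<^sup>2 * (norm x)\<^sup>2 - 2 * \<sigma>\<^sup>2 * (norm (S x))\<^sup>2 + (norm (S (S x)))\<^sup>2"
      using selfadj_inner[OF sa, of "S x" x]
      by (simp add: wx power2_norm_eq_inner inner_diff_left inner_diff_right inner_commute algebra_simps)
    also have "(norm (S (S x)))\<^sup>2 \<le> \<sigma>\<^sup>2 * (norm (S x))\<^sup>2"
      using norm_blinfun[of S "S x"] by (simp add: \<sigma>_def power_mult_distrib[symmetric] power_mono)
    finally have "\<delta>\<^sup>2 * (norm x)\<^sup>2 \<le> \<sigma>\<^sup>2 * (\<sigma>\<^sup>2 * (norm x)\<^sup>2 - (norm (S x))\<^sup>2)"
      by (simp add: algebra_simps)
    then have "\<delta>\<^sup>2 * (norm x)\<^sup>2 / \<sigma>\<^sup>2 \<le> \<sigma>\<^sup>2 * (norm x)\<^sup>2 - (norm (S x))\<^sup>2"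
      using \<sigma> by (simp add: divide_le_eq mult.commute)
    then show ?thesis by (simp add: algebra_simps)
  qed
  \<comment> \<open>The maximum only guards the square root against a negative argument.\<close>
  define m where "m = max 0 (\<sigma>\<^sup>2 - \<delta>\<^sup>2 / \<sigma>\<^sup>2)"
  have "norm S \<le> sqrt m"
  proof (rule norm_blinfun_bound)
    fix x
    have "(norm (S x))\<^sup>2 \<le> m * (norm x)\<^sup>2"
      using key[of x] by (rule order_trans) (simp add: m_def mult_right_mono)
    then have "sqrt ((norm (S x))\<^sup>2) \<le> sqrt (m * (norm x)\<^sup>2)" by (rule real_sqrt_le_mono)
    then show "norm (S x) \<le> sqrt m * norm x" by (simp add: real_sqrt_mult)
  qed (simp add: m_def)
  moreover have "m < \<sigma>\<^sup>2" using \<sigma> \<delta> by (simp add: m_def)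
  then have "sqrt m < \<sigma>" using \<sigma> by (simp add: real_sqrt_less_iff real_less_lsqrt)
  ultimately show False by (simp add: \<sigma>_def)
qed

text \<open>Positivity follows from the norm bound: if \<open>u\<close> has values in \<open>[-\<epsilon>, M]\<close>, then subtracting \<open>u\<close> from the
midpoint of this interval leaves a polynomial bounded by half its length.\<close>

lemma op_poly_inner_ge:
  fixes T :: "'a::complex_inner \<Rightarrow>\<^sub>L 'a"
  assumes T: "pos_op T" and u: "\<And>t. t \<in> {0..norm T} \<Longrightarrow> - \<epsilon> \<le> poly u t"
  shows "- \<epsilon> * (norm x)\<^sup>2 \<le> inner (op_poly u T x) x"
proof -
  have "compact (poly u ` {0..norm T})"
    by (intro compact_continuous_image continuous_intros) auto
  then obtain M where M: "\<And>t. t \<in> {0..norm T} \<Longrightarrow> \<bar>poly u t\<bar> \<le> M"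
    by (fastforce dest!: compact_imp_bounded simp: bounded_iff)
  \<comment> \<open>\<open>?M\<close> is half the length of \<open>[-\<epsilon>, M]\<close>, and \<open>?M - \<epsilon>\<close> is its midpoint.\<close>
  let ?M = "(M + \<epsilon>) / 2"
  let ?v = "[:?M - \<epsilon>:] - u"
  have "norm (op_poly ?v T) \<le> ?M"
  proof (rule op_poly_norm_le[OF T])
    fix t assume "t \<in> {0..norm T}"
    then show "\<bar>poly ?v t\<bar> \<le> ?M" using M[of t] u[of t] by (simp add: abs_le_iff field_simps)
  qed
  then have "inner (op_poly ?v T x) x \<le> ?M * (norm x)\<^sup>2"
    using inner_op_le[of "op_poly ?v T" x] by (meson mult_right_mono order_trans zero_le_power2)
  then show ?thesis
    by (simp add: op_poly_diff blinfun.diff_left op_poly_pCons inner_diff_left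
        power2_norm_eq_inner algebra_simps)
qed

subsection \<open>Limits of polynomials\<close>

lemma polynomial_approximation:
  fixes f :: "real \<Rightarrow> real"
  assumes "continuous_on {0..b} f"
  obtains u :: "nat \<Rightarrow> real poly" where "uniform_limit {0..b} (\<lambda>k. poly (u k)) f sequentially"
proof -
  have "\<exists>p. \<forall>x\<in>{0..b}. \<bar>f x - poly p x\<bar> < e" if e: "e > 0" for e
  proof -
    obtain g where g: "real_polynomial_function g" "\<And>x. x \<in> {0..b} \<Longrightarrow> \<bar>f x - g x\<bar> < e"
      using Stone_Weierstrass_real_polynomial_function[OF compact_Icc assms e] by blast
    obtain a n where an: "g = (\<lambda>x. \<Sum>i\<le>n. a i * x ^ i)"
      using g(1) by (auto simp: real_polynomial_function_iff_sum)
    have "poly (\<Sum>i\<le>n. monom (a i) i) x = g x" for x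
      by (simp add: an poly_sum poly_monom)
    then show ?thesis using g(2) by metis
  qed
  then have "\<forall>k. \<exists>p. \<forall>x\<in>{0..b}. \<bar>f x - poly p x\<bar> < inverse (Suc k)" by simp
  then obtain u where u: "\<And>k x. x \<in> {0..b} \<Longrightarrow> \<bar>f x - poly (u k) x\<bar> < inverse (Suc k)"
    by metis
  have "uniform_limit {0..b} (\<lambda>k. poly (u k)) f sequentially"
  proof (rule uniform_limitI)
    fix e :: real assume "e > 0"
    then have "\<forall>\<^sub>F k in sequentially. inverse (Suc k) < e"
      using order_tendstoD(2)[OF LIMSEQ_inverse_real_of_nat] by blast
    then show "\<forall>\<^sub>F k in sequentially. \<forall>x\<in>{0..b}. dist (poly (u k) x) (f x) < e"
    proof eventually_elim
      case (elim k)
      then show ?case by (auto simp: dist_real_def abs_minus_commute intro: less_trans[OF u])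
    qed
  qed
  with that show thesis by blast
qed

text \<open>The norm bound makes the polynomials of \<open>T\<close> Cauchy along every uniformly convergent sequence, and
it forces the same limit for any two sequences with the same limit function. Hence the definite description in
\<open>op_fun\<close> denotes that limit.\<close>

lemma op_fun_limit:
  fixes T :: "'a::{complex_inner,banach} \<Rightarrow>\<^sub>L 'a"
  assumes T: "pos_op T" and f: "continuous_on {0..norm T} f"
    and u: "uniform_limit {0..norm T} (\<lambda>k. poly (u k)) f sequentially"
  shows "(\<lambda>k. op_poly (u k) T) \<longlonglongrightarrow> op_fun f T"
proof -
  let ?I = "{0..norm T}"
  obtain v where v: "uniform_limit ?I (\<lambda>k. poly (v k)) f sequentially"
    using polynomial_approximation[OF f] by blast
  have close: "norm (op_poly p T - op_poly q T) \<le> 2 * e"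
    if p: "\<forall>x\<in>?I. dist (poly p x) (f x) < e" and q: "\<forall>x\<in>?I. dist (poly q x) (f x) < e" for p q e
  proof -
    have "norm (op_poly (p - q) T) \<le> 2 * e"
    proof (rule op_poly_norm_le[OF T])
      fix t assume "t \<in> ?I"
      then have "\<bar>poly p t - f t\<bar> < e" "\<bar>poly q t - f t\<bar> < e" using p q by (auto simp: dist_real_def)
      then show "\<bar>poly (p - q) t\<bar> \<le> 2 * e" by simp
    qed
    then show ?thesis by (simp add: op_poly_diff)
  qed
  have "Cauchy (\<lambda>k. op_poly (v k) T)"
  proof (rule metric_CauchyI)
    fix e :: real assume "e > 0"
    then obtain N where N: "\<And>k. k \<ge> N \<Longrightarrow> \<forall>x\<in>?I. dist (poly (v k) x) (f x) < e / 4"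
      using uniform_limitD[OF v, of "e / 4"] by (auto simp: eventually_sequentially)
    have "dist (op_poly (v m) T) (op_poly (v n) T) < e" if "m \<ge> N" "n \<ge> N" for m n
      using close[OF N[OF that(1)] N[OF that(2)]] \<open>e > 0\<close> by (simp add: dist_norm)
    then show "\<exists>N. \<forall>m\<ge>N. \<forall>n\<ge>N. dist (op_poly (v m) T) (op_poly (v n) T) < e" by blast
  qed
  then obtain L where L: "(\<lambda>k. op_poly (v k) T) \<longlonglongrightarrow> L"
    using Cauchy_convergent convergentD by blast
  have lim: "(\<lambda>k. op_poly (w k) T) \<longlonglongrightarrow> L"
    if w: "uniform_limit ?I (\<lambda>k. poly (w k)) f sequentially" for w :: "nat \<Rightarrow> real poly"
  proof -
    have "(\<lambda>k. op_poly (w k) T - op_poly (v k) T) \<longlonglongrightarrow> 0"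
    proof (rule tendstoI)
      fix e :: real assume "e > 0"
      then have "e / 4 > 0" by simp
      from uniform_limitD[OF v this] uniform_limitD[OF w this]
      show "\<forall>\<^sub>F k in sequentially. dist (op_poly (w k) T - op_poly (v k) T) 0 < e"
      proof eventually_elim
        case (elim k)
        then show ?case using close[OF elim(2,1)] \<open>e > 0\<close> by (simp add: dist_norm)
      qed
    qed
    from tendsto_add[OF this L] show ?thesis by simp
  qed
  have "op_fun f T = L"
    unfolding op_fun_def
  proof (rule the_equality)
    show "\<forall>u :: nat \<Rightarrow> real poly. uniform_limit ?I (\<lambda>k. poly (u k)) f sequentially \<longrightarrow>
      (\<lambda>k. op_poly (u k) T) \<longlonglongrightarrow> L" using lim by blast
    show "S = L" if "\<forall>u :: nat \<Rightarrow> real poly. uniform_limit ?I (\<lambda>k. poly (u k)) f sequentially \<longrightarrow>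
      (\<lambda>k. op_poly (u k) T) \<longlonglongrightarrow> S" for S
      using that L v LIMSEQ_unique by blast
  qed
  with lim[OF u] show ?thesis by simp
qed

lemma op_fun_poly:
  fixes T :: "'a::{complex_inner,banach} \<Rightarrow>\<^sub>L 'a"
  assumes "pos_op T"
  shows "op_fun (poly p) T = op_poly p T"
proof -
  have "(\<lambda>k::nat. op_poly p T) \<longlonglongrightarrow> op_fun (poly p) T"
    by (rule op_fun_limit[OF assms]) (auto intro!: continuous_intros uniform_limit_const)
  then show ?thesis by (metis LIMSEQ_unique tendsto_const)
qed

lemma op_fun_approx:
  fixes T :: "'a::{complex_inner,banach} \<Rightarrow>\<^sub>L 'a"
  assumes "pos_op T" "continuous_on {0..norm T} f"
  obtains u :: "nat \<Rightarrow> real poly" where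
    "uniform_limit {0..norm T} (\<lambda>k. poly (u k)) f sequentially"
    "\<And>x. (\<lambda>k. op_poly (u k) T x) \<longlonglongrightarrow> op_fun f T x"
proof -
  obtain u where u: "uniform_limit {0..norm T} (\<lambda>k. poly (u k)) f sequentially"
    using polynomial_approximation[OF assms(2)] by blast
  have "(\<lambda>k. op_poly (u k) T x) \<longlonglongrightarrow> op_fun f T x" for x
    by (intro blinfun.tendsto op_fun_limit[OF assms u] tendsto_const)
  with u that show thesis by blast
qed

lemma op_fun_selfadj:
  fixes T :: "'a::{complex_inner,banach} \<Rightarrow>\<^sub>L 'a"
  assumes "pos_op T" "continuous_on {0..norm T} f"
  shows "selfadj (op_fun f T)"
  unfolding selfadj_def
proof (intro allI)
  fix x y
  obtain u where u: "\<And>x. (\<lambda>k. op_poly (u k) T x) \<longlonglongrightarrow> op_fun f T x"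
    using op_fun_approx[OF assms] by metis
  have eq: "cinner (op_poly (u k) T x) y = cinner x (op_poly (u k) T y)" for k
    using assms(1) by (intro selfadjD op_poly_selfadj) (simp add: pos_op_def)
  have 1: "(\<lambda>k. cinner x (op_poly (u k) T y)) \<longlonglongrightarrow> cinner (op_fun f T x) y"
    unfolding eq[symmetric] by (intro cinner.tendsto u tendsto_const)
  have 2: "(\<lambda>k. cinner x (op_poly (u k) T y)) \<longlonglongrightarrow> cinner x (op_fun f T y)"
    by (intro cinner.tendsto u tendsto_const)
  show "cinner (op_fun f T x) y = cinner x (op_fun f T y)"
    by (rule LIMSEQ_unique[OF 1 2])
qed

lemma op_fun_bounded_ops:
  fixes T :: "'a::{complex_inner,banach} \<Rightarrow>\<^sub>L 'a"
  assumes "pos_op T" "continuous_on {0..norm T} f"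
  shows "op_fun f T \<in> bounded_ops"
  unfolding bounded_ops_def
proof (intro CollectI allI)
  fix c x
  obtain u where u: "\<And>x. (\<lambda>k. op_poly (u k) T x) \<longlonglongrightarrow> op_fun f T x"
    using op_fun_approx[OF assms] by metis
  have "(\<lambda>k. c *\<^sub>C op_poly (u k) T x) \<longlonglongrightarrow> c *\<^sub>C op_fun f T x"
    by (rule bounded_linear.tendsto[OF bounded_linear_scaleC_right u])
  moreover have "op_poly (u k) T (c *\<^sub>C x) = c *\<^sub>C op_poly (u k) T x" for k
    using assms(1) by (intro bounded_opsD op_poly_bounded_ops) (simp add: pos_op_def)
  ultimately show "op_fun f T (c *\<^sub>C x) = c *\<^sub>C op_fun f T x"
    using LIMSEQ_unique u[of "c *\<^sub>C x"] by simp
qed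

text \<open>The affine form of the upper bound is what estimates such as
\<open>t\<^sup>2 \<le> \<delta> + c t\<^sup>r\<close> need; monotonicity is the case \<open>a = 0\<close>, \<open>c = 1\<close>.\<close>

lemma op_fun_le:
  fixes T :: "'a::{complex_inner,banach} \<Rightarrow>\<^sub>L 'a"
  assumes T: "pos_op T" and f: "continuous_on {0..norm T} f" and g: "continuous_on {0..norm T} g"
    and le: "\<And>t. t \<in> {0..norm T} \<Longrightarrow> f t \<le> a + c * g t" and c: "c \<ge> 0"
  shows "inner (op_fun f T x) x \<le> a * (norm x)\<^sup>2 + c * inner (op_fun g T x) x"
proof -
  obtain u where u: "uniform_limit {0..norm T} (\<lambda>k. poly (u k)) f sequentially"
    and ul: "\<And>x. (\<lambda>k. op_poly (u k) T x) \<longlonglongrightarrow> op_fun f T x"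
    using op_fun_approx[OF T f] by metis
  obtain v where v: "uniform_limit {0..norm T} (\<lambda>k. poly (v k)) g sequentially"
    and vl: "\<And>x. (\<lambda>k. op_poly (v k) T x) \<longlonglongrightarrow> op_fun g T x"
    using op_fun_approx[OF T g] by metis
  have "inner (op_fun f T x) x \<le> a * (norm x)\<^sup>2 + c * inner (op_fun g T x) x + (1 + c) * (norm x)\<^sup>2 * e"
    if "e > 0" for e
  proof (rule tendsto_le[OF sequentially_bot])
    show "(\<lambda>k. inner (op_poly (u k) T x) x) \<longlonglongrightarrow> inner (op_fun f T x) x"
      by (intro tendsto_intros ul)
    show "(\<lambda>k. a * (norm x)\<^sup>2 + c * inner (op_poly (v k) T x) x + (1 + c) * (norm x)\<^sup>2 * e)
        \<longlonglongrightarrow> a * (norm x)\<^sup>2 + c * inner (op_fun g T x) x + (1 + c) * (norm x)\<^sup>2 * e"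
      by (intro tendsto_intros vl)
    show "\<forall>\<^sub>F k in sequentially. inner (op_poly (u k) T x) x
        \<le> a * (norm x)\<^sup>2 + c * inner (op_poly (v k) T x) x + (1 + c) * (norm x)\<^sup>2 * e"
      using uniform_limitD[OF u \<open>e > 0\<close>] uniform_limitD[OF v \<open>e > 0\<close>]
    proof eventually_elim
      case (elim k)
      let ?w = "[:a:] + smult c (v k) - u k"
      have "- ((1 + c) * e) * (norm x)\<^sup>2 \<le> inner (op_poly ?w T x) x"
      proof (rule op_poly_inner_ge[OF T])
        fix t assume t: "t \<in> {0..norm T}"
        have "g t - e \<le> poly (v k) t" "poly (u k) t \<le> f t + e"
          using elim t by (auto simp: dist_real_def abs_le_iff dest!: bspec[of _ _ t])
        then have "c * (g t - e) \<le> c * poly (v k) t" "poly (u k) t \<le> f t + e"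
          using c by (auto intro: mult_left_mono)
        then show "- ((1 + c) * e) \<le> poly ?w t"
          using le[OF t] by (simp add: algebra_simps)
      qed
      then show ?case
        by (simp add: op_poly_diff op_poly_add op_poly_smult blinfun.diff_left blinfun.add_left
            blinfun.scaleR_left op_poly_pCons inner_diff_left inner_add_left power2_norm_eq_inner
            algebra_simps)
    qed
  qed
  note 1 = this
  have "inner (op_fun f T x) x \<le> a * (norm x)\<^sup>2 + c * inner (op_fun g T x) x + d" if "d > 0" for d
  proof -
    let ?K = "(1 + c) * (norm x)\<^sup>2"
    have K: "?K \<ge> 0" using c by simp
    then have "?K * (d / (?K + 1)) \<le> d" using \<open>d > 0\<close> by (simp add: field_simps)
    moreover have "d / (?K + 1) > 0" using K \<open>d > 0\<close> by simp
    ultimately show ?thesis using 1[of "d / (?K + 1)"] by linarith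
  qed
  then show ?thesis by (rule field_le_epsilon)
qed

lemma op_fun_nonneg:
  fixes T :: "'a::{complex_inner,banach} \<Rightarrow>\<^sub>L 'a"
  assumes T: "pos_op T" and f: "continuous_on {0..norm T} f"
    and nn: "\<And>t. t \<in> {0..norm T} \<Longrightarrow> 0 \<le> f t"
  shows "0 \<le> inner (op_fun f T x) x"
proof -
  have "inner (op_fun (poly 0) T x) x \<le> 0 * (norm x)\<^sup>2 + 1 * inner (op_fun f T x) x"
    by (rule op_fun_le[OF T _ f]) (auto intro: nn)
  then show ?thesis by (simp only: op_fun_poly[OF T] op_poly_0) simp
qed

lemma op_fun_pos:
  fixes T :: "'a::{complex_inner,banach} \<Rightarrow>\<^sub>L 'a"
  assumes "pos_op T" "continuous_on {0..norm T} f" "\<And>t. t \<in> {0..norm T} \<Longrightarrow> 0 \<le> f t"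
  shows "pos_op (op_fun f T)"
  using op_fun_nonneg[OF assms] op_fun_selfadj[OF assms(1,2)] op_fun_bounded_ops[OF assms(1,2)]
  by (simp add: pos_op_def)

lemma op_fun_id:
  fixes T :: "'a::{complex_inner,banach} \<Rightarrow>\<^sub>L 'a"
  assumes "pos_op T"
  shows "op_fun (\<lambda>t. t) T = T"
proof -
  have "poly [:0, 1:] = (\<lambda>t::real. t)" by (rule ext) simp
  then have "op_fun (\<lambda>t. t) T = op_poly [:0, 1:] T" using op_fun_poly[OF assms] by metis
  also have "\<dots> = T" by (rule blinfun_eqI) (simp add: op_poly_pCons blinfun.scaleR_right)
  finally show ?thesis .
qed

lemma op_fun_cong:
  fixes T :: "'a::{complex_inner,banach} \<Rightarrow>\<^sub>L 'a"
  assumes T: "pos_op T" and f: "continuous_on {0..norm T} f"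
    and eq: "\<And>t. t \<in> {0..norm T} \<Longrightarrow> f t = g t"
  shows "op_fun f T = op_fun g T"
proof -
  have g: "continuous_on {0..norm T} g" using f by (rule continuous_on_eq) (rule eq)
  obtain u where u: "uniform_limit {0..norm T} (\<lambda>k. poly (u k)) f sequentially"
    using polynomial_approximation[OF f] by blast
  have "uniform_limit {0..norm T} (\<lambda>k. poly (u k)) g sequentially"
    using u eq by (simp add: uniform_limit_iff)
  then show ?thesis
    using op_fun_limit[OF T f u] op_fun_limit[OF T g] LIMSEQ_unique by metis
qed

lemma op_fun_mult:
  fixes T :: "'a::{complex_inner,banach} \<Rightarrow>\<^sub>L 'a"
  assumes T: "pos_op T" and f: "continuous_on {0..norm T} f" and g: "continuous_on {0..norm T} g"
  shows "op_fun (\<lambda>t. f t * g t) T x = op_fun f T (op_fun g T x)"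
proof -
  obtain u where u: "uniform_limit {0..norm T} (\<lambda>k. poly (u k)) f sequentially"
    using polynomial_approximation[OF f] by blast
  obtain v where v: "uniform_limit {0..norm T} (\<lambda>k. poly (v k)) g sequentially"
    using polynomial_approximation[OF g] by blast
  have bd: "bounded (h ` {0..norm T})" if "continuous_on {0..norm T} h" for h :: "real \<Rightarrow> real"
    using that by (intro compact_imp_bounded compact_continuous_image) auto
  have "uniform_limit {0..norm T} (\<lambda>k. poly (u k * v k)) (\<lambda>t. f t * g t) sequentially"
    using uniform_lim_mult[OF u v bd[OF f] bd[OF g]] by (simp only: poly_mult[abs_def])
  then have 1: "(\<lambda>k. op_poly (u k * v k) T x) \<longlonglongrightarrow> op_fun (\<lambda>t. f t * g t) T x"
    by (intro blinfun.tendsto op_fun_limit[OF T] tendsto_const continuous_intros f g)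
  have "(\<lambda>k. op_poly (u k) T (op_poly (v k) T x)) \<longlonglongrightarrow> op_fun f T (op_fun g T x)"
    by (intro blinfun.tendsto op_fun_limit[OF T f u] op_fun_limit[OF T g v] tendsto_const)
  then show ?thesis using 1 LIMSEQ_unique by (simp add: op_poly_mult)
qed

lemma op_fun_eigen:
  fixes T :: "'a::{complex_inner,banach} \<Rightarrow>\<^sub>L 'a"
  assumes T: "pos_op T" and f: "continuous_on {0..norm T} f" and e: "T e = s *\<^sub>R e" and s: "s \<ge> 0"
  shows "op_fun f T e = f s *\<^sub>R e"
proof (cases "e = 0")
  case False
  have "s * norm e \<le> norm T * norm e"
    using norm_blinfun[of T e] s by (simp add: e)
  then have sI: "s \<in> {0..norm T}" using False s by simp
  obtain u where u: "uniform_limit {0..norm T} (\<lambda>k. poly (u k)) f sequentially"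
    and ul: "\<And>x. (\<lambda>k. op_poly (u k) T x) \<longlonglongrightarrow> op_fun f T x"
    using op_fun_approx[OF T f] by metis
  have "(\<lambda>k. poly (u k) s *\<^sub>R e) \<longlonglongrightarrow> f s *\<^sub>R e"
    by (intro tendsto_intros tendsto_uniform_limitI[OF u sI])
  then show ?thesis using ul[of e] LIMSEQ_unique by (simp add: op_poly_eigen[OF e])
qed (simp add: blinfun.zero_right)

section \<open>Compact operators and singular bases\<close>

text \<open>Compactness, stated as smallness on subspaces of finite codimension. In this form it is immediate
for Hilbert-Schmidt operators and stable under sums and products; that it agrees with the usual notion in the direction
needed is shown in \<open>compact_op_image_of_ball\<close>.\<close>

definition compact_op :: "('a::complex_inner \<Rightarrow>\<^sub>L 'a) \<Rightarrow> bool" where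
  "compact_op A \<longleftrightarrow> (\<forall>\<epsilon>>0. \<exists>F. finite F \<and>
    (\<forall>x. (\<forall>e\<in>F. cinner x e = 0) \<longrightarrow> norm (A x) \<le> \<epsilon> * norm x))"

lemma compact_opD:
  assumes "compact_op A" "\<epsilon> > 0"
  obtains F where "finite F"
    "\<And>x. (\<And>e. e \<in> F \<Longrightarrow> cinner x e = 0) \<Longrightarrow> norm (blinfun_apply A x) \<le> \<epsilon> * norm x"
  using assms unfolding compact_op_def by metis

lemma compact_op_add:
  fixes A B :: "'a::complex_inner \<Rightarrow>\<^sub>L 'a"
  assumes "compact_op A" "compact_op B"
  shows "compact_op (A + B)"
  unfolding compact_op_def
proof (intro allI impI)
  fix \<epsilon> :: real assume "\<epsilon> > 0"
  then have h: "\<epsilon> / 2 > 0" by simp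
  obtain F where F: "finite F" "\<And>x. (\<And>e. e \<in> F \<Longrightarrow> cinner x e = 0) \<Longrightarrow> norm (A x) \<le> \<epsilon> / 2 * norm x"
    by (rule compact_opD[OF assms(1) h]) blast
  obtain G where G: "finite G" "\<And>x. (\<And>e. e \<in> G \<Longrightarrow> cinner x e = 0) \<Longrightarrow> norm (B x) \<le> \<epsilon> / 2 * norm x"
    by (rule compact_opD[OF assms(2) h]) blast
  show "\<exists>F. finite F \<and> (\<forall>x. (\<forall>e\<in>F. cinner x e = 0) \<longrightarrow> norm ((A + B) x) \<le> \<epsilon> * norm x)"
  proof (intro exI[of _ "F \<union> G"] conjI allI impI)
    fix x assume x: "\<forall>e\<in>F \<union> G. cinner x e = 0"
    have "norm (A x + B x) \<le> \<epsilon> / 2 * norm x + \<epsilon> / 2 * norm x"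
      using x by (intro norm_triangle_mono F(2) G(2)) auto
    then show "norm ((A + B) x) \<le> \<epsilon> * norm x" by (simp add: blinfun.add_left)
  qed (use F G in auto)
qed

text \<open>\<open>B x\<close> is orthogonal to \<open>e\<close> as soon as \<open>x\<close> is orthogonal to \<open>B\<^sup>* e\<close>.\<close>

lemma compact_op_compose_right:
  fixes A B :: "'a::{complex_inner,banach} \<Rightarrow>\<^sub>L 'a"
  assumes "compact_op A" "B \<in> bounded_ops"
  shows "compact_op (A o\<^sub>L B)"
  unfolding compact_op_def
proof (intro allI impI)
  fix \<epsilon> :: real assume "\<epsilon> > 0"
  then have h: "\<epsilon> / (norm B + 1) > 0" by (simp add: add_nonneg_pos)
  obtain F where F: "finite F"
    "\<And>x. (\<And>e. e \<in> F \<Longrightarrow> cinner x e = 0) \<Longrightarrow> norm (A x) \<le> \<epsilon> / (norm B + 1) * norm x"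
    by (rule compact_opD[OF assms(1) h]) blast
  show "\<exists>F. finite F \<and> (\<forall>x. (\<forall>e\<in>F. cinner x e = 0) \<longrightarrow> norm ((A o\<^sub>L B) x) \<le> \<epsilon> * norm x)"
  proof (intro exI[of _ "blinfun_apply (op_adjoint B) ` F"] conjI allI impI)
    fix x assume x: "\<forall>e\<in>blinfun_apply (op_adjoint B) ` F. cinner x e = 0"
    have "norm (A (B x)) \<le> \<epsilon> / (norm B + 1) * norm (B x)"
      using x by (intro F(2)) (simp add: cinner_op_adjoint[OF assms(2)])
    also have "\<dots> \<le> \<epsilon> / (norm B + 1) * ((norm B + 1) * norm x)"
      using norm_blinfun[of B x]
      by (intro mult_left_mono[OF _ less_imp_le[OF h]]) (simp add: distrib_right add_increasing2)
    also have "\<dots> = \<epsilon> * norm x"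
      using norm_ge_zero[of B] by (simp add: add_nonneg_eq_0_iff)
    finally show "norm ((A o\<^sub>L B) x) \<le> \<epsilon> * norm x" by simp
  qed (use F in simp)
qed

text \<open>Compactness of bounded sets in finite dimension, in the only form required: the box is an iterated sum of
compact segments.\<close>

lemma compact_box:
  fixes C :: "'a::real_normed_vector set"
  assumes "finite C"
  shows "compact {\<Sum>e\<in>C. r e *\<^sub>R e |r. \<forall>e\<in>C. \<bar>r e\<bar> \<le> b e}" (is "compact (?S C)")
  using assms
proof induction
  case (insert a C)
  let ?I = "(\<lambda>r. r *\<^sub>R a) ` {- b a..b a}"
  have "?S (insert a C) \<subseteq> {x + y |x y. x \<in> ?I \<and> y \<in> ?S C}"
    using insert by (auto simp: abs_le_iff intro!: imageI)
      (metis (mono_tags, lifting) atLeastAtMost_iff image_eqI minus_le_iff)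
  moreover have "{x + y |x y. x \<in> ?I \<and> y \<in> ?S C} \<subseteq> ?S (insert a C)"
  proof safe
    fix s r assume s: "s \<in> {- b a..b a}" and r: "\<forall>e\<in>C. \<bar>r e\<bar> \<le> b e"
    show "\<exists>r'. s *\<^sub>R a + (\<Sum>e\<in>C. r e *\<^sub>R e) = (\<Sum>e\<in>insert a C. r' e *\<^sub>R e) \<and>
      (\<forall>e\<in>insert a C. \<bar>r' e\<bar> \<le> b e)"
      using insert s r
      by (intro exI[of _ "r(a := s)"]) (auto simp: abs_le_iff intro!: sum.cong)
  qed
  ultimately have "?S (insert a C) = {x + y |x y. x \<in> ?I \<and> y \<in> ?S C}" by (rule subset_antisym)
  moreover have "compact ?I" by (intro compact_continuous_image continuous_intros) auto
  ultimately show ?case using compact_sums[of ?I "?S C"] insert.IH by (simp only:)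
qed simp

text \<open>Up to \<open>\<epsilon>\<close> the image of the unit ball is the image of its projection to a finite dimensional
subspace, which lies in a compact box. The projection is the real one onto the span of \<open>F\<close> and \<open>\<i> F\<close>, whose real
orthogonal complement is the complex orthogonal complement of \<open>F\<close>.\<close>

lemma compact_op_image_of_ball:
  fixes A :: "'a::{complex_inner,banach} \<Rightarrow>\<^sub>L 'a"
  assumes "compact_op A"
  shows "compact (closure (blinfun_apply A ` cball 0 1))"
  unfolding compact_eq_totally_bounded
proof (intro conjI allI impI)
  show "complete (closure (blinfun_apply A ` cball 0 1))" by (simp add: complete_eq_closed)
  fix \<epsilon> :: real assume "\<epsilon> > 0"
  then have h: "\<epsilon> / 4 > 0" by simp
  obtain F where F: "finite F" "\<And>x. (\<And>e. e \<in> F \<Longrightarrow> cinner x e = 0) \<Longrightarrow> norm (A x) \<le> \<epsilon> / 4 * norm x"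
    by (rule compact_opD[OF assms h]) blast
  let ?F = "F \<union> (\<lambda>e. \<i> *\<^sub>C e) ` F"
  obtain C where C: "finite C" "span C = span ?F" "pairwise orthogonal C"
    using basis_orthogonal[of ?F] F(1) by auto
  have small: "norm (A z) \<le> \<epsilon> / 4 * norm z" if z: "\<And>e. e \<in> C \<Longrightarrow> inner z e = 0" for z
  proof (rule F(2))
    fix e assume e: "e \<in> F"
    have "inner z y = 0" if "y \<in> span C" for y
      using that by (induction rule: span_induct_alt) (auto simp: inner_add_right z)
    moreover have "e \<in> span C" "\<i> *\<^sub>C e \<in> span C"
      using e unfolding C(2) by (auto intro: span_base)
    ultimately have "Re (cinner z e) = 0" "Re (cinner z (\<i> *\<^sub>C e)) = 0" by (auto simp: Re_cinner)
    then show "cinner z e = 0" by (simp add: complex_eq_iff cinner_scaleC_right)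
  qed
  let ?K = "{\<Sum>e\<in>C. r e *\<^sub>R e |r. \<forall>e\<in>C. \<bar>r e\<bar> \<le> 1 / norm e}"
  have "compact (blinfun_apply A ` ?K)"
    by (intro compact_continuous_image compact_box C continuous_intros)
  then obtain k where k: "finite k" "blinfun_apply A ` ?K \<subseteq> (\<Union>x\<in>k. ball x (\<epsilon> / 4))"
    using h unfolding compact_eq_totally_bounded by meson
  have near: "\<exists>y\<in>k. dist y (A x) < \<epsilon> / 2" if x: "norm x \<le> 1" for x
  proof -
    \<comment> \<open>\<open>C\<close> is orthogonal but not normalised, and may contain \<open>0\<close>, where \<open>r\<close> vanishes.\<close>
    define r where "r e = inner x e / (norm e)\<^sup>2" for e
    define y where "y = (\<Sum>e\<in>C. r e *\<^sub>R e)"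
    have ye: "inner y e = inner x e" if e: "e \<in> C" for e
    proof -
      have "inner y e = (\<Sum>f\<in>C. if f = e then inner x e else 0)"
        unfolding y_def inner_sum_left
      proof (rule sum.cong)
        fix f assume "f \<in> C"
        then show "inner (r f *\<^sub>R f) e = (if f = e then inner x e else 0)"
          using C(3) e by (auto simp: r_def power2_norm_eq_inner pairwise_def orthogonal_def)
      qed simp
      then show ?thesis using C(1) e by simp
    qed
    have z: "inner (x - y) e = 0" if "e \<in> C" for e
      using ye[OF that] by (simp add: inner_diff_left)
    then have "inner (x - y) y = 0" unfolding y_def by (simp add: inner_sum_right)
    then have "(norm ((x - y) + y))\<^sup>2 = (norm (x - y))\<^sup>2 + (norm y)\<^sup>2"
      by (intro norm_add_Pythagorean) (simp add: orthogonal_def)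
    then have "(norm (x - y))\<^sup>2 \<le> (norm x)\<^sup>2" by simp
    then have "norm (x - y) \<le> 1" using x by (meson norm_ge_zero order_trans power2_le_imp_le)
    then have "\<epsilon> / 4 * norm (x - y) \<le> \<epsilon> / 4 * 1" using h by (intro mult_left_mono) auto
    then have Axy: "norm (A (x - y)) \<le> \<epsilon> / 4" using small[of "x - y"] z by simp
    have "\<bar>r e\<bar> \<le> 1 / norm e" if "e \<in> C" for e
    proof (cases "e = 0")
      case False
      have "\<bar>inner x e\<bar> \<le> 1 * norm e"
        using Cauchy_Schwarz_ineq2[of x e] x by (meson mult_right_mono norm_ge_zero order_trans)
      with False show ?thesis by (simp add: r_def divide_simps power2_eq_square)
    qed (simp add: r_def)
    then have "A y \<in> blinfun_apply A ` ?K" by (auto simp: y_def)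
    then have "A y \<in> (\<Union>x\<in>k. ball x (\<epsilon> / 4))" using k(2) by blast
    then obtain p where p: "p \<in> k" "dist p (A y) < \<epsilon> / 4" by auto
    have "dist (A y) (A x) \<le> \<epsilon> / 4"
      using Axy by (simp add: dist_norm blinfun.diff_right norm_minus_commute)
    then have "dist p (A x) < \<epsilon> / 2" using p(2) dist_triangle[of p "A x" "A y"] by linarith
    with p(1) show ?thesis by blast
  qed
  have "closure (blinfun_apply A ` cball 0 1) \<subseteq> (\<Union>x\<in>k. ball x \<epsilon>)"
  proof
    fix q assume "q \<in> closure (blinfun_apply A ` cball 0 1)"
    then obtain x where x: "norm x \<le> 1" "dist (A x) q < \<epsilon> / 4"
      using closure_approachable[THEN iffD1, rule_format, OF _ h] by fastforce
    obtain y where y: "y \<in> k" "dist y (A x) < \<epsilon> / 2" using near[OF x(1)] by blast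
    have "dist y q < \<epsilon>" using x(2) y(2) dist_triangle[of y q "A x"] \<open>\<epsilon> > 0\<close> by linarith
    with y(1) show "q \<in> (\<Union>x\<in>k. ball x \<epsilon>)" by auto
  qed
  with k(1) show "\<exists>k. finite k \<and> closure (blinfun_apply A ` cball 0 1) \<subseteq> (\<Union>x\<in>k. ball x \<epsilon>)" by blast
qed

definition abs_sq :: "('a::{complex_inner,banach} \<Rightarrow>\<^sub>L 'a) \<Rightarrow> ('a \<Rightarrow>\<^sub>L 'a)" where
  "abs_sq A = op_adjoint A o\<^sub>L A"

lemma cinner_abs_sq:
  "A \<in> bounded_ops \<Longrightarrow> cinner (abs_sq A x) y = cinner (blinfun_apply A x) (blinfun_apply A y)"
  by (metis abs_sq_def blinfun_apply_blinfun_compose cinner_commute cinner_op_adjoint)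

lemma inner_abs_sq:
  "A \<in> bounded_ops \<Longrightarrow> inner (abs_sq A x) y = inner (blinfun_apply A x) (blinfun_apply A y)"
  by (metis cinner_abs_sq Re_cinner)

lemma abs_sq_pos: "A \<in> bounded_ops \<Longrightarrow> pos_op (abs_sq A)"
  unfolding pos_op_def selfadj_def
proof (intro conjI allI)
  assume A: "A \<in> bounded_ops"
  show "abs_sq A \<in> bounded_ops"
    unfolding abs_sq_def by (intro bounded_ops_compose op_adjoint_bounded_ops A)
  show "cinner (abs_sq A x) y = cinner x (abs_sq A y)" for x y
    by (metis A cinner_abs_sq cinner_commute)
  show "0 \<le> inner (abs_sq A x) x" for x by (simp add: inner_abs_sq A)
qed

text \<open>The variational proof of the spectral theorem, run inside the orthogonal complement \<open>V\<close> of a set of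
eigenvectors of \<open>A\<^sup>*A\<close>, which is invariant under \<open>A\<^sup>*A\<close>. Unit vectors on which \<open>\<parallel>A x\<parallel>\<close> approaches its supremum \<open>l\<close>
over \<open>V\<close> are approximate eigenvectors for \<open>l\<^sup>2\<close>; compactness of \<open>A\<close> makes a subsequence converge.\<close>

lemma compact_op_eigenvector:
  fixes A :: "'a::{complex_inner,banach} \<Rightarrow>\<^sub>L 'a"
  assumes A: "A \<in> bounded_ops" "compact_op A"
    and E: "\<And>e. e \<in> E \<Longrightarrow> \<exists>\<mu>. abs_sq A e = \<mu> *\<^sub>R e"
    and x0: "x0 \<noteq> 0" "\<And>e. e \<in> E \<Longrightarrow> cinner x0 e = 0"
  shows "\<exists>x \<mu>. norm x = 1 \<and> (\<forall>e\<in>E. cinner x e = 0) \<and> abs_sq A x = \<mu> *\<^sub>R x"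
proof -
  let ?T = "abs_sq A"
  define V where "V = {x. \<forall>e\<in>E. cinner x e = 0}"
  have V_scale: "r *\<^sub>R x \<in> V" if "x \<in> V" for r x
    using that by (auto simp: V_def cinner.scaleR_left)
  have V_T: "?T x \<in> V" if "x \<in> V" for x
    unfolding V_def
  proof (intro CollectI ballI)
    fix e assume e: "e \<in> E"
    then obtain \<mu> where "?T e = \<mu> *\<^sub>R e" using E by blast
    then have "cinner x (?T e) = 0" using that e by (simp add: V_def cinner.scaleR_right)
    moreover have "cinner (?T x) e = cinner x (?T e)"
      using abs_sq_pos[OF A(1)] by (simp add: pos_op_def selfadj_def)
    ultimately show "cinner (?T x) e = 0" by simp
  qed
  let ?N = "{norm (A x) |x. x \<in> V \<and> norm x = 1}"
  define l where "l = Sup ?N"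
  define u0 where "u0 = (1 / norm x0) *\<^sub>R x0"
  have u0: "u0 \<in> V" "norm u0 = 1" using x0 by (auto simp: u0_def V_def cinner.scaleR_left)
  have bdd: "bdd_above ?N"
  proof (rule bdd_aboveI[of _ "norm A"])
    fix r assume "r \<in> ?N"
    then obtain x where "r = norm (A x)" "norm x = 1" by blast
    then show "r \<le> norm A" using norm_blinfun[of A x] by simp
  qed
  have ne: "?N \<noteq> {}" using u0 by blast
  have Al1: "norm (A x) \<le> l" if "x \<in> V" "norm x = 1" for x
    unfolding l_def by (rule cSup_upper) (use that bdd in auto)
  have Al: "norm (A x) \<le> l * norm x" if "x \<in> V" for x
  proof (cases "x = 0")
    case False
    have "norm (A ((1 / norm x) *\<^sub>R x)) \<le> l" using False that by (intro Al1 V_scale) auto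
    with False show ?thesis by (simp add: blinfun.scaleR_right divide_simps mult.commute)
  qed (simp add: blinfun.zero_right)
  have l0: "l \<ge> 0" using Al1[OF u0] norm_ge_zero order_trans by blast
  show ?thesis
  proof (cases "l = 0")
    case True
    then have "A u0 = 0" using Al1[OF u0] by simp
    then have "?T u0 = 0 *\<^sub>R u0" by (simp add: abs_sq_def blinfun.zero_right)
    then show ?thesis using u0 unfolding V_def by blast
  next
    case False
    with l0 have l: "l > 0" by simp
    have TV: "norm (?T x) \<le> l\<^sup>2 * norm x" if "x \<in> V" for x
    proof -
      have "norm (?T x) * norm (?T x) = inner (A x) (A (?T x))"
        by (simp add: inner_abs_sq[OF A(1), symmetric] power2_norm_eq_inner[symmetric] power2_eq_square)
      also have "\<dots> \<le> norm (A x) * norm (A (?T x))" by (rule norm_cauchy_schwarz)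
      also have "\<dots> \<le> (l * norm x) * (l * norm (?T x))"
        using l0 by (intro mult_mono Al V_T that) auto
      finally have "norm (?T x) * norm (?T x) \<le> (l\<^sup>2 * norm x) * norm (?T x)"
        by (simp add: power2_eq_square mult_ac)
      then show ?thesis by (cases "?T x = 0") auto
    qed
    have "\<exists>x. x \<in> V \<and> norm x = 1 \<and> norm (A x) > l - inverse (real (Suc n))" for n
      using less_cSup_iff[OF ne bdd, of "l - inverse (real (Suc n))"] by (auto simp: l_def)
    then obtain X where X: "\<And>n. X n \<in> V" "\<And>n. norm (X n) = 1"
      "\<And>n. norm (blinfun_apply A (X n)) > l - inverse (real (Suc n))" by metis
    have AX: "(\<lambda>n. norm (A (X n))) \<longlonglongrightarrow> l"
    proof (rule tendsto_sandwich)
      show "(\<lambda>n. l - inverse (real (Suc n))) \<longlonglongrightarrow> l"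
        using tendsto_diff[OF tendsto_const LIMSEQ_inverse_real_of_nat, of l] by simp
      show "\<forall>\<^sub>F n in sequentially. l - inverse (real (Suc n)) \<le> norm (A (X n))"
        by (intro always_eventually allI less_imp_le X)
      show "\<forall>\<^sub>F n in sequentially. norm (A (X n)) \<le> l"
        by (intro always_eventually allI Al1 X)
    qed simp
    \<comment> \<open>Expanding the square, \<open>\<parallel>?T x\<parallel> \<le> l\<^sup>2\<close> on unit vectors leaves \<open>2 l\<^sup>4 - 2 l\<^sup>2 \<parallel>A x\<parallel>\<^sup>2\<close>.\<close>
    have "(\<lambda>n. (norm (?T (X n) - l\<^sup>2 *\<^sub>R X n))\<^sup>2) \<longlonglongrightarrow> 0"
    proof (rule tendsto_sandwich[of "\<lambda>_. 0"])
      show "\<forall>\<^sub>F n in sequentially. (norm (?T (X n) - l\<^sup>2 *\<^sub>R X n))\<^sup>2 \<le> 2 * l^4 - 2 * l\<^sup>2 * (norm (A (X n)))\<^sup>2"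
      proof (intro always_eventually allI)
        fix n
        have "(norm (?T (X n) - l\<^sup>2 *\<^sub>R X n))\<^sup>2
            = (norm (?T (X n)))\<^sup>2 - 2 * l\<^sup>2 * inner (?T (X n)) (X n) + l^4 * (norm (X n))\<^sup>2"
          unfolding power2_norm_eq_inner
          by (simp add: inner_diff_left inner_diff_right inner_commute algebra_simps power2_eq_square
              power4_eq_xxxx)
        also have "inner (?T (X n)) (X n) = (norm (A (X n)))\<^sup>2"
          by (simp add: inner_abs_sq[OF A(1)] power2_norm_eq_inner)
        also have "(norm (?T (X n)))\<^sup>2 \<le> (l\<^sup>2)\<^sup>2"
          using TV[OF X(1), of n] X(2) by (intro power_mono) auto
        finally show "(norm (?T (X n) - l\<^sup>2 *\<^sub>R X n))\<^sup>2 \<le> 2 * l^4 - 2 * l\<^sup>2 * (norm (A (X n)))\<^sup>2"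
          by (simp add: X(2))
      qed
      have "(\<lambda>n. 2 * l^4 - 2 * l\<^sup>2 * (norm (A (X n)))\<^sup>2) \<longlonglongrightarrow> 2 * l^4 - 2 * l\<^sup>2 * l\<^sup>2"
        by (intro tendsto_intros AX)
      then show "(\<lambda>n. 2 * l^4 - 2 * l\<^sup>2 * (norm (A (X n)))\<^sup>2) \<longlonglongrightarrow> 0"
        by (simp add: power2_eq_square power4_eq_xxxx)
    qed auto
    then have "(\<lambda>n. sqrt ((norm (?T (X n) - l\<^sup>2 *\<^sub>R X n))\<^sup>2)) \<longlonglongrightarrow> sqrt 0"
      by (rule tendsto_real_sqrt)
    then have d0: "(\<lambda>n. ?T (X n) - l\<^sup>2 *\<^sub>R X n) \<longlonglongrightarrow> 0"
      by (simp add: tendsto_norm_zero_iff)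
    have "\<forall>n. blinfun_apply A (X n) \<in> closure (blinfun_apply A ` cball 0 1)"
      using X(2) by (auto intro!: closure_subset[THEN subsetD])
    then obtain y r where r: "strict_mono r" "((\<lambda>n. A (X n)) \<circ> r) \<longlonglongrightarrow> y"
      using compact_op_image_of_ball[OF A(2)] unfolding compact_def by metis
    have Tr: "(\<lambda>n. ?T (X (r n))) \<longlonglongrightarrow> op_adjoint A y"
      using r(2) unfolding abs_sq_def comp_def by (auto intro!: blinfun.tendsto tendsto_const)
    define x where "x = (1 / l\<^sup>2) *\<^sub>R op_adjoint A y"
    have "(\<lambda>n. (1 / l\<^sup>2) *\<^sub>R (?T (X (r n)) - (?T (X (r n)) - l\<^sup>2 *\<^sub>R X (r n)))) \<longlonglongrightarrow> (1 / l\<^sup>2) *\<^sub>R (op_adjoint A y - 0)"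
      by (intro tendsto_intros Tr) (use LIMSEQ_subseq_LIMSEQ[OF d0 r(1)] in \<open>simp add: comp_def\<close>)
    then have Xr: "(\<lambda>n. X (r n)) \<longlonglongrightarrow> x" using l by (simp add: x_def)
    have "(\<lambda>n. norm (X (r n))) \<longlonglongrightarrow> norm x" by (intro tendsto_intros Xr)
    then have 1: "norm x = 1" using X(2) by (simp add: LIMSEQ_const_iff)
    have 2: "cinner x e = 0" if "e \<in> E" for e
    proof -
      have "(\<lambda>n. cinner (X (r n)) e) \<longlonglongrightarrow> cinner x e" by (intro cinner.tendsto Xr tendsto_const)
      then show ?thesis using X(1) that by (simp add: V_def LIMSEQ_const_iff)
    qed
    have "(\<lambda>n. ?T (X (r n))) \<longlonglongrightarrow> ?T x" by (intro blinfun.tendsto Xr tendsto_const)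
    with Tr have "?T x = op_adjoint A y" by (rule LIMSEQ_unique[rotated])
    then have "?T x = l\<^sup>2 *\<^sub>R x" using l by (simp add: x_def)
    with 1 2 show ?thesis by blast
  qed
qed

text \<open>The right singular vectors of \<open>A\<close>, together with a basis of its kernel; the singular values are the
norms of the \<open>A e\<close>. Unlike a singular value decomposition this form needs no bookkeeping for vanishing singular
values.\<close>

definition singular_basis :: "('a::complex_inner \<Rightarrow>\<^sub>L 'a) \<Rightarrow> 'a set \<Rightarrow> bool" where
  "singular_basis A E \<longleftrightarrow> orthonormal_basis E \<and>
    (\<forall>e\<in>E. \<forall>f\<in>E. e \<noteq> f \<longrightarrow> cinner (A e) (A f) = 0)"

text \<open>A maximal orthonormal set of eigenvectors of \<open>A\<^sup>*A\<close> is an orthonormal basis, since a nonzero vector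
orthogonal to it would supply one more eigenvector.\<close>

lemma singular_basis_exists:
  fixes A :: "'a::{complex_inner,banach} \<Rightarrow>\<^sub>L 'a"
  assumes A: "A \<in> bounded_ops" "compact_op A"
  obtains E where "singular_basis A E"
proof -
  let ?S = "{x. \<exists>\<mu>. abs_sq A x = \<mu> *\<^sub>R x}"
  have "ortho_set ({}::'a set)" by (simp add: ortho_set_def)
  then obtain E where "{} \<subseteq> E" and E: "E \<subseteq> ?S" "ortho_set E"
    "\<forall>E'. ortho_set E' \<longrightarrow> E \<subseteq> E' \<longrightarrow> E' \<subseteq> ?S \<longrightarrow> E' = E"
    by (rule ortho_set_maximal[OF _ empty_subsetI])
  have "x = 0" if x: "\<forall>e\<in>E. cinner x e = 0" for x
  proof (rule ccontr)
    assume "x \<noteq> 0"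
    moreover have "\<And>e. e \<in> E \<Longrightarrow> \<exists>\<mu>. abs_sq A e = \<mu> *\<^sub>R e" using E(1) by blast
    ultimately obtain u \<mu> where u: "norm u = 1" "\<forall>e\<in>E. cinner u e = 0" "abs_sq A u = \<mu> *\<^sub>R u"
      using compact_op_eigenvector[OF A, of E x] x by blast
    have "ortho_set (insert u E)" using ortho_set_insert[OF E(2) u(1)] u(2) by blast
    moreover have "insert u E \<subseteq> ?S" using E(1) u(3) by blast
    ultimately have "u \<in> E" using E(3) by blast
    then show False using u(1,2) cinner_same[of u] by auto
  qed
  then have onb: "orthonormal_basis E"
    using E(2) unfolding orthonormal_basis_def ortho_set_def by blast
  have "cinner (A e) (A f) = 0" if ef: "e \<in> E" "f \<in> E" "e \<noteq> f" for e f
  proof -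
    obtain \<mu> where "abs_sq A e = \<mu> *\<^sub>R e" using E(1) ef(1) by blast
    then have "cinner (A e) (A f) = \<mu> *\<^sub>R cinner e f"
      by (metis cinner_abs_sq[OF A(1)] cinner.scaleR_left)
    then show ?thesis using ortho_set_cinner[OF E(2) ef(1,2)] ef(3) by simp
  qed
  then show thesis using that onb unfolding singular_basis_def by blast
qed

lemma singular_basis_eigen:
  fixes A :: "'a::{complex_inner,banach} \<Rightarrow>\<^sub>L 'a"
  assumes A: "A \<in> bounded_ops" "singular_basis A E" and e: "e \<in> E"
  shows "abs_sq A e = (norm (A e))\<^sup>2 *\<^sub>R e"
proof -
  have onb: "orthonormal_basis E" using A(2) by (simp add: singular_basis_def)
  have "((\<lambda>f. cinner (abs_sq A e) f *\<^sub>C f) has_sum abs_sq A e) E"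
    by (rule onb_expansion[OF onb])
  moreover have "((\<lambda>f. cinner (abs_sq A e) f *\<^sub>C f) has_sum cinner (abs_sq A e) e *\<^sub>C e) E"
    using A e by (intro has_sum_single) (auto simp: cinner_abs_sq singular_basis_def)
  ultimately have "abs_sq A e = cinner (abs_sq A e) e *\<^sub>C e" by (rule has_sum_unique)
  also have "cinner (abs_sq A e) e = complex_of_real ((norm (A e))\<^sup>2)"
    by (simp only: cinner_abs_sq[OF A(1)] cinner_same)
  finally show ?thesis by (simp only: scaleC_of_real)
qed

section \<open>Schatten norms in terms of singular bases\<close>

lemma has_sum_finite_sum:
  fixes f :: "'i \<Rightarrow> 'c \<Rightarrow> 'b::topological_comm_monoid_add"
  assumes "\<And>i. i \<in> I \<Longrightarrow> (f i has_sum s i) A"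
  shows "((\<lambda>x. \<Sum>i\<in>I. f i x) has_sum (\<Sum>i\<in>I. s i)) A"
  using assms
proof (induction I rule: infinite_finite_induct)
  case (insert i I)
  then show ?case by (simp add: has_sum_add)
qed simp_all

lemma has_sum_norm_le:
  fixes f :: "'b \<Rightarrow> 'c::real_normed_vector"
  assumes "(f has_sum S) A" "\<And>F. finite F \<Longrightarrow> F \<subseteq> A \<Longrightarrow> norm (sum f F) \<le> K"
  shows "norm S \<le> K"
proof (rule Lim_norm_ubound[OF finite_subsets_at_top_neq_bot])
  show "(sum f \<longlongrightarrow> S) (finite_subsets_at_top A)" using assms(1) by (simp add: has_sum_def)
  show "\<forall>\<^sub>F F in finite_subsets_at_top A. norm (sum f F) \<le> K"
    using assms(2) by (intro eventually_finite_subsets_at_top_weakI) auto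
qed

lemma infsum_ennreal_le_iff:
  assumes "\<And>x. x \<in> A \<Longrightarrow> 0 \<le> f x" "0 \<le> C"
  shows "(\<Sum>\<^sub>\<infinity>x\<in>A. ennreal (f x)) \<le> ennreal C \<longleftrightarrow> (\<forall>F. finite F \<longrightarrow> F \<subseteq> A \<longrightarrow> sum f F \<le> C)"
proof -
  have "(\<Sum>\<^sub>\<infinity>x\<in>A. ennreal (f x)) = (SUP F\<in>{F. finite F \<and> F \<subseteq> A}. \<Sum>x\<in>F. ennreal (f x))"
    by (rule nonneg_infsum_complete) simp
  also have "\<dots> = (SUP F\<in>{F. finite F \<and> F \<subseteq> A}. ennreal (sum f F))"
    by (intro SUP_cong refl sum_ennreal) (use assms in auto)
  finally show ?thesis using assms(2) by (auto simp: SUP_le_iff ennreal_le_iff)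
qed

lemma ennreal_powr_le_iff:
  assumes "r > 0" "C \<ge> 0"
  shows "ennreal_powr x (1 / r) \<le> ennreal C \<longleftrightarrow> x \<le> ennreal (C powr r)"
proof (cases x)
  case (real y)
  have "y powr (1 / r) \<le> C \<longleftrightarrow> y \<le> C powr r"
  proof
    assume "y powr (1 / r) \<le> C"
    then have "(y powr (1 / r)) powr r \<le> C powr r" using assms by (intro powr_mono2) auto
    then show "y \<le> C powr r" using real assms by (simp add: powr_powr)
  next
    assume "y \<le> C powr r"
    then have "y powr (1 / r) \<le> (C powr r) powr (1 / r)" using assms real by (intro powr_mono2) auto
    then show "y powr (1 / r) \<le> C" using assms by (simp add: powr_powr)
  qed
  then show ?thesis using real assms by (simp add: ennreal_powr_def ennreal_le_iff)
qed (simp_all add: ennreal_powr_def top_unique)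

lemma ennreal_powr_less_top: "ennreal_powr x r < \<infinity> \<longleftrightarrow> x < \<infinity>"
  by (cases x) (simp_all add: ennreal_powr_def)

text \<open>Both sides are the sum of the squared moduli of all matrix entries of \<open>R\<close>, once by rows and once by
columns. Applied in both directions it shows that the trace of \<open>R\<^sup>2\<close> does not depend on the basis.\<close>

lemma hilbert_schmidt_basis_le:
  fixes R :: "'a::{complex_inner,banach} \<Rightarrow>\<^sub>L 'a"
  assumes R: "selfadj R" and E: "orthonormal_basis E" and F: "orthonormal_basis F"
  shows "(\<Sum>\<^sub>\<infinity>e\<in>E. ennreal ((norm (R e))\<^sup>2)) \<le> (\<Sum>\<^sub>\<infinity>f\<in>F. ennreal ((norm (R f))\<^sup>2))"
proof (cases "\<Sum>\<^sub>\<infinity>f\<in>F. ennreal ((norm (R f))\<^sup>2)")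
  case (real C)
  then have C: "sum (\<lambda>f. (norm (R f))\<^sup>2) H \<le> C" if "finite H" "H \<subseteq> F" for H
    using infsum_ennreal_le_iff[of F "\<lambda>f. (norm (R f))\<^sup>2" C] that by simp
  have "sum (\<lambda>e. (norm (R e))\<^sup>2) G \<le> C" if G: "finite G" "G \<subseteq> E" for G
  proof (rule has_sum_le_finite_sums)
    show "((\<lambda>f. \<Sum>e\<in>G. (cmod (cinner (R e) f))\<^sup>2) has_sum (\<Sum>e\<in>G. (norm (R e))\<^sup>2)) F"
      by (intro has_sum_finite_sum parseval_norm F)
    fix H assume H: "finite H" "H \<subseteq> F"
    have "(\<Sum>f\<in>H. \<Sum>e\<in>G. (cmod (cinner (R e) f))\<^sup>2) \<le> (\<Sum>f\<in>H. (norm (R f))\<^sup>2)"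
    proof (rule sum_mono)
      fix f
      have "cmod (cinner (R e) f) = cmod (cinner (R f) e)" for e
        by (metis R selfadjD cinner_commute complex_mod_cnj)
      then show "(\<Sum>e\<in>G. (cmod (cinner (R e) f))\<^sup>2) \<le> (norm (R f))\<^sup>2"
        using bessel[OF ortho_set_subset[OF orthonormal_basisD[OF E] G(2)] G(1), of "R f"] by simp
    qed
    also have "\<dots> \<le> C" by (rule C[OF H])
    finally show "(\<Sum>f\<in>H. \<Sum>e\<in>G. (cmod (cinner (R e) f))\<^sup>2) \<le> C" .
  qed
  then show ?thesis using real infsum_ennreal_le_iff[of E "\<lambda>f. (norm (R f))\<^sup>2" C] by simp
qed simp

text \<open>On vectors orthogonal to finitely many basis vectors only a tail of the square sum matters, by the
Cauchy-Schwarz inequality.\<close>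

lemma hilbert_schmidt_compact:
  fixes R :: "'a::{complex_inner,banach} \<Rightarrow>\<^sub>L 'a"
  assumes R: "R \<in> bounded_ops" and E: "orthonormal_basis E"
    and fin: "(\<Sum>\<^sub>\<infinity>e\<in>E. ennreal ((norm (R e))\<^sup>2)) < \<infinity>"
  shows "compact_op R"
  unfolding compact_op_def
proof (intro allI impI)
  fix \<epsilon> :: real assume "\<epsilon> > 0"
  note oE = orthonormal_basisD[OF E]
  obtain K where "K \<ge> 0" "(\<Sum>\<^sub>\<infinity>e\<in>E. ennreal ((norm (R e))\<^sup>2)) \<le> ennreal K"
    using fin by (metis enn2real_nonneg ennreal_enn2real infinity_ennreal_def order_refl)
  then have "sum (\<lambda>f. (norm (R f))\<^sup>2) H \<le> K" if "finite H" "H \<subseteq> E" for H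
    using infsum_ennreal_le_iff[of E "\<lambda>f. (norm (R f))\<^sup>2" K] that by simp
  then have "(\<lambda>f. (norm (R f))\<^sup>2) summable_on E" by (intro summable_on_bounded_sums) auto
  then obtain F where F: "finite F" "F \<subseteq> E"
    "\<And>G. finite G \<Longrightarrow> G \<subseteq> E - F \<Longrightarrow> (\<Sum>e\<in>G. (norm (R e))\<^sup>2) \<le> \<epsilon>\<^sup>2"
    using summable_on_small_tail[of "\<lambda>f. (norm (R f))\<^sup>2" E "\<epsilon>\<^sup>2"] \<open>\<epsilon> > 0\<close> by auto
  show "\<exists>F. finite F \<and> (\<forall>x. (\<forall>e\<in>F. cinner x e = 0) \<longrightarrow> norm (R x) \<le> \<epsilon> * norm x)"
  proof (intro exI[of _ F] conjI F(1) allI impI)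
    fix x assume x: "\<forall>e\<in>F. cinner x e = 0"
    show "norm (R x) \<le> \<epsilon> * norm x"
    proof (rule has_sum_norm_le[OF op_expansion[OF R E]])
      fix G assume G: "finite G" "G \<subseteq> E"
      have "norm (\<Sum>e\<in>G. cinner x e *\<^sub>C R e) = norm (\<Sum>e\<in>G - F. cinner x e *\<^sub>C R e)"
        using x G by (intro arg_cong[where f = norm] sum.mono_neutral_right) auto
      also have "\<dots> \<le> (\<Sum>e\<in>G - F. norm (cinner x e *\<^sub>C R e))" by (rule norm_sum)
      also have "\<dots> = (\<Sum>e\<in>G - F. cmod (cinner x e) * norm (R e))" by (simp add: norm_scaleC)
      also have "\<dots> \<le> L2_set (\<lambda>e. cmod (cinner x e)) (G - F) * L2_set (\<lambda>e. norm (R e)) (G - F)"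
        using L2_set_mult_ineq[of "\<lambda>e. cmod (cinner x e)" "\<lambda>e. norm (R e)" "G - F"] by simp
      also have "\<dots> \<le> norm x * \<epsilon>"
      proof (rule mult_mono)
        have "(\<Sum>e\<in>G - F. (cmod (cinner x e))\<^sup>2) \<le> (norm x)\<^sup>2"
          using G by (intro bessel) (auto intro: ortho_set_subset[OF oE])
        then show "L2_set (\<lambda>e. cmod (cinner x e)) (G - F) \<le> norm x"
          unfolding L2_set_def by (intro real_le_lsqrt) (auto intro: sum_nonneg)
        have "(\<Sum>e\<in>G - F. (norm (R e))\<^sup>2) \<le> \<epsilon>\<^sup>2" using G by (intro F(3)) auto
        then show "L2_set (\<lambda>e. norm (R e)) (G - F) \<le> \<epsilon>"
          unfolding L2_set_def using \<open>\<epsilon> > 0\<close> by (intro real_le_lsqrt) (auto intro: sum_nonneg)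
      qed (auto intro: L2_set_nonneg)
      finally show "norm (\<Sum>e\<in>G. cinner x e *\<^sub>C R e) \<le> \<epsilon> * norm x" by (simp add: mult.commute)
    qed
  qed
qed

subsection \<open>The absolute value\<close>

lemma op_abs_eq: "op_abs A = op_fun sqrt (abs_sq A)"
  by (simp add: op_abs_def abs_sq_def)

lemma op_abs_pos: "A \<in> bounded_ops \<Longrightarrow> pos_op (op_abs (A :: 'a::{complex_inner,banach} \<Rightarrow>\<^sub>L 'a))"
  unfolding op_abs_eq by (intro op_fun_pos abs_sq_pos continuous_intros) auto

lemma op_abs_op_abs:
  fixes A :: "'a::{complex_inner,banach} \<Rightarrow>\<^sub>L 'a"
  assumes A: "A \<in> bounded_ops"
  shows "op_abs A (op_abs A x) = abs_sq A x"
proof -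
  have c: "continuous_on {0..norm (abs_sq A)} sqrt" by (intro continuous_intros)
  have "op_abs A (op_abs A x) = op_fun (\<lambda>t. sqrt t * sqrt t) (abs_sq A) x"
    unfolding op_abs_eq by (rule op_fun_mult[OF abs_sq_pos[OF A] c c, symmetric])
  also have "op_fun (\<lambda>t. sqrt t * sqrt t) (abs_sq A) = op_fun (\<lambda>t. t) (abs_sq A)"
    by (rule op_fun_cong[OF abs_sq_pos[OF A]]) (auto intro!: continuous_intros)
  also have "\<dots> = abs_sq A" by (rule op_fun_id[OF abs_sq_pos[OF A]])
  finally show ?thesis .
qed

definition abs_powr :: "real \<Rightarrow> ('a::{complex_inner,banach} \<Rightarrow>\<^sub>L 'a) \<Rightarrow> ('a \<Rightarrow>\<^sub>L 'a)" where
  "abs_powr a A = op_fun (\<lambda>t. t powr a) (op_abs A)"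

lemma continuous_on_powr_const: "a > 0 \<Longrightarrow> continuous_on {0..b::real} (\<lambda>t. t powr a)"
  by (rule continuous_on_powr') (auto intro: continuous_intros)

lemma abs_powr_pos: "A \<in> bounded_ops \<Longrightarrow> a > 0 \<Longrightarrow> pos_op (abs_powr a A)"
  unfolding abs_powr_def by (intro op_fun_pos op_abs_pos continuous_on_powr_const) auto

text \<open>The square root of \<open>|A|\<^sup>r\<close> is again a power of \<open>|A|\<close>, so that traces of \<open>|A|\<^sup>r\<close> are squares of
Hilbert-Schmidt norms.\<close>

lemma abs_powr_half:
  assumes "A \<in> bounded_ops" "r > 0"
  shows "abs_powr r A x = abs_powr (r / 2) A (abs_powr (r / 2) A x)"
proof -
  have eq: "(\<lambda>t::real. t powr r) = (\<lambda>t. t powr (r / 2) * t powr (r / 2))"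
    by (simp add: powr_add[symmetric])
  have r: "r / 2 > 0" using assms(2) by simp
  show ?thesis
    unfolding abs_powr_def
    by (subst eq) (rule op_fun_mult[OF op_abs_pos[OF assms(1)] continuous_on_powr_const[OF r]
          continuous_on_powr_const[OF r]])
qed

lemma norm_abs_powr_half:
  assumes "A \<in> bounded_ops" "r > 0"
  shows "inner (abs_powr r A x) x = (norm (abs_powr (r / 2) A x))\<^sup>2"
  using abs_powr_pos[of A "r / 2"] assms
  by (subst abs_powr_half) (simp_all add: selfadj_inner pos_op_def power2_norm_eq_inner)

lemma schatten_norm_basis:
  fixes A :: "'a::{complex_inner,banach} \<Rightarrow>\<^sub>L 'a"
  assumes A: "A \<in> bounded_ops" and r: "r > 0" and E: "orthonormal_basis E"
  shows "schatten_norm (ennreal r) A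
    = ennreal_powr (\<Sum>\<^sub>\<infinity>e\<in>E. ennreal ((norm (abs_powr (r / 2) A e))\<^sup>2)) (1 / r)"
proof -
  have sa: "selfadj (abs_powr (r / 2) A)" using abs_powr_pos[OF A, of "r / 2"] r by (simp add: pos_op_def)
  have "pos_trace (op_fun (\<lambda>t. t powr r) (op_abs A))
      = (\<Sum>\<^sub>\<infinity>e\<in>(SOME E. orthonormal_basis E). ennreal ((norm (abs_powr (r / 2) A e))\<^sup>2))"
    using norm_abs_powr_half[OF A r] by (simp add: pos_trace_def abs_powr_def Re_cinner)
  also have "\<dots> = (\<Sum>\<^sub>\<infinity>e\<in>E. ennreal ((norm (abs_powr (r / 2) A e))\<^sup>2))"
    by (intro antisym hilbert_schmidt_basis_le sa E some_orthonormal_basis)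
  finally show ?thesis using r by (simp add: schatten_norm_def)
qed

text \<open>The vectors of a singular basis are eigenvectors of \<open>A\<^sup>*A\<close>, hence of all continuous functions of it, and the
trace may be computed in this basis.\<close>

theorem schatten_norm_singular:
  fixes A :: "'a::{complex_inner,banach} \<Rightarrow>\<^sub>L 'a"
  assumes A: "A \<in> bounded_ops" and r: "r > 0" and E: "singular_basis A E"
  shows "schatten_norm (ennreal r) A = ennreal_powr (\<Sum>\<^sub>\<infinity>e\<in>E. ennreal (norm (A e) powr r)) (1 / r)"
proof -
  have onb: "orthonormal_basis E" using E by (simp add: singular_basis_def)
  have "(norm (abs_powr (r / 2) A e))\<^sup>2 = norm (A e) powr r" if e: "e \<in> E" for e
  proof -
    have "op_abs A e = sqrt ((norm (A e))\<^sup>2) *\<^sub>R e"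
      unfolding op_abs_eq
      by (rule op_fun_eigen[OF abs_sq_pos[OF A]])
        (auto intro!: continuous_intros singular_basis_eigen[OF A E e])
    then have 1: "op_abs A e = norm (A e) *\<^sub>R e" by simp
    have "abs_powr (r / 2) A e = norm (A e) powr (r / 2) *\<^sub>R e"
      unfolding abs_powr_def using r
      by (intro op_fun_eigen[OF op_abs_pos[OF A] _ 1] continuous_on_powr_const) auto
    then show ?thesis
      using ortho_set_norm[OF orthonormal_basisD[OF onb] e]
      by (simp add: power2_eq_square powr_add[symmetric])
  qed
  then have "(\<Sum>\<^sub>\<infinity>e\<in>E. ennreal ((norm (abs_powr (r / 2) A e))\<^sup>2)) = (\<Sum>\<^sub>\<infinity>e\<in>E. ennreal (norm (A e) powr r))"
    by (intro infsum_cong) simp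
  then show ?thesis using schatten_norm_basis[OF A r onb] by simp
qed

text \<open>The operator \<open>R = |A|\<^bsup>r/2\<^esup>\<close> is Hilbert-Schmidt, hence compact. On the spectrum of \<open>|A|\<close> one has
\<open>t\<^sup>2 \<le> \<delta>\<^sup>2 + c t\<^sup>r\<close>, so \<open>\<parallel>A x\<parallel>\<^sup>2 \<le> \<delta>\<^sup>2 \<parallel>x\<parallel>\<^sup>2 + c \<parallel>R x\<parallel>\<^sup>2\<close>, and smallness of \<open>R\<close> on a subspace passes to \<open>A\<close>. This
argument covers all exponents at once.\<close>

theorem schatten_finite_compact:
  fixes A :: "'a::{complex_inner,banach} \<Rightarrow>\<^sub>L 'a"
  assumes A: "A \<in> bounded_ops" and r: "r > 0" and fin: "schatten_norm (ennreal r) A < \<infinity>"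
  shows "compact_op A"
  unfolding compact_op_def
proof (intro allI impI)
  fix \<epsilon> :: real assume \<epsilon>: "\<epsilon> > 0"
  let ?R = "abs_powr (r / 2) A"
  let ?b = "norm (op_abs A)"
  have R: "?R \<in> bounded_ops" using abs_powr_pos[OF A, of "r / 2"] r by (simp add: pos_op_def)
  have "compact_op ?R"
    using fin unfolding schatten_norm_basis[OF A r some_orthonormal_basis] ennreal_powr_less_top
    by (rule hilbert_schmidt_compact[OF R some_orthonormal_basis])
  define \<delta> where "\<delta> = \<epsilon> / 2"
  \<comment> \<open>With this \<open>c\<close> the term \<open>c t\<^sup>r\<close> exceeds \<open>t\<^sup>2\<close> on \<open>[\<delta>, ?b]\<close>, while \<open>\<delta>\<^sup>2\<close> does so below \<open>\<delta>\<close>.\<close>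
  define c where "c = ?b\<^sup>2 / \<delta> powr r"
  have \<delta>: "\<delta> > 0" and c: "c \<ge> 0" using \<epsilon> by (auto simp: \<delta>_def c_def)
  have le: "t * t \<le> \<delta>\<^sup>2 + c * t powr r" if t: "t \<in> {0..?b}" for t
  proof (cases "t \<le> \<delta>")
    case True
    then have "t * t \<le> \<delta>\<^sup>2" using t by (simp add: power2_eq_square mult_mono)
    moreover have "0 \<le> c * t powr r" using c by simp
    ultimately show ?thesis by linarith
  next
    case False
    then have "\<delta> powr r \<le> t powr r" using \<delta> r by (intro powr_mono2) auto
    then have "c * \<delta> powr r \<le> c * t powr r" using c by (rule mult_left_mono)
    moreover have "c * \<delta> powr r = ?b\<^sup>2" using \<delta> by (simp add: c_def)
    moreover have "t * t \<le> ?b\<^sup>2" using t by (simp add: power2_eq_square mult_mono)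
    moreover have "0 \<le> \<delta>\<^sup>2" by simp
    ultimately show ?thesis by linarith
  qed
  have bound: "(norm (A x))\<^sup>2 \<le> \<delta>\<^sup>2 * (norm x)\<^sup>2 + c * (norm (?R x))\<^sup>2" for x
  proof -
    have N: "pos_op (op_abs A)" by (rule op_abs_pos[OF A])
    have "(norm (A x))\<^sup>2 = inner (op_abs A (op_abs A x)) x"
      by (simp add: op_abs_op_abs[OF A] inner_abs_sq[OF A] power2_norm_eq_inner)
    also have "\<dots> = inner (op_fun (\<lambda>t. t * t) (op_abs A) x) x"
      using op_fun_mult[OF N continuous_on_id continuous_on_id, of x] op_fun_id[OF N] by simp
    also have "\<dots> \<le> \<delta>\<^sup>2 * (norm x)\<^sup>2 + c * inner (op_fun (\<lambda>t. t powr r) (op_abs A) x) x"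
      by (rule op_fun_le[OF N]) (auto intro!: continuous_intros continuous_on_powr_const r c le)
    also have "inner (op_fun (\<lambda>t. t powr r) (op_abs A) x) x = (norm (?R x))\<^sup>2"
      using norm_abs_powr_half[OF A r] by (simp add: abs_powr_def)
    finally show ?thesis .
  qed
  \<comment> \<open>Chosen so that \<open>c \<eta>\<^sup>2 \<le> \<delta>\<^sup>2\<close>, also when \<open>c = 0\<close>.\<close>
  define \<eta> where "\<eta> = \<delta> / sqrt (c + 1)"
  have \<eta>: "\<eta> > 0" using \<delta> c by (simp add: \<eta>_def)
  obtain F where F: "finite F" "\<And>x. (\<And>e. e \<in> F \<Longrightarrow> cinner x e = 0) \<Longrightarrow> norm (?R x) \<le> \<eta> * norm x"
    by (rule compact_opD[OF \<open>compact_op ?R\<close> \<eta>]) blast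
  show "\<exists>F. finite F \<and> (\<forall>x. (\<forall>e\<in>F. cinner x e = 0) \<longrightarrow> norm (A x) \<le> \<epsilon> * norm x)"
  proof (intro exI[of _ F] conjI F(1) allI impI)
    fix x assume "\<forall>e\<in>F. cinner x e = 0"
    then have "(norm (?R x))\<^sup>2 \<le> (\<eta> * norm x)\<^sup>2" by (intro power_mono F(2)) auto
    then have "c * (norm (?R x))\<^sup>2 \<le> c * (\<eta> * norm x)\<^sup>2" using c by (rule mult_left_mono)
    also have "c * (\<eta> * norm x)\<^sup>2 = c / (c + 1) * (\<delta>\<^sup>2 * (norm x)\<^sup>2)"
      using c by (simp add: \<eta>_def power_mult_distrib power_divide)
    also have "\<dots> \<le> 1 * (\<delta>\<^sup>2 * (norm x)\<^sup>2)" using c by (intro mult_right_mono) auto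
    finally have "(norm (A x))\<^sup>2 \<le> 2 * (\<delta>\<^sup>2 * (norm x)\<^sup>2)" using bound[of x] by linarith
    also have "\<dots> \<le> 4 * (\<delta>\<^sup>2 * (norm x)\<^sup>2)" by simp
    also have "\<dots> = (\<epsilon> * norm x)\<^sup>2" by (simp add: \<delta>_def power_mult_distrib power_divide)
    finally show "norm (A x) \<le> \<epsilon> * norm x" using \<epsilon> by (rule_tac power2_le_imp_le) auto
  qed
qed

theorem schatten_norm_le_iff:
  fixes A :: "'a::{complex_inner,banach} \<Rightarrow>\<^sub>L 'a"
  assumes A: "A \<in> bounded_ops" and r: "r > 0" and E: "singular_basis A E" and C: "C \<ge> 0"
  shows "schatten_norm (ennreal r) A \<le> ennreal C \<longleftrightarrow>
    (\<forall>F. finite F \<longrightarrow> F \<subseteq> E \<longrightarrow> (\<Sum>e\<in>F. norm (A e) powr r) \<le> C powr r)"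
  unfolding schatten_norm_singular[OF A r E] ennreal_powr_le_iff[OF r C]
  by (rule infsum_ennreal_le_iff) auto

lemma schatten_singular_basis:
  fixes A :: "'a::{complex_inner,banach} \<Rightarrow>\<^sub>L 'a"
  assumes A: "A \<in> bounded_ops" and r: "r > 0" and C: "schatten_norm (ennreal r) A \<le> ennreal C" "C \<ge> 0"
  obtains E where "singular_basis A E"
    "\<And>F. finite F \<Longrightarrow> F \<subseteq> E \<Longrightarrow> (\<Sum>e\<in>F. norm (A e) powr r) \<le> C powr r"
proof -
  have "schatten_norm (ennreal r) A < \<infinity>" using C(1) by (simp add: le_less_trans)
  then obtain E where E: "singular_basis A E"
    using singular_basis_exists[OF A schatten_finite_compact[OF A r]] by blast
  with that schatten_norm_le_iff[OF A r E C(2)] C(1) show thesis by blast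
qed

section \<open>Pairings of Schatten operators\<close>

text \<open>Convexity of \<open>x \<mapsto> x\<^sup>r\<close>: its graph lies above the tangent at \<open>a\<close>. Integrated against weights of total
mass at most one, it gives Jensen's inequality.\<close>

lemma powr_tangent:
  fixes x a r :: real
  assumes "x \<ge> 0" "a \<ge> 0" "r \<ge> 1"
  shows "r * a powr (r - 1) * x - (r - 1) * a powr r \<le> x powr r"
proof (cases "x = 0 \<or> a = 0")
  case True
  then show ?thesis using assms by auto
next
  case False
  then have pos: "x > 0" "a > 0" using assms by auto
  have "(x powr r) powr (1 / r) * (a powr r) powr (1 - 1 / r) \<le> 1 / r * x powr r + (1 - 1 / r) * a powr r"
    using assms pos by (intro Youngs_inequality_0) auto
  also have "(x powr r) powr (1 / r) * (a powr r) powr (1 - 1 / r) = x * a powr (r - 1)"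
    using assms pos by (simp add: powr_powr right_diff_distrib)
  finally have "r * (x * a powr (r - 1)) \<le> r * (1 / r * x powr r + (1 - 1 / r) * a powr r)"
    using assms by (intro mult_left_mono) auto
  also have "\<dots> = x powr r + (r - 1) * a powr r" using assms by (simp add: field_simps)
  finally show ?thesis by (simp add: mult_ac)
qed

text \<open>The relation \<open>1/r + 1/q = 1\<close> with \<open>1 \<le> r < \<infinity>\<close>, solved for \<open>q\<close>.\<close>

definition conj_exp :: "real \<Rightarrow> ennreal \<Rightarrow> bool" where
  "conj_exp r q \<longleftrightarrow> (r = 1 \<and> q = \<infinity>) \<or> (r > 1 \<and> q = ennreal (r / (r - 1)))"

lemma conj_exp_ge1: "conj_exp r q \<Longrightarrow> r \<ge> 1"
  by (auto simp: conj_exp_def)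

text \<open>The last step of both sharpness arguments: testing an element against its extremal partner bounds the
\<open>s\<close>-th power \<open>S\<close> of its norm by \<open>C\<close> times the \<open>r\<close>-norm of the partner, which is \<open>S\<close> to the power \<open>1/r\<close>.\<close>

lemma powr_self_bound:
  fixes S C r s :: real
  assumes r: "r > 1" and s_def: "s = r / (r - 1)" and S0: "S \<ge> 0" and le: "S \<le> C * S powr (1 / r)"
  shows "S \<le> C powr s"
proof (cases "S = 0")
  case False
  have s: "s > 1" "1 - 1 / r = 1 / s" using r by (auto simp: s_def field_simps)
  from False have Sp: "S > 0" using S0 by simp
  have "S powr (1 / s) * S powr (1 / r) = S" using Sp by (simp add: powr_add[symmetric] flip: s(2))
  with le have "S powr (1 / s) * S powr (1 / r) \<le> C * S powr (1 / r)" by simp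
  then have "S powr (1 / s) \<le> C" using Sp by simp
  then have "(S powr (1 / s)) powr s \<le> C powr s" using s by (intro powr_mono2) auto
  then show ?thesis using Sp s by (simp add: powr_powr)
qed simp

lemma sum_powr_Holder:
  fixes u v :: "'i \<Rightarrow> real"
  assumes r: "r > 1" and s: "s = r / (r - 1)" and nn: "\<And>i. i \<in> I \<Longrightarrow> 0 \<le> u i" "\<And>i. i \<in> I \<Longrightarrow> 0 \<le> v i"
    and C: "(\<Sum>i\<in>I. u i powr r) \<le> C powr r" "C \<ge> 0" and D: "(\<Sum>i\<in>I. v i powr s) \<le> D powr s" "D \<ge> 0"
    and fin: "finite I"
  shows "(\<Sum>i\<in>I. u i * v i) \<le> C * D"
proof -
  have s1: "s > 1" "1 / r + 1 / s = 1" using r by (auto simp: s field_simps)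
  have zero: "w i = 0" if "(\<Sum>i\<in>I. w i powr t) \<le> 0" "\<And>i. i \<in> I \<Longrightarrow> 0 \<le> w i" "i \<in> I"
    for w :: "'i \<Rightarrow> real" and t i
  proof -
    have "(\<Sum>i\<in>I. w i powr t) = 0" using that(1) by (intro antisym sum_nonneg) auto
    then show ?thesis using that fin by (simp add: sum_nonneg_eq_0_iff)
  qed
  show ?thesis
  proof (cases "C = 0 \<or> D = 0")
    case True
    then have "u i * v i = 0" if "i \<in> I" for i
      using zero[of u r i] zero[of v s i] C D nn that by auto
    then have "(\<Sum>i\<in>I. u i * v i) = 0" by (intro sum.neutral ballI)
    then show ?thesis using C D by simp
  next
    case False
    then have pos: "C > 0" "D > 0" using C D by auto
    have "(\<Sum>i\<in>I. (u i / C) * (v i / D)) \<le> (\<Sum>i\<in>I. (u i / C) powr r / r + (v i / D) powr s / s)"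
      using nn pos r s1 by (intro sum_mono Youngs_inequality) auto
    also have "\<dots> = (\<Sum>i\<in>I. u i powr r) / C powr r / r + (\<Sum>i\<in>I. v i powr s) / D powr s / s"
      using nn pos by (simp add: sum.distrib powr_divide sum_divide_distrib[symmetric])
    also have "\<dots> \<le> 1 / r + 1 / s"
      using C D pos r s1 by (intro add_mono divide_right_mono) auto
    finally have "(\<Sum>i\<in>I. u i * v i) / (C * D) \<le> 1" using s1 by (simp add: sum_divide_distrib)
    then show ?thesis using pos by (simp add: divide_le_eq)
  qed
qed

subsection \<open>Bessel families\<close>

text \<open>Families that satisfy Bessel's inequality. Unlike orthonormal families they are stable under
contractions, which is what the product estimate \<open>schatten_compose\<close> uses.\<close>

definition bessel_fam :: "'i set \<Rightarrow> ('i \<Rightarrow> 'a::complex_inner) \<Rightarrow> bool" where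
  "bessel_fam I x \<longleftrightarrow> finite I \<and> (\<forall>v. (\<Sum>i\<in>I. (cmod (cinner v (x i)))\<^sup>2) \<le> (norm v)\<^sup>2)"

lemma bessel_famD: "bessel_fam I x \<Longrightarrow> (\<Sum>i\<in>I. (cmod (cinner v (x i)))\<^sup>2) \<le> (norm v)\<^sup>2"
  by (simp add: bessel_fam_def)

lemma bessel_fam_ortho: "ortho_set I \<Longrightarrow> finite I \<Longrightarrow> bessel_fam I (\<lambda>i. i)"
  by (simp add: bessel_fam_def bessel)

lemma bessel_fam_norm:
  assumes "bessel_fam I x" "i \<in> I"
  shows "norm (x i) \<le> 1"
proof -
  have "(cmod (cinner (x i) (x i)))\<^sup>2 \<le> (\<Sum>j\<in>I. (cmod (cinner (x i) (x j)))\<^sup>2)"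
    using assms by (intro member_le_sum) (auto simp: bessel_fam_def)
  also have "\<dots> \<le> (norm (x i))\<^sup>2" by (rule bessel_famD[OF assms(1)])
  finally have "(norm (x i))\<^sup>2 * (norm (x i))\<^sup>2 \<le> 1 * (norm (x i))\<^sup>2"
    by (simp add: cmod_cinner_same power2_eq_square)
  then have "x i = 0 \<or> (norm (x i))\<^sup>2 \<le> 1" by (metis mult_le_cancel_right_pos norm_eq_zero zero_less_power2)
  then show ?thesis by (auto simp: power2_le_iff_abs_le abs_square_le_1)
qed

text \<open>The synthesis operator is the adjoint of the analysis operator, so it is a contraction as well.\<close>

lemma bessel_fam_synthesis:
  assumes "bessel_fam I x"
  shows "(norm (\<Sum>i\<in>I. c i *\<^sub>C x i))\<^sup>2 \<le> (\<Sum>i\<in>I. (cmod (c i))\<^sup>2)"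
proof -
  let ?w = "\<Sum>i\<in>I. c i *\<^sub>C x i"
  have "(norm ?w)\<^sup>2 = cmod (cinner ?w ?w)" by (simp add: cmod_cinner_same)
  also have "cinner ?w ?w = (\<Sum>i\<in>I. c i * cinner (x i) ?w)"
    by (simp only: cinner.sum_left[of _ I] cinner_scaleC_left)
  also have "cmod \<dots> \<le> (\<Sum>i\<in>I. cmod (c i) * cmod (cinner ?w (x i)))"
    by (rule order_trans[OF norm_sum]) (simp add: norm_mult cinner_commute[of "x _" ?w])
  also have "\<dots> \<le> (\<Sum>i\<in>I. ((cmod (c i))\<^sup>2 + (cmod (cinner ?w (x i)))\<^sup>2) / 2)"
  proof (rule sum_mono)
    fix i
    have "0 \<le> (cmod (c i) - cmod (cinner ?w (x i)))\<^sup>2" by simp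
    then show "cmod (c i) * cmod (cinner ?w (x i)) \<le> ((cmod (c i))\<^sup>2 + (cmod (cinner ?w (x i)))\<^sup>2) / 2"
      by (simp add: power2_diff)
  qed
  also have "\<dots> = (\<Sum>i\<in>I. (cmod (c i))\<^sup>2) / 2 + (\<Sum>i\<in>I. (cmod (cinner ?w (x i)))\<^sup>2) / 2"
    by (simp add: add_divide_distrib sum.distrib sum_divide_distrib)
  also have "\<dots> \<le> (\<Sum>i\<in>I. (cmod (c i))\<^sup>2) / 2 + (norm ?w)\<^sup>2 / 2"
    using bessel_famD[OF assms, of ?w] by simp
  finally show ?thesis by simp
qed

text \<open>The left singular vector belonging to \<open>e\<close>; it is \<open>0\<close> if \<open>A e = 0\<close>, because \<open>1 / 0 = 0\<close>.\<close>

definition unit_image :: "('a::complex_inner \<Rightarrow>\<^sub>L 'a) \<Rightarrow> 'a \<Rightarrow> 'a" where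
  "unit_image A e = (1 / norm (A e)) *\<^sub>R A e"

lemma norm_unit_image: "blinfun_apply A e \<noteq> 0 \<Longrightarrow> norm (unit_image A e) = 1"
  by (simp add: unit_image_def)

lemma unit_image_scale: "norm (blinfun_apply A e) *\<^sub>R unit_image A e = A e"
  by (simp add: unit_image_def)

lemma singular_unit_image_ortho:
  assumes "singular_basis A E" "F \<subseteq> {e \<in> E. A e \<noteq> 0}"
  shows "inj_on (unit_image A) F" "ortho_set (unit_image A ` F)"
proof -
  have z: "cinner (unit_image A e) (unit_image A f) = (if e = f then 1 else 0)"
    if "e \<in> F" "f \<in> F" for e f
    using that assms norm_unit_image[of A e] cinner_same[of "unit_image A e"]
    by (auto simp: singular_basis_def unit_image_def cinner.scaleR_left cinner.scaleR_right subset_eq)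
  show "inj_on (unit_image A) F"
    by (rule inj_onI) (metis z zero_neq_one)
  show "ortho_set (unit_image A ` F)"
    unfolding ortho_set_def using z by (auto) (metis zero_neq_one)
qed

lemma bessel_fam_unit_image:
  assumes A: "singular_basis A E" and F: "finite F" "F \<subseteq> E"
  shows "bessel_fam F (unit_image A)"
  unfolding bessel_fam_def
proof (intro conjI allI F(1))
  fix v
  let ?F = "{e \<in> F. A e \<noteq> 0}"
  have sub: "?F \<subseteq> {e \<in> E. A e \<noteq> 0}" using F by auto
  have "(\<Sum>i\<in>F. (cmod (cinner v (unit_image A i)))\<^sup>2) = (\<Sum>i\<in>?F. (cmod (cinner v (unit_image A i)))\<^sup>2)"
    using F(1) by (intro sum.mono_neutral_right) (auto simp: unit_image_def)
  also have "\<dots> = (\<Sum>f\<in>unit_image A ` ?F. (cmod (cinner v f))\<^sup>2)"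
    by (simp add: sum.reindex[OF singular_unit_image_ortho(1)[OF A sub]])
  also have "\<dots> \<le> (norm v)\<^sup>2"
    using F(1) by (intro bessel singular_unit_image_ortho(2)[OF A sub]) auto
  finally show "(\<Sum>i\<in>F. (cmod (cinner v (unit_image A i)))\<^sup>2) \<le> (norm v)\<^sup>2" .
qed

lemma sum_le_half_squares:
  fixes a b :: "'i \<Rightarrow> real"
  assumes "(\<Sum>i\<in>I. (a i)\<^sup>2) \<le> 1" "(\<Sum>i\<in>I. (b i)\<^sup>2) \<le> 1"
  shows "(\<Sum>i\<in>I. a i * b i) \<le> 1"
proof -
  have "(\<Sum>i\<in>I. a i * b i) \<le> (\<Sum>i\<in>I. ((a i)\<^sup>2 + (b i)\<^sup>2) / 2)"
  proof (rule sum_mono)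
    fix i
    have "0 \<le> (a i - b i)\<^sup>2" by simp
    then show "a i * b i \<le> ((a i)\<^sup>2 + (b i)\<^sup>2) / 2" by (simp add: power2_diff)
  qed
  also have "\<dots> = (\<Sum>i\<in>I. (a i)\<^sup>2) / 2 + (\<Sum>i\<in>I. (b i)\<^sup>2) / 2"
    by (simp add: add_divide_distrib sum.distrib sum_divide_distrib)
  finally show ?thesis using assms by simp
qed

text \<open>Expanding \<open>x i\<close> in a singular basis of \<open>A\<close> bounds the modulus of the entry
\<open>cinner (A (x i)) (y i)\<close> by the sum over \<open>e\<close> of the singular values \<open>\<parallel>A e\<parallel>\<close> with the weights \<open>d i e\<close>. By Bessel's inequality the
weights have row sums and column sums at most one. Jensen's inequality in each row and summation over the rows give
the bound.\<close>

theorem schatten_pairing_bound: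
  fixes A :: "'a::{complex_inner,banach} \<Rightarrow>\<^sub>L 'a"
  assumes A: "A \<in> bounded_ops" and r: "r \<ge> 1" and C: "schatten_norm (ennreal r) A \<le> ennreal C" "C \<ge> 0"
    and x: "bessel_fam I x" and y: "bessel_fam I y"
  shows "(\<Sum>i\<in>I. cmod (cinner (A (x i)) (y i)) powr r) \<le> C powr r"
proof -
  have r0: "r > 0" using r by simp
  obtain E where E: "singular_basis A E"
    and EC: "\<And>F. finite F \<Longrightarrow> F \<subseteq> E \<Longrightarrow> (\<Sum>e\<in>F. norm (A e) powr r) \<le> C powr r"
    by (rule schatten_singular_basis[OF A r0 C]) blast
  have onb: "orthonormal_basis E" using E by (simp add: singular_basis_def)
  note oE = orthonormal_basisD[OF onb]
  let ?t = "\<lambda>e. norm (A e)"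
  define d where "d i e = cmod (cinner (x i) e) * cmod (cinner (y i) (unit_image A e))" for i e
  have d0: "d i e \<ge> 0" for i e by (simp add: d_def)
  have sq1: "(norm v)\<^sup>2 \<le> 1" if "norm v \<le> 1" for v :: 'a using that by (simp add: power_le_one)
  have dE: "sum (d i) F \<le> 1" if i: "i \<in> I" and F: "finite F" "F \<subseteq> E" for i F
    unfolding d_def
  proof (rule sum_le_half_squares)
    show "(\<Sum>e\<in>F. (cmod (cinner (x i) e))\<^sup>2) \<le> 1"
      using bessel[OF ortho_set_subset[OF oE F(2)] F(1), of "x i"] sq1[OF bessel_fam_norm[OF x i]] by linarith
    show "(\<Sum>e\<in>F. (cmod (cinner (y i) (unit_image A e)))\<^sup>2) \<le> 1"
      using bessel_famD[OF bessel_fam_unit_image[OF E F], of "y i"] sq1[OF bessel_fam_norm[OF y i]] by linarith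
  qed
  have dI: "(\<Sum>i\<in>I. d i e) \<le> 1" if e: "e \<in> E" for e
    unfolding d_def
  proof (rule sum_le_half_squares)
    have "(\<Sum>i\<in>I. (cmod (cinner (x i) e))\<^sup>2) = (\<Sum>i\<in>I. (cmod (cinner e (x i)))\<^sup>2)"
      by (metis cinner_commute complex_mod_cnj)
    then show "(\<Sum>i\<in>I. (cmod (cinner (x i) e))\<^sup>2) \<le> 1"
      using bessel_famD[OF x, of e] ortho_set_norm[OF oE e] by simp
    have "norm (unit_image A e) \<le> 1" by (simp add: unit_image_def)
    then have "(norm (unit_image A e))\<^sup>2 \<le> 1" by (rule sq1)
    moreover have "(\<Sum>i\<in>I. (cmod (cinner (y i) (unit_image A e)))\<^sup>2) = (\<Sum>i\<in>I. (cmod (cinner (unit_image A e) (y i)))\<^sup>2)"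
      by (metis cinner_commute complex_mod_cnj)
    ultimately show "(\<Sum>i\<in>I. (cmod (cinner (y i) (unit_image A e)))\<^sup>2) \<le> 1"
      using bessel_famD[OF y, of "unit_image A e"] by simp
  qed
  have t_le: "?t e \<le> norm A" if "e \<in> E" for e
    using norm_blinfun[of A e] ortho_set_norm[OF oE that] by simp
  have sd: "d i summable_on E" if "i \<in> I" for i
    by (rule summable_on_bounded_sums[where K = 1]) (use d0 dE[OF that] in auto)
  have bounded_summable: "(\<lambda>e. w e * d i e) summable_on E"
    if i: "i \<in> I" and w: "\<And>e. e \<in> E \<Longrightarrow> 0 \<le> w e" "\<And>e. e \<in> E \<Longrightarrow> w e \<le> M" for i w M
  proof (rule summable_on_comparison_test)
    show "(\<lambda>e. M * d i e) summable_on E" by (intro summable_on_cmult_right sd i)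
  qed (use w d0 in \<open>auto intro: mult_right_mono\<close>)
  let ?h = "\<lambda>i. infsum (\<lambda>e. ?t e powr r * d i e) E"
  have sh: "(\<lambda>e. ?t e powr r * d i e) summable_on E" if "i \<in> I" for i
    using t_le r0 by (intro bounded_summable[OF that, where M = "norm A powr r"]) (auto intro: powr_mono2)
  have st: "(\<lambda>e. ?t e * d i e) summable_on E" if "i \<in> I" for i
    using t_le by (intro bounded_summable[OF that, where M = "norm A"]) auto
  have jensen: "cmod (cinner (A (x i)) (y i)) powr r \<le> ?h i" if i: "i \<in> I" for i
  proof -
    define a where "a = cmod (cinner (A (x i)) (y i))"
    have a0: "a \<ge> 0" by (simp add: a_def)
    have "((\<lambda>e. cinner (cinner (x i) e *\<^sub>C A e) (y i)) has_sum cinner (A (x i)) (y i)) E"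
      by (rule has_sum_bounded_linear[OF cinner.bounded_linear_left op_expansion[OF A onb]])
    then have "a \<le> infsum (\<lambda>e. ?t e * d i e) E"
      unfolding a_def
    proof (rule has_sum_norm_le)
      fix F assume F: "finite F" "F \<subseteq> E"
      have "cmod (\<Sum>e\<in>F. cinner (cinner (x i) e *\<^sub>C A e) (y i)) \<le> (\<Sum>e\<in>F. ?t e * d i e)"
      proof (rule sum_norm_le)
        fix e
        have "cinner (A e) (y i) = ?t e *\<^sub>R cinner (unit_image A e) (y i)"
          by (metis cinner.scaleR_left unit_image_scale)
        then show "cmod (cinner (cinner (x i) e *\<^sub>C A e) (y i)) \<le> ?t e * d i e"
          by (simp add: cinner_scaleC_left norm_mult d_def cinner_commute[of "unit_image A e"])
      qed
      also have "\<dots> \<le> infsum (\<lambda>e. ?t e * d i e) E"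
        by (rule finite_sum_le_infsum[OF st[OF i] F]) (simp add: d0)
      finally show "cmod (\<Sum>e\<in>F. cinner (cinner (x i) e *\<^sub>C A e) (y i)) \<le> infsum (\<lambda>e. ?t e * d i e) E" .
    qed
    moreover have "infsum (d i) E \<le> 1"
      using dE[OF i] by (intro infsum_le_finite_sums sd i) auto
    ultimately have "r * a powr (r - 1) * a - (r - 1) * a powr r * 1
        \<le> r * a powr (r - 1) * infsum (\<lambda>e. ?t e * d i e) E - (r - 1) * a powr r * infsum (d i) E"
      using r by (intro diff_mono mult_left_mono) auto
    also have "\<dots> \<le> ?h i"
    proof (rule has_sum_mono)
      show "((\<lambda>e. r * a powr (r - 1) * (?t e * d i e) - (r - 1) * a powr r * d i e) has_sum
        (r * a powr (r - 1) * infsum (\<lambda>e. ?t e * d i e) E - (r - 1) * a powr r * infsum (d i) E)) E"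
        unfolding diff_conv_add_uminus
        by (intro has_sum_add has_sum_uminusI has_sum_cmult_right has_sum_infsum st sd i)
      show "((\<lambda>e. ?t e powr r * d i e) has_sum ?h i) E" by (rule has_sum_infsum[OF sh[OF i]])
      fix e
      have "(r * a powr (r - 1) * ?t e - (r - 1) * a powr r) * d i e \<le> ?t e powr r * d i e"
        using powr_tangent[of "?t e" a r] a0 r d0 by (intro mult_right_mono) auto
      then show "r * a powr (r - 1) * (?t e * d i e) - (r - 1) * a powr r * d i e \<le> ?t e powr r * d i e"
        by (simp add: algebra_simps)
    qed
    also have "r * a powr (r - 1) * a - (r - 1) * a powr r * 1 = a powr r"
      using a0 by (cases "a = 0") (auto simp: powr_diff left_diff_distrib)
    finally show ?thesis by (simp add: a_def)
  qed
  have "(\<Sum>i\<in>I. cmod (cinner (A (x i)) (y i)) powr r) \<le> (\<Sum>i\<in>I. ?h i)"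
    by (rule sum_mono[OF jensen])
  also have "\<dots> \<le> C powr r"
  proof (rule has_sum_le_finite_sums)
    show "((\<lambda>e. \<Sum>i\<in>I. ?t e powr r * d i e) has_sum (\<Sum>i\<in>I. ?h i)) E"
      by (intro has_sum_finite_sum has_sum_infsum sh)
    fix F assume F: "finite F" "F \<subseteq> E"
    have "(\<Sum>e\<in>F. \<Sum>i\<in>I. ?t e powr r * d i e) \<le> (\<Sum>e\<in>F. ?t e powr r)"
    proof (rule sum_mono)
      fix e assume "e \<in> F"
      then show "(\<Sum>i\<in>I. ?t e powr r * d i e) \<le> ?t e powr r"
        using dI[of e] F by (simp add: sum_distrib_left[symmetric] mult_left_le subset_eq)
    qed
    also have "\<dots> \<le> C powr r" by (rule EC[OF F])
    finally show "(\<Sum>e\<in>F. \<Sum>i\<in>I. ?t e powr r * d i e) \<le> C powr r" .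
  qed
  finally show ?thesis .
qed

text \<open>Hoelder's inequality for sums combined with the previous bound; it treats finite \<open>q\<close> and
\<open>q = \<infinity>\<close> uniformly, so that later proofs need no case distinction.\<close>

lemma schatten_weighted_pairing:
  fixes B :: "'a::{complex_inner,banach} \<Rightarrow>\<^sub>L 'a"
  assumes conj: "conj_exp r q" and B: "B \<in> bounded_ops" "schatten_norm q B \<le> ennreal D" "D \<ge> 0"
    and x: "bessel_fam I x" and y: "bessel_fam I y"
    and u: "\<And>i. i \<in> I \<Longrightarrow> 0 \<le> u i" "(\<Sum>i\<in>I. u i powr r) \<le> C powr r" and C: "C \<ge> 0"
  shows "(\<Sum>i\<in>I. u i * cmod (cinner (B (x i)) (y i))) \<le> C * D"
  using conj unfolding conj_exp_def
proof (elim disjE conjE)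
  assume r: "r = 1" "q = \<infinity>"
  then have nB: "norm B \<le> D" using B by (simp add: schatten_norm_def ennreal_le_iff)
  have "(\<Sum>i\<in>I. u i * cmod (cinner (B (x i)) (y i))) \<le> (\<Sum>i\<in>I. u i * D)"
  proof (intro sum_mono mult_left_mono u(1))
    fix i assume i: "i \<in> I"
    have "cmod (cinner (B (x i)) (y i)) \<le> norm (B (x i)) * norm (y i)" by (rule cmod_cinner_le)
    also have "\<dots> \<le> (norm B * norm (x i)) * norm (y i)" by (intro mult_right_mono norm_blinfun) auto
    also have "\<dots> \<le> (D * 1) * 1"
      using nB B(3) bessel_fam_norm[OF x i] bessel_fam_norm[OF y i] by (intro mult_mono) auto
    finally show "cmod (cinner (B (x i)) (y i)) \<le> D" by simp
  qed
  also have "\<dots> = (\<Sum>i\<in>I. u i powr r) * D" using u(1) by (simp add: r sum_distrib_right)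
  also have "\<dots> \<le> C powr r * D" using u(2) B(3) by (rule mult_right_mono)
  finally show ?thesis using C by (simp add: r)
next
  assume r: "r > 1" "q = ennreal (r / (r - 1))"
  show ?thesis
  proof (rule sum_powr_Holder[OF r(1) refl])
    show "(\<Sum>i\<in>I. cmod (cinner (B (x i)) (y i)) powr (r / (r - 1))) \<le> D powr (r / (r - 1))"
      using r B by (intro schatten_pairing_bound[OF B(1) _ _ _ x y]) (auto simp: field_simps)
    show "finite I" using x by (simp add: bessel_fam_def)
  qed (use u C B in auto)
qed

text \<open>In a singular basis \<open>E\<close> of \<open>A B\<close> the norms \<open>\<parallel>A B e\<parallel>\<close> are the numbers \<open>cinner (A B e) (h e)\<close>, where
\<open>h e\<close> is the normalised image of \<open>e\<close>. Expanding \<open>B e\<close> in a singular basis of \<open>A\<close> and exchanging the sums turns a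
finite sum of them into a sum of the singular values of \<open>A\<close> times matrix entries of \<open>B\<close> along the family \<open>x\<close>. That
family is the image of the left singular vectors of \<open>A\<close> under the contraction sending \<open>h e\<close> to \<open>e\<close>, so it is a
Bessel family.\<close>

theorem schatten_compose:
  fixes A B :: "'a::{complex_inner,banach} \<Rightarrow>\<^sub>L 'a"
  assumes conj: "conj_exp r q" and A: "A \<in> bounded_ops" "schatten_norm (ennreal r) A \<le> ennreal C" "C \<ge> 0"
    and B: "B \<in> bounded_ops" "schatten_norm q B \<le> ennreal D" "D \<ge> 0"
  shows "schatten_norm 1 (A o\<^sub>L B) \<le> ennreal (C * D)"
proof -
  have r0: "r > 0" using conj by (auto simp: conj_exp_def)
  have AB: "A o\<^sub>L B \<in> bounded_ops" by (intro bounded_ops_compose A B)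
  have "schatten_norm (ennreal r) A < \<infinity>" using A(2) by (simp add: le_less_trans)
  then have "compact_op (A o\<^sub>L B)"
    by (intro compact_op_compose_right schatten_finite_compact[OF A(1) r0] B)
  then obtain E where E: "singular_basis (A o\<^sub>L B) E" by (rule singular_basis_exists[OF AB])
  obtain G where G: "singular_basis A G"
    and GC: "\<And>F. finite F \<Longrightarrow> F \<subseteq> G \<Longrightarrow> (\<Sum>e\<in>F. norm (A e) powr r) \<le> C powr r"
    by (rule schatten_singular_basis[OF A(1) r0 A(2,3)]) blast
  have Gonb: "orthonormal_basis G" using G by (simp add: singular_basis_def)
  have oE: "ortho_set E" using E by (auto simp: singular_basis_def intro: orthonormal_basisD)
  let ?h = "unit_image (A o\<^sub>L B)"
  have "(\<Sum>e\<in>F. norm ((A o\<^sub>L B) e) powr 1) \<le> (C * D) powr 1" if F: "finite F" "F \<subseteq> E" for F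
  proof -
    define x where "x i = (\<Sum>e\<in>F. cinner (unit_image A i) (?h e) *\<^sub>C e)" for i
    have hs: "((\<lambda>i. \<Sum>e\<in>F. cinner (cinner (B e) i *\<^sub>C A i) (?h e)) has_sum (\<Sum>e\<in>F. cinner (A (B e)) (?h e))) G"
      by (intro has_sum_finite_sum has_sum_bounded_linear[OF cinner.bounded_linear_left]
          op_expansion[OF A(1) Gonb])
    have hterm: "(\<Sum>e\<in>F. cinner (cinner (B e) i *\<^sub>C A i) (?h e)) = norm (A i) *\<^sub>R cinner (B (x i)) i" for i
    proof -
      have "cinner (A i) (?h e) = norm (A i) *\<^sub>R cinner (unit_image A i) (?h e)" for e
        by (metis cinner.scaleR_left unit_image_scale)
      then show ?thesis
        by (simp add: x_def blinfun.sum_right bounded_opsD[OF B(1)] cinner.sum_left cinner_scaleC_left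
            scaleR_conv_of_real sum_distrib_left mult_ac)
    qed
    have "cmod (\<Sum>e\<in>F. cinner (A (B e)) (?h e)) \<le> C * D"
    proof (rule has_sum_norm_le[OF hs])
      fix I assume I: "finite I" "I \<subseteq> G"
      have yb: "bessel_fam I (\<lambda>i. i)"
        by (intro bessel_fam_ortho ortho_set_subset[OF orthonormal_basisD[OF Gonb]] I)
      have xb: "bessel_fam I x"
        unfolding bessel_fam_def
      proof (intro conjI allI I(1))
        fix v
        \<comment> \<open>The adjoint of the contraction \<open>h e \<mapsto> e\<close>, applied to \<open>v\<close>.\<close>
        define w where "w = (\<Sum>e\<in>F. cinner v e *\<^sub>C ?h e)"
        have "cinner v (x i) = cinner w (unit_image A i)" for i
          unfolding x_def w_def
          by (simp add: cinner.sum_left cinner.sum_right cinner_scaleC_left cinner_scaleC_right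
              cinner_commute[of "?h _"] mult.commute)
        then have "(\<Sum>i\<in>I. (cmod (cinner v (x i)))\<^sup>2) \<le> (norm w)\<^sup>2"
          using bessel_famD[OF bessel_fam_unit_image[OF G I], of w] by simp
        also have "\<dots> \<le> (\<Sum>e\<in>F. (cmod (cinner v e))\<^sup>2)"
          unfolding w_def by (rule bessel_fam_synthesis[OF bessel_fam_unit_image[OF E F]])
        also have "\<dots> \<le> (norm v)\<^sup>2" by (rule bessel[OF ortho_set_subset[OF oE F(2)] F(1)])
        finally show "(\<Sum>i\<in>I. (cmod (cinner v (x i)))\<^sup>2) \<le> (norm v)\<^sup>2" .
      qed
      have "cmod (\<Sum>i\<in>I. \<Sum>e\<in>F. cinner (cinner (B e) i *\<^sub>C A i) (?h e))
          \<le> (\<Sum>i\<in>I. norm (A i) * cmod (cinner (B (x i)) i))"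
        unfolding hterm by (rule order_trans[OF norm_sum]) simp
      also have "\<dots> \<le> C * D"
        using GC[OF I] by (intro schatten_weighted_pairing[OF conj B xb yb] A(3)) auto
      finally show "cmod (\<Sum>i\<in>I. \<Sum>e\<in>F. cinner (cinner (B e) i *\<^sub>C A i) (?h e)) \<le> C * D" .
    qed
    moreover have "cinner (A (B e)) (?h e) = complex_of_real (norm (A (B e)))" for e
      by (simp add: unit_image_def cinner.scaleR_right cinner_same scaleR_conv_of_real power2_eq_square)
    ultimately have "(\<Sum>e\<in>F. norm (A (B e))) \<le> C * D"
      by (simp flip: of_real_sum add: sum_nonneg)
    then show ?thesis using A(3) B(3) by simp
  qed
  then show ?thesis
    using schatten_norm_le_iff[OF AB zero_less_one E, of "C * D"] A(3) B(3) by simp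
qed

section \<open>The Schatten class as a vector space\<close>

lemma schatten_finite_obtains:
  assumes "schatten_norm p A < \<infinity>"
  obtains C where "C \<ge> 0" "schatten_norm p A = ennreal C"
  using assms by (cases "schatten_norm p A") auto

text \<open>In a singular basis of \<open>A + B\<close> the norm \<open>\<parallel>(A + B) e\<parallel>\<close> is a sum of a matrix entry of \<open>A\<close> and one of
\<open>B\<close>. The crude factor \<open>2\<^sup>r\<close> is harmless, since only membership is at stake.\<close>

lemma schatten_norm_add_finite:
  fixes A B :: "'a::{complex_inner,banach} \<Rightarrow>\<^sub>L 'a"
  assumes A: "A \<in> bounded_ops" and B: "B \<in> bounded_ops" and r: "r \<ge> 1"
    and fA: "schatten_norm (ennreal r) A < \<infinity>" and fB: "schatten_norm (ennreal r) B < \<infinity>"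
  shows "schatten_norm (ennreal r) (A + B) < \<infinity>"
proof -
  have r0: "r > 0" using r by simp
  obtain C where C: "C \<ge> 0" "schatten_norm (ennreal r) A = ennreal C" by (rule schatten_finite_obtains[OF fA])
  obtain D where D: "D \<ge> 0" "schatten_norm (ennreal r) B = ennreal D" by (rule schatten_finite_obtains[OF fB])
  have AB: "A + B \<in> bounded_ops" by (intro bounded_ops_add A B)
  obtain E where E: "singular_basis (A + B) E"
    by (rule singular_basis_exists[OF AB compact_op_add[OF schatten_finite_compact[OF A r0 fA] schatten_finite_compact[OF B r0 fB]]])
  have oE: "ortho_set E" using E by (auto simp: singular_basis_def intro: orthonormal_basisD)
  let ?h = "unit_image (A + B)"
  define K where "K = (2 powr r * (C powr r + D powr r)) powr (1 / r)"
  have K: "K \<ge> 0" "K powr r = 2 powr r * (C powr r + D powr r)"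
    using r0 by (auto simp: K_def powr_powr)
  have "(\<Sum>e\<in>F. norm ((A + B) e) powr r) \<le> K powr r" if F: "finite F" "F \<subseteq> E" for F
  proof -
    have be: "bessel_fam F (\<lambda>e. e)" by (intro bessel_fam_ortho ortho_set_subset[OF oE] F)
    have bh: "bessel_fam F ?h" by (rule bessel_fam_unit_image[OF E F])
    have "norm ((A + B) e) powr r \<le> 2 powr r * (cmod (cinner (A e) (?h e)) powr r + cmod (cinner (B e) (?h e)) powr r)" for e
    proof -
      let ?a = "cmod (cinner (A e) (?h e))" and ?b = "cmod (cinner (B e) (?h e))"
      have "cinner ((A + B) e) (?h e) = complex_of_real (norm ((A + B) e))"
        by (simp add: unit_image_def cinner.scaleR_right cinner_same scaleR_conv_of_real power2_eq_square)
      then have "norm ((A + B) e) = cmod (cinner (A e + B e) (?h e))"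
        by (simp add: blinfun.add_left)
      also have "\<dots> \<le> ?a + ?b" by (simp add: cinner_add_left norm_triangle_ineq)
      also have "\<dots> \<le> 2 * max ?a ?b" by simp
      finally have "norm ((A + B) e) powr r \<le> (2 * max ?a ?b) powr r" using r0 by (intro powr_mono2) auto
      also have "\<dots> = 2 powr r * max ?a ?b powr r" by (simp add: powr_mult)
      also have "\<dots> \<le> 2 powr r * (?a powr r + ?b powr r)"
        by (intro mult_left_mono) (auto simp: max_def)
      finally show ?thesis .
    qed
    then have "(\<Sum>e\<in>F. norm ((A + B) e) powr r)
        \<le> (\<Sum>e\<in>F. 2 powr r * (cmod (cinner (A e) (?h e)) powr r + cmod (cinner (B e) (?h e)) powr r))"
      by (intro sum_mono)
    also have "\<dots> = 2 powr r * ((\<Sum>e\<in>F. cmod (cinner (A e) (?h e)) powr r) + (\<Sum>e\<in>F. cmod (cinner (B e) (?h e)) powr r))"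
      by (simp add: sum_distrib_left sum.distrib distrib_left)
    also have "\<dots> \<le> 2 powr r * (C powr r + D powr r)"
      by (intro mult_left_mono add_mono schatten_pairing_bound[OF A r _ C(1) be bh]
          schatten_pairing_bound[OF B r _ D(1) be bh]) (simp_all add: C D)
    finally show ?thesis by (simp add: K)
  qed
  then have "schatten_norm (ennreal r) (A + B) \<le> ennreal K"
    unfolding schatten_norm_le_iff[OF AB r0 E K(1)] by blast
  then show ?thesis by (simp add: le_less_trans)
qed

lemma schatten_norm_scaleC_le:
  fixes A :: "'a::{complex_inner,banach} \<Rightarrow>\<^sub>L 'a"
  assumes A: "A \<in> bounded_ops" and r: "r > 0" and C: "schatten_norm (ennreal r) A \<le> ennreal C" "C \<ge> 0"
  shows "schatten_norm (ennreal r) (c *\<^sub>C A) \<le> ennreal (cmod c * C)"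
proof -
  obtain E where E: "singular_basis A E"
    and EC: "\<And>F. finite F \<Longrightarrow> F \<subseteq> E \<Longrightarrow> (\<Sum>e\<in>F. norm (A e) powr r) \<le> C powr r"
    by (rule schatten_singular_basis[OF A r C]) blast
  have E': "singular_basis (c *\<^sub>C A) E"
    using E by (auto simp: singular_basis_def scaleC_blinfun.rep_eq cinner_scaleC_left cinner_scaleC_right)
  have "(\<Sum>e\<in>F. norm ((c *\<^sub>C A) e) powr r) \<le> (cmod c * C) powr r" if F: "finite F" "F \<subseteq> E" for F
  proof -
    have "(\<Sum>e\<in>F. norm ((c *\<^sub>C A) e) powr r) = cmod c powr r * (\<Sum>e\<in>F. norm (A e) powr r)"
      by (simp add: scaleC_blinfun.rep_eq norm_scaleC powr_mult sum_distrib_left)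
    also have "\<dots> \<le> cmod c powr r * C powr r" by (intro mult_left_mono EC F) auto
    finally show ?thesis using C by (simp add: powr_mult)
  qed
  then show ?thesis
    using schatten_norm_le_iff[OF bounded_ops_scaleC[OF A] r E', of "cmod c * C"] C by simp
qed

section \<open>Rank one operators and the trace\<close>

definition rank_one :: "'a::complex_inner \<Rightarrow> 'a \<Rightarrow> ('a \<Rightarrow>\<^sub>L 'a)" where
  "rank_one x y = Blinfun (\<lambda>z. cinner z y *\<^sub>C x)"

lemma rank_one_apply [simp]: "rank_one x y z = cinner z y *\<^sub>C x"
  unfolding rank_one_def
  by (subst bounded_linear_Blinfun_apply)
    (auto intro: bounded_linear_compose[OF bounded_linear_scaleC_left cinner.bounded_linear_left])

lemma rank_one_bounded_ops: "rank_one x y \<in> bounded_ops"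
  by (simp add: bounded_ops_def cinner_scaleC_left scaleC_scaleC)

lemma bounded_ops_sum: "(\<And>i. i \<in> I \<Longrightarrow> f i \<in> bounded_ops) \<Longrightarrow> sum f I \<in> bounded_ops"
  by (induction I rule: infinite_finite_induct) (auto intro: bounded_ops_add)

text \<open>Any orthonormal basis that contains \<open>Y\<close> is a singular basis of this operator, with singular values
\<open>|a y|\<close> and zeros.\<close>

lemma schatten_norm_finite_rank:
  fixes Y :: "'a::{complex_inner,banach} set"
  assumes Y: "finite Y" "ortho_set Y" and g: "inj_on g Y" "ortho_set (g ` Y)" and r: "r > 0"
    and C: "(\<Sum>y\<in>Y. cmod (a y) powr r) \<le> C powr r" "C \<ge> 0"
  shows "schatten_norm (ennreal r) (\<Sum>y\<in>Y. a y *\<^sub>C rank_one (g y) y) \<le> ennreal C"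
proof -
  let ?A = "\<Sum>y\<in>Y. a y *\<^sub>C rank_one (g y) y"
  have A: "?A \<in> bounded_ops" by (intro bounded_ops_sum bounded_ops_scaleC rank_one_bounded_ops)
  obtain E where E: "Y \<subseteq> E" "orthonormal_basis E" by (rule ortho_set_extend[OF Y(2)])
  note oE = orthonormal_basisD[OF E(2)]
  have ap: "?A e = (if e \<in> Y then a e *\<^sub>C g e else 0)" if e: "e \<in> E" for e
  proof -
    have "?A e = (\<Sum>y\<in>Y. if y = e then a e *\<^sub>C g e else 0)"
      unfolding blinfun.sum_left
    proof (rule sum.cong[OF refl])
      fix y assume "y \<in> Y"
      then have "cinner e y = (if e = y then 1 else 0)" using e E(1) by (intro ortho_set_cinner[OF oE]) auto
      then show "(a y *\<^sub>C rank_one (g y) y) e = (if y = e then a e *\<^sub>C g e else 0)"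
        by (simp add: scaleC_blinfun.rep_eq)
    qed
    then show ?thesis using Y(1) by simp
  qed
  have gg: "cinner (g y) (g z) = (if y = z then 1 else 0)" if "y \<in> Y" "z \<in> Y" for y z
    using ortho_set_cinner[OF g(2), of "g y" "g z"] that g(1) by (simp add: inj_on_eq_iff)
  have sb: "singular_basis ?A E"
    unfolding singular_basis_def
    using E(2) by (auto simp: ap cinner_scaleC_left cinner_scaleC_right gg)
  show ?thesis
    unfolding schatten_norm_le_iff[OF A r sb C(2)]
  proof (intro allI impI)
    fix F assume F: "finite F" "F \<subseteq> E"
    have "(\<Sum>e\<in>F. norm (?A e) powr r) = (\<Sum>e\<in>F. if e \<in> Y then cmod (a e) powr r else 0)"
    proof (rule sum.cong[OF refl])
      fix e assume "e \<in> F"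
      then have "e \<in> E" using F by auto
      moreover have "norm (g e) = 1" if "e \<in> Y" using ortho_set_norm[OF g(2)] that by blast
      ultimately show "norm (?A e) powr r = (if e \<in> Y then cmod (a e) powr r else 0)"
        by (simp add: ap norm_scaleC del: blinfun.sum_left)
    qed
    also have "\<dots> = (\<Sum>e\<in>F \<inter> Y. cmod (a e) powr r)"
      using F(1) by (simp add: sum.inter_restrict)
    also have "\<dots> \<le> (\<Sum>e\<in>Y. cmod (a e) powr r)" using Y(1) by (intro sum_mono2) auto
    finally show "(\<Sum>e\<in>F. norm (?A e) powr r) \<le> C powr r" using C(1) by linarith
  qed
qed

lemma ortho_set_unit: "x \<noteq> 0 \<Longrightarrow> ortho_set {(1 / norm x) *\<^sub>R x}" for x :: "'a::complex_inner"
  by (simp add: ortho_set_def cinner.scaleR_left cinner.scaleR_right cinner_same scaleR_conv_of_real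
      power2_eq_square)

lemma schatten_norm_zero:
  fixes r :: real
  assumes "r > 0"
  shows "schatten_norm (ennreal r) (0 :: 'a::{complex_inner,banach} \<Rightarrow>\<^sub>L 'a) = 0"
  using schatten_norm_finite_rank[of "{} :: 'a set" id r "\<lambda>_. 0" 0] assms
  by (simp add: ortho_set_def)

lemma schatten_norm_rank_one:
  fixes x y :: "'a::{complex_inner,banach}"
  assumes r: "r > 0"
  shows "schatten_norm (ennreal r) (rank_one x y) \<le> ennreal (norm x * norm y)"
proof (cases "x = 0 \<or> y = 0")
  case True
  then have "rank_one x y = 0" by (intro blinfun_eqI) auto
  then show ?thesis using schatten_norm_zero[OF r, where 'a = 'a] by simp
next
  case False
  let ?u = "(1 / norm x) *\<^sub>R x" and ?v = "(1 / norm y) *\<^sub>R y"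
  have "schatten_norm (ennreal r) (\<Sum>z\<in>{?v}. complex_of_real (norm x * norm y) *\<^sub>C rank_one ?u z)
      \<le> ennreal (norm x * norm y)"
    using False r by (intro schatten_norm_finite_rank) (auto intro: ortho_set_unit simp: norm_mult)
  moreover have "(\<Sum>z\<in>{?v}. complex_of_real (norm x * norm y) *\<^sub>C rank_one ?u z) = rank_one x y"
  proof (rule blinfun_eqI)
    fix z
    show "(\<Sum>z\<in>{?v}. complex_of_real (norm x * norm y) *\<^sub>C rank_one ?u z) z = rank_one x y z"
      using False by (simp add: scaleC_blinfun.rep_eq cinner_scaleC_right scaleC_scaleC scaleC_of_real[symmetric])
  qed
  ultimately show ?thesis by simp
qed

lemma trace_summable:
  fixes T :: "'a::{complex_inner,banach} \<Rightarrow>\<^sub>L 'a"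
  assumes T: "T \<in> bounded_ops" "schatten_norm 1 T \<le> ennreal C" "C \<ge> 0" and E: "orthonormal_basis E"
  shows "(\<lambda>e. cinner (T e) e) summable_on E"
    and "cmod (\<Sum>\<^sub>\<infinity>e\<in>E. cinner (T e) e) \<le> C"
proof -
  note oE = orthonormal_basisD[OF E]
  have bound: "(\<Sum>e\<in>F. cmod (cinner (T e) e)) \<le> C" if F: "finite F" "F \<subseteq> E" for F
  proof -
    have be: "bessel_fam F (\<lambda>e. e)" by (intro bessel_fam_ortho ortho_set_subset[OF oE] F)
    from schatten_pairing_bound[OF T(1) order_refl _ T(3) be be] T(2,3) show ?thesis by simp
  qed
  then have "(\<lambda>e. cmod (cinner (T e) e)) summable_on E"
    by (intro summable_on_bounded_sums) auto
  then show s: "(\<lambda>e. cinner (T e) e) summable_on E" by (rule abs_summable_summable)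
  show "cmod (\<Sum>\<^sub>\<infinity>e\<in>E. cinner (T e) e) \<le> C"
    by (rule has_sum_norm_le[OF has_sum_infsum[OF s]]) (rule order_trans[OF norm_sum bound])
qed

lemma op_trace_bound:
  fixes T :: "'a::{complex_inner,banach} \<Rightarrow>\<^sub>L 'a"
  assumes "T \<in> bounded_ops" "schatten_norm 1 T \<le> ennreal C" "C \<ge> 0"
  shows "cmod (op_trace T) \<le> C"
  unfolding op_trace_def by (rule trace_summable(2)[OF assms some_orthonormal_basis])

lemma op_trace_add:
  fixes S T :: "'a::{complex_inner,banach} \<Rightarrow>\<^sub>L 'a"
  assumes S: "S \<in> bounded_ops" "schatten_norm 1 S < \<infinity>" and T: "T \<in> bounded_ops" "schatten_norm 1 T < \<infinity>"
  shows "op_trace (S + T) = op_trace S + op_trace T"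
proof -
  let ?E = "SOME E :: 'a set. orthonormal_basis E"
  have *: "(\<lambda>e. cinner (U e) e) summable_on ?E" if U: "U \<in> bounded_ops" "schatten_norm 1 U < \<infinity>" for U
  proof -
    obtain C where "C \<ge> 0" "schatten_norm 1 U = ennreal C" by (rule schatten_finite_obtains[OF U(2)])
    then show ?thesis by (intro trace_summable(1)[OF U(1) _ _ some_orthonormal_basis]) auto
  qed
  have "op_trace (S + T) = (\<Sum>\<^sub>\<infinity>e\<in>?E. cinner (S e) e + cinner (T e) e)"
    by (simp add: op_trace_def blinfun.add_left cinner_add_left)
  also have "\<dots> = op_trace S + op_trace T"
    unfolding op_trace_def by (intro infsum_add * S T)
  finally show ?thesis .
qed

lemma op_trace_scaleC: "op_trace (c *\<^sub>C T) = c * op_trace T"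
  by (simp add: op_trace_def scaleC_blinfun.rep_eq cinner_scaleC_left infsum_cmult_right')

lemma op_trace_rank_one:
  fixes B :: "'a::{complex_inner,banach} \<Rightarrow>\<^sub>L 'a"
  assumes B: "B \<in> bounded_ops" and I: "finite I"
  shows "op_trace ((\<Sum>i\<in>I. a i *\<^sub>C rank_one (x i) (y i)) o\<^sub>L B) = (\<Sum>i\<in>I. a i * cinner (B (x i)) (y i))"
proof -
  let ?E = "SOME E :: 'a set. orthonormal_basis E"
  have "((\<lambda>e. \<Sum>i\<in>I. a i * (cinner (x i) e * cinner e (op_adjoint B (y i)))) has_sum
      (\<Sum>i\<in>I. a i * cinner (x i) (op_adjoint B (y i)))) ?E"
    by (intro has_sum_finite_sum has_sum_cmult_right parseval some_orthonormal_basis)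
  moreover have "cinner (((\<Sum>i\<in>I. a i *\<^sub>C rank_one (x i) (y i)) o\<^sub>L B) e) e
      = (\<Sum>i\<in>I. a i * (cinner (x i) e * cinner e (op_adjoint B (y i))))" for e
    by (simp add: blinfun.sum_left scaleC_blinfun.rep_eq cinner.sum_left cinner_scaleC_left
        cinner_op_adjoint[OF B] mult_ac)
  ultimately show ?thesis
    unfolding op_trace_def by (simp add: infsumI cinner_op_adjoint[OF B])
qed

section \<open>Schatten duality\<close>

lemma schatten_compose_finite:
  fixes A B :: "'a::{complex_inner,banach} \<Rightarrow>\<^sub>L 'a"
  assumes conj: "conj_exp r q" and A: "A \<in> bounded_ops" "schatten_norm (ennreal r) A < \<infinity>"
    and B: "B \<in> bounded_ops" "schatten_norm q B < \<infinity>"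
  shows "schatten_norm 1 (A o\<^sub>L B) < \<infinity>"
proof -
  obtain C where C: "C \<ge> 0" "schatten_norm (ennreal r) A = ennreal C" by (rule schatten_finite_obtains[OF A(2)])
  obtain D where D: "D \<ge> 0" "schatten_norm q B = ennreal D" by (rule schatten_finite_obtains[OF B(2)])
  have "schatten_norm 1 (A o\<^sub>L B) \<le> ennreal (C * D)"
    using C D by (intro schatten_compose[OF conj A(1) _ _ B(1)]) auto
  then show ?thesis by (simp add: le_less_trans)
qed

lemma schatten_trace_bound:
  fixes A B :: "'a::{complex_inner,banach} \<Rightarrow>\<^sub>L 'a"
  assumes conj: "conj_exp r q" and A: "A \<in> bounded_ops" "schatten_norm (ennreal r) A \<le> ennreal C" "C \<ge> 0"
    and B: "B \<in> bounded_ops" "schatten_norm q B \<le> ennreal D" "D \<ge> 0"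
  shows "cmod (op_trace (A o\<^sub>L B)) \<le> C * D"
  using A B by (intro op_trace_bound bounded_ops_compose schatten_compose[OF conj]) auto

text \<open>Let \<open>1 < r\<close> and let \<open>s\<close> be the conjugate exponent. Choosing \<open>a\<close> extremal in the test inequality shows that
the entries \<open>cinner (B (g y)) y\<close> along orthonormal systems have \<open>s\<close>-norm at most \<open>C\<close>. Therefore an orthonormal
system on which all these entries are at least \<open>\<epsilon>\<close> in modulus has bounded size; a largest one cannot be
enlarged, which says that \<open>B\<close> is smaller than \<open>\<epsilon>\<close> on the vectors \<open>x\<close> orthogonal to the \<open>g y\<close> and to the
\<open>B\<^sup>* y\<close>. So \<open>B\<close> is compact, and the bound on the entries along its singular basis is the claim.
For \<open>r = 1\<close> systems of a single pair already bound the operator norm.\<close>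

theorem schatten_norm_le_of_pairing:
  fixes B :: "'a::{complex_inner,banach} \<Rightarrow>\<^sub>L 'a"
  assumes conj: "conj_exp r q" and B: "B \<in> bounded_ops" and C: "C \<ge> 0"
    and test: "\<And>Y g a K. finite Y \<Longrightarrow> ortho_set Y \<Longrightarrow> inj_on g Y \<Longrightarrow> ortho_set (g ` Y) \<Longrightarrow> K \<ge> 0 \<Longrightarrow>
      (\<Sum>y\<in>Y. cmod (a y) powr r) \<le> K powr r \<Longrightarrow>
      cmod (\<Sum>y\<in>Y. a y * cinner (B (g y)) y) \<le> C * K"
  shows "schatten_norm q B \<le> ennreal C"
  using conj unfolding conj_exp_def
proof (elim disjE conjE)
  assume r: "r = 1" "q = \<infinity>"
  have "cmod (cinner (B x) y) \<le> C * norm x * norm y" for x y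
  proof (cases "x = 0 \<or> y = 0")
    case True
    then show ?thesis by (auto simp: blinfun.zero_right)
  next
    case False
    let ?u = "(1 / norm x) *\<^sub>R x" and ?v = "(1 / norm y) *\<^sub>R y"
    have "cmod (\<Sum>y\<in>{?v}. 1 * cinner (B ?u) y) \<le> C * 1"
      using False by (intro test) (auto intro: ortho_set_unit)
    then have "cmod (cinner (B x) y) / (norm x * norm y) \<le> C"
      using False by (simp add: blinfun.scaleR_right cinner.scaleR_left cinner.scaleR_right norm_mult norm_divide mult_ac)
    then show ?thesis using False by (simp add: divide_le_eq mult_ac)
  qed
  then have "norm B \<le> C" by (rule norm_le_of_form[OF _ C])
  then show ?thesis by (simp add: r schatten_norm_def ennreal_leI)
next
  assume r: "r > 1" "q = ennreal (r / (r - 1))"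
  define s where "s = r / (r - 1)"
  have s: "s > 1" "(s - 1) * r = s" "1 - 1 / r = 1 / s" using r(1) by (auto simp: s_def field_simps)
  have key: "(\<Sum>y\<in>Y. cmod (cinner (B (g y)) y) powr s) \<le> C powr s"
    if Y: "finite Y" "ortho_set Y" "inj_on g Y" "ortho_set (g ` Y)" for Y g
  proof -
    define b where "b y = cinner (B (g y)) y" for y
    \<comment> \<open>The case of equality in Hoelder's inequality.\<close>
    define a where "a y = cnj (sgn (b y)) * complex_of_real (cmod (b y) powr (s - 1))" for y
    define S where "S = (\<Sum>y\<in>Y. cmod (b y) powr s)"
    have S0: "S \<ge> 0" by (simp add: S_def sum_nonneg)
    have ab: "a y * b y = complex_of_real (cmod (b y) powr s)" for y
    proof (cases "b y = 0")
      case False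
      have "cnj (sgn (b y)) * b y = complex_of_real (cmod (b y))"
        using False by (simp add: sgn_eq complex_norm_square[symmetric] mult.commute power2_eq_square)
      then have "a y * b y = complex_of_real (cmod (b y) * cmod (b y) powr (s - 1))"
        by (simp add: a_def mult_ac)
      also have "cmod (b y) * cmod (b y) powr (s - 1) = cmod (b y) powr s"
        using False by (simp add: powr_diff)
      finally show ?thesis .
    qed (use s in \<open>simp add: a_def\<close>)
    have "cmod (a y) powr r = cmod (b y) powr s" for y
    proof (cases "b y = 0")
      case False
      then have "cmod (a y) = cmod (b y) powr (s - 1)" by (simp add: a_def norm_mult norm_sgn)
      then show ?thesis by (simp add: powr_powr s(2))
    qed (use s r in \<open>simp add: a_def\<close>)
    then have "(\<Sum>y\<in>Y. cmod (a y) powr r) \<le> (S powr (1 / r)) powr r"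
      using S0 r by (simp add: powr_powr S_def)
    then have "cmod (\<Sum>y\<in>Y. a y * cinner (B (g y)) y) \<le> C * S powr (1 / r)"
      by (intro test Y) auto
    moreover have "(\<Sum>y\<in>Y. a y * cinner (B (g y)) y) = complex_of_real S"
      by (simp add: b_def[symmetric] ab S_def)
    ultimately have le: "S \<le> C * S powr (1 / r)" using S0 by simp
    have "S \<le> C powr s" by (rule powr_self_bound[OF r(1) s_def S0 le])
    then show ?thesis by (simp add: S_def b_def)
  qed
  have "compact_op B"
    unfolding compact_op_def
  proof (intro allI impI)
    fix \<epsilon> :: real assume \<epsilon>: "\<epsilon> > 0"
    \<comment> \<open>A good pair is a system of matrix entries of \<open>B\<close>, from the \<open>g y\<close> to the \<open>y\<close>, all of modulus at least \<open>\<epsilon>\<close>.\<close>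
    define good where "good Y g \<longleftrightarrow> finite Y \<and> ortho_set Y \<and> inj_on g Y \<and> ortho_set (g ` Y) \<and>
      (\<forall>y\<in>Y. cmod (cinner (B (g y)) y) \<ge> \<epsilon>)" for Y :: "'a set" and g
    have card_le: "real (card Y) \<le> C powr s / \<epsilon> powr s" if "good Y g" for Y g
    proof -
      have "real (card Y) * \<epsilon> powr s = (\<Sum>y\<in>Y. \<epsilon> powr s)" by simp
      also have "\<dots> \<le> (\<Sum>y\<in>Y. cmod (cinner (B (g y)) y) powr s)"
        using that \<epsilon> s by (intro sum_mono powr_mono2) (auto simp: good_def)
      also have "\<dots> \<le> C powr s" using that by (intro key) (auto simp: good_def)
      finally show ?thesis using \<epsilon> by (simp add: le_divide_eq)
    qed
    define P where "P n \<longleftrightarrow> (\<exists>Y g. good Y g \<and> card Y = n)" for n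
    have "P 0" unfolding P_def by (rule exI[of _ "{}"]) (simp add: good_def ortho_set_def)
    moreover have "\<forall>n. P n \<longrightarrow> n \<le> nat \<lfloor>C powr s / \<epsilon> powr s\<rfloor>"
      using card_le by (auto simp: P_def le_nat_floor)
    ultimately obtain n where n: "P n" "\<And>m. P m \<Longrightarrow> m \<le> n"
      using Nat.ex_has_greatest_nat[of P 0 "nat \<lfloor>C powr s / \<epsilon> powr s\<rfloor>"] by blast
    then obtain Y g where Yg: "good Y g" "card Y = n" unfolding P_def by blast
    then have Y: "finite Y" "ortho_set Y" "inj_on g Y" "ortho_set (g ` Y)" by (auto simp: good_def)
    let ?F = "g ` Y \<union> blinfun_apply (op_adjoint B) ` Y"
    show "\<exists>F. finite F \<and> (\<forall>x. (\<forall>e\<in>F. cinner x e = 0) \<longrightarrow> norm (B x) \<le> \<epsilon> * norm x)"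
    proof (intro exI[of _ ?F] conjI allI impI)
      fix x assume x: "\<forall>e\<in>?F. cinner x e = 0"
      show "norm (B x) \<le> \<epsilon> * norm x"
      proof (rule ccontr)
        assume "\<not> norm (B x) \<le> \<epsilon> * norm x"
        then have big: "norm (B x) > \<epsilon> * norm x" by simp
        then have Bx: "B x \<noteq> 0" using \<epsilon> by (auto simp: mult_less_0_iff)
        then have x0: "x \<noteq> 0" by (auto simp: blinfun.zero_right)
        define u where "u = (1 / norm x) *\<^sub>R x"
        define v where "v = (1 / norm (B x)) *\<^sub>R B x"
        have u1: "norm u = 1" and v1: "norm v = 1" using x0 Bx by (auto simp: u_def v_def)
        have uY: "cinner u (g y) = 0" and vY: "cinner v y = 0" if "y \<in> Y" for y
          using x that by (auto simp: u_def v_def cinner.scaleR_left cinner_op_adjoint[OF B])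
        have uv: "cinner (B u) v = complex_of_real (norm (B x) / norm x)"
          using x0 Bx by (simp add: u_def v_def blinfun.scaleR_right cinner.scaleR_left cinner.scaleR_right
              cinner_same scaleR_conv_of_real power2_eq_square)
        have vnot: "v \<notin> Y" using vY v1 cinner_same[of v] by auto
        have unot: "u \<notin> g ` Y" using uY u1 cinner_same[of u] by auto
        \<comment> \<open>Adding \<open>u\<close> and the direction \<open>v\<close> of its image enlarges the largest good system.\<close>
        let ?g = "g(v := u)"
        have img: "?g ` insert v Y = insert u (g ` Y)" using vnot by auto
        have "good (insert v Y) ?g"
          unfolding good_def img
        proof (intro conjI)
          show "ortho_set (insert v Y)" by (rule ortho_set_insert[OF Y(2) v1 vY])
          show "ortho_set (insert u (g ` Y))" using uY by (intro ortho_set_insert[OF Y(4) u1]) auto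
          show "inj_on ?g (insert v Y)"
            using Y(3) vnot unot by (auto simp: inj_on_def)
          have "norm (B x) / norm x \<ge> \<epsilon>" using big x0 by (simp add: le_divide_eq)
          then show "\<forall>y\<in>insert v Y. \<epsilon> \<le> cmod (cinner (B (?g y)) y)"
            using Yg(1) vnot uv by (auto simp: good_def norm_divide)
        qed (use Y(1) in simp)
        then have "P (Suc n)" using Yg(2) Y(1) vnot unfolding P_def by (metis card_insert_disjoint)
        then show False using n(2) by fastforce
      qed
    qed (use Y(1) in simp)
  qed
  then obtain E where E: "singular_basis B E" by (rule singular_basis_exists[OF B])
  have s0: "s > 0" using s by simp
  have oE: "ortho_set E" using E by (auto simp: singular_basis_def intro: orthonormal_basisD)
  have "(\<Sum>e\<in>F. norm (B e) powr s) \<le> C powr s" if F: "finite F" "F \<subseteq> E" for F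
  proof -
    let ?F = "{e \<in> F. B e \<noteq> 0}"
    have sub: "?F \<subseteq> {e \<in> E. B e \<noteq> 0}" using F by auto
    note io = singular_unit_image_ortho[OF E sub]
    \<comment> \<open>Test systems are indexed by the left vectors, so right singular vectors are recovered from left ones.\<close>
    define g where "g = inv_into ?F (unit_image B)"
    have g: "g (unit_image B e) = e" if "e \<in> ?F" for e
      unfolding g_def using io(1) that by (rule inv_into_f_f)
    have gim: "g ` (unit_image B ` ?F) = ?F" using g by force
    have "(\<Sum>e\<in>F. norm (B e) powr s) = (\<Sum>e\<in>?F. norm (B e) powr s)"
      using F(1) s0 by (intro sum.mono_neutral_right) auto
    also have "\<dots> = (\<Sum>e\<in>?F. cmod (cinner (B (g (unit_image B e))) (unit_image B e)) powr s)"
    proof (rule sum.cong[OF refl])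
      fix e assume e: "e \<in> ?F"
      have "cinner (B e) (unit_image B e) = complex_of_real (norm (B e))"
        by (simp add: unit_image_def cinner.scaleR_right cinner_same scaleR_conv_of_real power2_eq_square)
      then show "norm (B e) powr s = cmod (cinner (B (g (unit_image B e))) (unit_image B e)) powr s"
        by (simp add: g[OF e])
    qed
    also have "\<dots> = (\<Sum>y\<in>unit_image B ` ?F. cmod (cinner (B (g y)) y) powr s)"
      by (simp add: sum.reindex[OF io(1)])
    also have "\<dots> \<le> C powr s"
    proof (rule key)
      show "inj_on g (unit_image B ` ?F)" by (rule inj_onI) (use g in auto)
      show "ortho_set (g ` (unit_image B ` ?F))"
        unfolding gim using F by (intro ortho_set_subset[OF oE]) auto
    qed (use F io in auto)
    finally show ?thesis .
  qed
  then have "schatten_norm (ennreal s) B \<le> ennreal C"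
    unfolding schatten_norm_le_iff[OF B s0 E C] by blast
  then show ?thesis by (simp add: r s_def)
qed

text \<open>Cutting off a singular basis leaves an operator with the same singular basis whose singular values
are a tail of those of \<open>A\<close>. The factor \<open>1\<close> keeps the sum in the form in which finite rank operators occur
elsewhere.\<close>

lemma schatten_finite_rank_approx:
  fixes A :: "'a::{complex_inner,banach} \<Rightarrow>\<^sub>L 'a"
  assumes A: "A \<in> bounded_ops" "schatten_norm (ennreal r) A < \<infinity>" and r: "r > 0" and \<epsilon>: "\<epsilon> > 0"
  obtains F where "finite F" "schatten_norm (ennreal r) (A - (\<Sum>e\<in>F. 1 *\<^sub>C rank_one (A e) e)) \<le> ennreal \<epsilon>"
proof -
  obtain C where C: "C \<ge> 0" "schatten_norm (ennreal r) A = ennreal C" by (rule schatten_finite_obtains[OF A(2)])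
  obtain E where E: "singular_basis A E"
    and EC: "\<And>F. finite F \<Longrightarrow> F \<subseteq> E \<Longrightarrow> (\<Sum>e\<in>F. norm (A e) powr r) \<le> C powr r"
    by (rule schatten_singular_basis[OF A(1) r eq_refl[OF C(2)] C(1)]) blast
  have oE: "ortho_set E" using E by (auto simp: singular_basis_def intro: orthonormal_basisD)
  have "(\<lambda>e. norm (A e) powr r) summable_on E"
    by (rule summable_on_bounded_sums[where K = "C powr r"]) (use EC in auto)
  then obtain F where F: "finite F" "F \<subseteq> E"
    "\<And>G. finite G \<Longrightarrow> G \<subseteq> E - F \<Longrightarrow> (\<Sum>e\<in>G. norm (A e) powr r) \<le> \<epsilon> powr r"
    by (rule summable_on_small_tail[where \<epsilon> = "\<epsilon> powr r"]) (use \<epsilon> in auto)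
  define S where "S = (\<Sum>e\<in>F. 1 *\<^sub>C rank_one (A e) e)"
  have Sb: "S \<in> bounded_ops" unfolding S_def by (intro bounded_ops_sum bounded_ops_scaleC rank_one_bounded_ops)
  have ap: "(A - S) e = (if e \<in> F then 0 else A e)" if e: "e \<in> E" for e
  proof -
    have "S e = (\<Sum>y\<in>F. if y = e then A e else 0)"
      unfolding S_def blinfun.sum_left
    proof (rule sum.cong[OF refl])
      fix y assume "y \<in> F"
      then have "cinner e y = (if e = y then 1 else 0)" using e F(2) by (intro ortho_set_cinner[OF oE]) auto
      then show "(1 *\<^sub>C rank_one (A y) y) e = (if y = e then A e else 0)" by simp
    qed
    then show ?thesis using F(1) by (simp add: blinfun.diff_left)
  qed
  have sb: "singular_basis (A - S) E"
    using E unfolding singular_basis_def by (auto simp: ap)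
  have "schatten_norm (ennreal r) (A - S) \<le> ennreal \<epsilon>"
    unfolding schatten_norm_le_iff[OF bounded_ops_diff[OF A(1) Sb] r sb less_imp_le[OF \<epsilon>]]
  proof (intro allI impI)
    fix G assume G: "finite G" "G \<subseteq> E"
    have "(\<Sum>e\<in>G. norm ((A - S) e) powr r) = (\<Sum>e\<in>G. if e \<in> F then 0 else norm (A e) powr r)"
    proof (rule sum.cong[OF refl])
      fix e assume "e \<in> G"
      then have "e \<in> E" using G by auto
      from ap[OF this] show "norm ((A - S) e) powr r = (if e \<in> F then 0 else norm (A e) powr r)"
        using r by simp
    qed
    also have "\<dots> = (\<Sum>e\<in>G - F. norm (A e) powr r)"
      using G(1) by (intro sum.mono_neutral_cong_right) auto
    also have "\<dots> \<le> \<epsilon> powr r" using G by (intro F(3)) auto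
    finally show "(\<Sum>e\<in>G. norm ((A - S) e) powr r) \<le> \<epsilon> powr r" .
  qed
  with F(1) that show thesis unfolding S_def by blast
qed

lemma schatten_finite_rank_finite:
  fixes x y :: "'i \<Rightarrow> 'a::{complex_inner,banach}"
  assumes "r \<ge> 1" "finite I"
  shows "schatten_norm (ennreal r) (\<Sum>i\<in>I. a i *\<^sub>C rank_one (x i) (y i)) < \<infinity>"
  using assms(2)
proof induction
  case (insert i I)
  have "schatten_norm (ennreal r) (a i *\<^sub>C rank_one (x i) (y i)) \<le> ennreal (cmod (a i) * (norm (x i) * norm (y i)))"
    using assms(1) by (intro schatten_norm_scaleC_le rank_one_bounded_ops schatten_norm_rank_one) auto
  then have "schatten_norm (ennreal r) (a i *\<^sub>C rank_one (x i) (y i)) < \<infinity>" by (simp add: le_less_trans)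
  then have "schatten_norm (ennreal r) (a i *\<^sub>C rank_one (x i) (y i) + (\<Sum>i\<in>I. a i *\<^sub>C rank_one (x i) (y i))) < \<infinity>"
    using insert.IH
    by (intro schatten_norm_add_finite assms(1) bounded_ops_sum bounded_ops_scaleC rank_one_bounded_ops)
  then show ?case using insert.hyps by simp
qed (use schatten_norm_zero[of r, where 'a = 'a] assms in simp)

text \<open>The sesquilinear form \<open>(x, y) \<mapsto> \<phi> (rank_one x y)\<close> is bounded, so it is given by an operator \<open>B\<close>. On finite
rank operators \<open>\<phi>\<close> is the trace pairing with \<open>B\<close>; hence \<open>B\<close> has finite Schatten norm, both sides are continuous in the
Schatten norm, and finite rank operators are dense.\<close>

theorem schatten_functional_representation:
  fixes \<phi> :: "('a::{complex_inner,banach} \<Rightarrow>\<^sub>L 'a) \<Rightarrow> complex"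
  assumes conj: "conj_exp r q"
    and add: "\<And>A B. A \<in> bounded_ops \<Longrightarrow> B \<in> bounded_ops \<Longrightarrow> schatten_norm (ennreal r) A < \<infinity> \<Longrightarrow>
      schatten_norm (ennreal r) B < \<infinity> \<Longrightarrow> \<phi> (A + B) = \<phi> A + \<phi> B"
    and scale: "\<And>c A. A \<in> bounded_ops \<Longrightarrow> schatten_norm (ennreal r) A < \<infinity> \<Longrightarrow> \<phi> (c *\<^sub>C A) = c * \<phi> A"
    and bound: "\<And>A K. A \<in> bounded_ops \<Longrightarrow> schatten_norm (ennreal r) A \<le> ennreal K \<Longrightarrow> K \<ge> 0 \<Longrightarrow>
      cmod (\<phi> A) \<le> C * K"
    and C: "C \<ge> 0"
  shows "\<exists>B\<in>bounded_ops. schatten_norm q B \<le> ennreal C \<and>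
    (\<forall>A\<in>bounded_ops. schatten_norm (ennreal r) A < \<infinity> \<longrightarrow> \<phi> A = op_trace (A o\<^sub>L B))"
proof -
  have r1: "r \<ge> 1" by (rule conj_exp_ge1[OF conj])
  then have r0: "r > 0" by simp
  have fin1: "schatten_norm (ennreal r) (rank_one x y) < \<infinity>" for x y :: 'a
    using schatten_norm_rank_one[OF r0, of x y] by (simp add: le_less_trans)
  note rb = rank_one_bounded_ops
  have "\<exists>B\<in>bounded_ops. \<forall>x y. cinner (blinfun_apply B x) y = \<phi> (rank_one x y)"
  proof (rule op_of_form)
    fix x x' y :: 'a
    have "rank_one (x + x') y = rank_one x y + rank_one x' y"
      by (rule blinfun_eqI) (simp add: blinfun.add_left scaleC_add_right)
    then show "\<phi> (rank_one (x + x') y) = \<phi> (rank_one x y) + \<phi> (rank_one x' y)"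
      using add[OF rb rb fin1 fin1] by simp
  next
    fix c and x y :: 'a
    have "rank_one (c *\<^sub>C x) y = c *\<^sub>C rank_one x y"
      by (rule blinfun_eqI) (simp add: scaleC_blinfun.rep_eq scaleC_scaleC mult.commute)
    then show "\<phi> (rank_one (c *\<^sub>C x) y) = c * \<phi> (rank_one x y)"
      using scale[OF rb fin1] by simp
  next
    fix x y y' :: 'a
    have "rank_one x (y + y') = rank_one x y + rank_one x y'"
      by (rule blinfun_eqI) (simp add: blinfun.add_left cinner_add_right scaleC_add_left)
    then show "\<phi> (rank_one x (y + y')) = \<phi> (rank_one x y) + \<phi> (rank_one x y')"
      using add[OF rb rb fin1 fin1] by simp
  next
    fix c and x y :: 'a
    have "rank_one x (c *\<^sub>C y) = cnj c *\<^sub>C rank_one x y"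
      by (rule blinfun_eqI) (simp add: scaleC_blinfun.rep_eq scaleC_scaleC cinner_scaleC_right)
    then show "\<phi> (rank_one x (c *\<^sub>C y)) = cnj c * \<phi> (rank_one x y)"
      using scale[OF rb fin1] by simp
  next
    fix x y :: 'a
    show "cmod (\<phi> (rank_one x y)) \<le> C * norm x * norm y"
      using bound[OF rb schatten_norm_rank_one[OF r0], of x y] by (simp add: mult.assoc)
  qed
  then obtain B where B: "B \<in> bounded_ops" "\<And>x y. cinner (B x) y = \<phi> (rank_one x y)" by blast
  have fin_rank: "\<phi> (\<Sum>i\<in>I. a i *\<^sub>C rank_one (x i) (y i)) = (\<Sum>i\<in>I. a i * cinner (B (x i)) (y i))"
    if "finite I" for I :: "'a set" and a x y
    using that
  proof induction
    case empty
    have "\<phi> (0 *\<^sub>C 0) = 0 * \<phi> 0"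
      by (rule scale) (use schatten_norm_zero[OF r0, where 'a = 'a] in auto)
    then show ?case by simp
  next
    case (insert i I)
    have f: "schatten_norm (ennreal r) (a i *\<^sub>C rank_one (x i) (y i)) < \<infinity>"
      using schatten_finite_rank_finite[OF r1, of "{i}" a x y] by simp
    have "\<phi> (a i *\<^sub>C rank_one (x i) (y i) + (\<Sum>i\<in>I. a i *\<^sub>C rank_one (x i) (y i)))
        = \<phi> (a i *\<^sub>C rank_one (x i) (y i)) + \<phi> (\<Sum>i\<in>I. a i *\<^sub>C rank_one (x i) (y i))"
      using insert.hyps
      by (intro add bounded_ops_sum bounded_ops_scaleC rb f schatten_finite_rank_finite r1)
    then show ?case using insert by (simp add: scale[OF rb fin1] B(2))
  qed
  have Bq: "schatten_norm q B \<le> ennreal C"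
  proof (rule schatten_norm_le_of_pairing[OF conj B(1) C])
    fix Y :: "'a set" and g :: "'a \<Rightarrow> 'a" and a K
    assume Y: "finite Y" "ortho_set Y" "inj_on g Y" "ortho_set (g ` Y)" and K: "K \<ge> 0"
      "(\<Sum>y\<in>Y. cmod (a y) powr r) \<le> K powr r"
    have "cmod (\<phi> (\<Sum>y\<in>Y. a y *\<^sub>C rank_one (g y) y)) \<le> C * K"
      by (intro bound bounded_ops_sum bounded_ops_scaleC rb schatten_norm_finite_rank Y r0 K)
    then show "cmod (\<Sum>y\<in>Y. a y * cinner (B (g y)) y) \<le> C * K"
      by (simp only: fin_rank[OF Y(1)])
  qed
  have "\<phi> A = op_trace (A o\<^sub>L B)" if A: "A \<in> bounded_ops" "schatten_norm (ennreal r) A < \<infinity>" for A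
  proof -
    have "cmod (\<phi> A - op_trace (A o\<^sub>L B)) \<le> 2 * C * \<epsilon>" if \<epsilon>: "\<epsilon> > 0" for \<epsilon>
    proof -
      obtain F where F: "finite F" "schatten_norm (ennreal r) (A - (\<Sum>e\<in>F. 1 *\<^sub>C rank_one (A e) e)) \<le> ennreal \<epsilon>"
        by (rule schatten_finite_rank_approx[OF A r0 \<epsilon>])
      let ?S = "\<Sum>e\<in>F. 1 *\<^sub>C rank_one (A e) e"
      let ?D = "A - ?S"
      have S: "?S \<in> bounded_ops" "schatten_norm (ennreal r) ?S < \<infinity>"
        by (intro bounded_ops_sum bounded_ops_scaleC rb)
          (rule schatten_finite_rank_finite[OF r1 F(1)])
      have D: "?D \<in> bounded_ops" "schatten_norm (ennreal r) ?D < \<infinity>"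
        by (rule bounded_ops_diff[OF A(1) S(1)]) (rule le_less_trans[OF F(2)], simp)
      have qB: "schatten_norm q B < \<infinity>" using Bq by (simp add: le_less_trans)
      have A_eq: "A = ?D + ?S" by simp
      have "\<phi> A = \<phi> ?D + \<phi> ?S" using add[OF D(1) S(1) D(2) S(2)] by simp
      moreover have "op_trace (A o\<^sub>L B) = op_trace (?D o\<^sub>L B) + op_trace (?S o\<^sub>L B)"
      proof -
        have "A o\<^sub>L B = (?D o\<^sub>L B) + (?S o\<^sub>L B)"
          by (rule blinfun_eqI) (simp add: blinfun.add_left blinfun.diff_left)
        then show ?thesis
          using op_trace_add[OF bounded_ops_compose[OF D(1) B(1)] schatten_compose_finite[OF conj D B(1) qB]
              bounded_ops_compose[OF S(1) B(1)] schatten_compose_finite[OF conj S B(1) qB]] by simp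
      qed
      moreover have "\<phi> ?S = op_trace (?S o\<^sub>L B)"
        by (simp only: fin_rank[OF F(1)] op_trace_rank_one[OF B(1) F(1)])
      ultimately have eq: "\<phi> A - op_trace (A o\<^sub>L B) = \<phi> ?D - op_trace (?D o\<^sub>L B)" by simp
      have "cmod (\<phi> A - op_trace (A o\<^sub>L B)) \<le> cmod (\<phi> ?D) + cmod (op_trace (?D o\<^sub>L B))"
        unfolding eq by (rule norm_triangle_ineq4)
      moreover have "cmod (\<phi> ?D) \<le> C * \<epsilon>" using \<epsilon> by (intro bound D F) auto
      moreover have "cmod (op_trace (?D o\<^sub>L B)) \<le> \<epsilon> * C"
        using \<epsilon> C by (intro schatten_trace_bound[OF conj D(1) F(2) _ B(1) Bq]) auto
      ultimately show ?thesis by (simp only: mult.commute[of \<epsilon> C])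
    qed
    note le = this
    have "cmod (\<phi> A - op_trace (A o\<^sub>L B)) \<le> 0 + e" if "e > 0" for e
    proof -
      have "e / (2 * C + 1) > 0" "2 * C * (e / (2 * C + 1)) \<le> e"
        using that C by (simp_all add: divide_simps)
      then show ?thesis using le[of "e / (2 * C + 1)"] by linarith
    qed
    then have "cmod (\<phi> A - op_trace (A o\<^sub>L B)) \<le> 0" by (rule field_le_epsilon)
    then show ?thesis by simp
  qed
  with B(1) Bq show ?thesis by blast
qed

section \<open>Lebesgue spaces and their duals\<close>

text \<open>Limit arguments such as dominated convergence are pointwise, so they are carried out for representatives.\<close>

definition Lr :: "real \<Rightarrow> ('a::euclidean_space \<Rightarrow> complex) \<Rightarrow> bool" where
  "Lr r f \<longleftrightarrow> f \<in> borel_measurable borel \<and> integrable lborel (\<lambda>x. cmod (f x) powr r)"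

definition Lr_norm :: "real \<Rightarrow> ('a::euclidean_space \<Rightarrow> complex) \<Rightarrow> real" where
  "Lr_norm r f = (\<integral>x. cmod (f x) powr r \<partial>lborel) powr (1 / r)"

text \<open>The formula under the quotient in \<open>Lp_norm\<close>, for representatives.\<close>

definition Lp_fnorm :: "ennreal \<Rightarrow> ('a::euclidean_space \<Rightarrow> complex) \<Rightarrow> ennreal" where
  "Lp_fnorm p f = (if p = \<infinity> then esssup lborel (\<lambda>x. ennreal (cmod (f x)))
    else ennreal_powr (\<integral>\<^sup>+ x. ennreal (cmod (f x) powr enn2real p) \<partial>lborel) (1 / enn2real p))"

lemma LrD [measurable_dest]: "Lr r f \<Longrightarrow> f \<in> borel_measurable borel"
  by (simp add: Lr_def)

lemma Lr_integrable: "Lr r f \<Longrightarrow> integrable lborel (\<lambda>x. cmod (f x) powr r)"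
  by (simp add: Lr_def)

lemma Lr_norm_nonneg [simp]: "Lr_norm r f \<ge> 0"
  by (simp add: Lr_norm_def)

lemma Lr_norm_powr: "r > 0 \<Longrightarrow> Lr_norm r f powr r = (\<integral>x. cmod (f x) powr r \<partial>lborel)"
  by (simp add: Lr_norm_def powr_powr)

lemma Lp_fnorm_le_iff:
  assumes "r > 0" "C \<ge> 0"
  shows "Lp_fnorm (ennreal r) f \<le> ennreal C \<longleftrightarrow>
    (\<integral>\<^sup>+ x. ennreal (cmod (f x) powr r) \<partial>lborel) \<le> ennreal (C powr r)"
  using assms by (simp add: Lp_fnorm_def ennreal_powr_le_iff)

lemma Lr_iff_Lp_fnorm:
  assumes [measurable]: "f \<in> borel_measurable borel" and r: "r > 0"
  shows "Lr r f \<longleftrightarrow> Lp_fnorm (ennreal r) f < \<infinity>"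
  using r by (simp add: Lr_def Lp_fnorm_def ennreal_powr_less_top[unfolded infinity_ennreal_def] integrable_iff_bounded)

lemma Lp_fnorm_eq_Lr_norm:
  assumes f: "Lr r f" and r: "r > 0"
  shows "Lp_fnorm (ennreal r) f = ennreal (Lr_norm r f)"
proof -
  have "(\<integral>\<^sup>+ x. ennreal (cmod (f x) powr r) \<partial>lborel) = ennreal (\<integral>x. cmod (f x) powr r \<partial>lborel)"
    by (rule nn_integral_eq_integral[OF Lr_integrable[OF f]]) simp
  then show ?thesis using r by (simp add: Lp_fnorm_def ennreal_powr_def Lr_norm_def)
qed

lemma Lp_fnorm_top_le_iff:
  assumes [measurable]: "f \<in> borel_measurable borel" and C: "C \<ge> 0"
  shows "Lp_fnorm \<infinity> f \<le> ennreal C \<longleftrightarrow> (AE x in lborel. cmod (f x) \<le> C)"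
proof
  assume le: "Lp_fnorm \<infinity> f \<le> ennreal C"
  have "AE x in lborel. ennreal (cmod (f x)) \<le> Lp_fnorm \<infinity> f"
    using esssup_AE[where M = lborel and f = "\<lambda>x. ennreal (cmod (f x))"] by (simp add: Lp_fnorm_def)
  then show "AE x in lborel. cmod (f x) \<le> C"
  proof eventually_elim
    case (elim x)
    with le have "ennreal (cmod (f x)) \<le> ennreal C" by (rule order_trans[rotated])
    then show ?case using C by (simp add: ennreal_le_iff)
  qed
next
  assume "AE x in lborel. cmod (f x) \<le> C"
  then have "AE x in lborel. ennreal (cmod (f x)) \<le> ennreal C"
    by eventually_elim (rule ennreal_leI)
  then show "Lp_fnorm \<infinity> f \<le> ennreal C" by (auto simp: Lp_fnorm_def intro!: esssup_I)
qed

lemma powr_add_le: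
  fixes a b :: complex
  assumes "r \<ge> 0"
  shows "cmod (a + b) powr r \<le> 2 powr r * (cmod a powr r + cmod b powr r)"
proof -
  have "cmod (a + b) \<le> 2 * max (cmod a) (cmod b)"
    using norm_triangle_ineq[of a b] by simp
  then have "cmod (a + b) powr r \<le> (2 * max (cmod a) (cmod b)) powr r"
    using assms by (intro powr_mono2) auto
  also have "\<dots> = 2 powr r * max (cmod a) (cmod b) powr r" by (simp add: powr_mult)
  also have "\<dots> \<le> 2 powr r * (cmod a powr r + cmod b powr r)"
    by (intro mult_left_mono) (auto simp: max_def)
  finally show ?thesis .
qed

lemma Lr_add:
  assumes f: "Lr r f" and g: "Lr r g" and r: "r \<ge> 0"
  shows "Lr r (\<lambda>x. f x + g x)"
proof -
  note [measurable] = LrD[OF f] LrD[OF g]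
  have "integrable lborel (\<lambda>x. cmod (f x + g x) powr r)"
  proof (rule Bochner_Integration.integrable_bound)
    show "integrable lborel (\<lambda>x. 2 powr r * (cmod (f x) powr r + cmod (g x) powr r))"
      using Lr_integrable[OF f] Lr_integrable[OF g] by simp
  qed (use powr_add_le[OF r] in \<open>auto intro!: AE_I2 simp: abs_of_nonneg\<close>)
  then show ?thesis by (simp add: Lr_def)
qed

lemma Lr_cmult: "Lr r f \<Longrightarrow> Lr r (\<lambda>x. c * f x)"
  by (auto simp: Lr_def norm_mult powr_mult intro: borel_measurable_times)

lemma Lr_diff: "Lr r f \<Longrightarrow> Lr r g \<Longrightarrow> r \<ge> 0 \<Longrightarrow> Lr r (\<lambda>x. f x - g x)"
  using Lr_add[of r f "\<lambda>x. - 1 * g x"] Lr_cmult[of r g "- 1"] by simp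

lemma Lr_norm_cmult: "r > 0 \<Longrightarrow> Lr_norm r (\<lambda>x. c * f x) = cmod c * Lr_norm r f"
  by (simp add: Lr_norm_def norm_mult powr_mult powr_powr)

lemma Lr_bounded:
  assumes [measurable]: "f \<in> borel_measurable borel" and G: "integrable lborel (\<lambda>x. G x powr r)"
    and le: "\<And>x. cmod (f x) \<le> G x" and r: "r \<ge> 0"
  shows "Lr r f"
  unfolding Lr_def
proof
  show "integrable lborel (\<lambda>x. cmod (f x) powr r)"
  proof (rule Bochner_Integration.integrable_bound[OF G])
    show "AE x in lborel. norm (cmod (f x) powr r) \<le> norm (G x powr r)"
      using le r by (auto intro!: AE_I2 powr_mono2)
  qed simp
qed simp

subsection \<open>Hoelder's inequality\<close>

lemma Lr_norm_zero_AE: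
  assumes f: "Lr r f" and "Lr_norm r f = 0" and r: "r > 0"
  shows "AE x in lborel. f x = 0"
proof -
  have "(\<integral>x. cmod (f x) powr r \<partial>lborel) = 0"
    using assms(2) Lr_norm_powr[OF r, of f] by simp
  then have "AE x in lborel. cmod (f x) powr r = 0"
    using Lr_integrable[OF f] by (subst (asm) integral_nonneg_eq_0_iff_AE) auto
  then show ?thesis by eventually_elim simp
qed

text \<open>It suffices to dominate \<open>|f g|\<close> by an integrable function whose integral is at most the product of the norms.
For finite \<open>q\<close> Young's inequality for the normalised functions provides it; if one of the norms
vanishes, so that normalising is impossible, the product is zero almost everywhere.\<close>

theorem Lr_Holder:
  assumes conj: "conj_exp r q" and f: "Lr r f" and [measurable]: "g \<in> borel_measurable borel"
    and g: "Lp_fnorm q g \<le> ennreal D" and D: "D \<ge> 0"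
  shows "integrable lborel (\<lambda>x. f x * g x)" "cmod (\<integral>x. f x * g x \<partial>lborel) \<le> Lr_norm r f * D"
proof -
  note [measurable] = LrD[OF f]
  have *: "integrable lborel (\<lambda>x. f x * g x) \<and> cmod (\<integral>x. f x * g x \<partial>lborel) \<le> Lr_norm r f * D"
    if G: "integrable lborel G" "AE x in lborel. cmod (f x * g x) \<le> G x" "integral\<^sup>L lborel G \<le> Lr_norm r f * D" for G
  proof
    show i: "integrable lborel (\<lambda>x. f x * g x)"
      by (rule Bochner_Integration.integrable_bound[OF G(1)]) (use G(2) in \<open>auto elim!: eventually_mono\<close>)
    have "cmod (\<integral>x. f x * g x \<partial>lborel) \<le> (\<integral>x. cmod (f x * g x) \<partial>lborel)"
      by (rule integral_norm_bound)
    also have "\<dots> \<le> integral\<^sup>L lborel G"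
      by (rule integral_mono_AE[OF integrable_norm[OF i] G(1,2)])
    finally show "cmod (\<integral>x. f x * g x \<partial>lborel) \<le> Lr_norm r f * D" using G(3) by linarith
  qed
  have "integrable lborel (\<lambda>x. f x * g x) \<and> cmod (\<integral>x. f x * g x \<partial>lborel) \<le> Lr_norm r f * D"
    using conj unfolding conj_exp_def
  proof (elim disjE conjE)
    assume r: "r = 1" "q = \<infinity>"
    have ae: "AE x in lborel. cmod (g x) \<le> D" using g D by (simp only: r Lp_fnorm_top_le_iff[OF assms(3) D])
    have i: "integrable lborel (\<lambda>x. cmod (f x))" using Lr_integrable[OF f] by (simp add: r)
    show ?thesis
    proof (rule *)
      show "integrable lborel (\<lambda>x. cmod (f x) * D)" using i by simp
      show "AE x in lborel. cmod (f x * g x) \<le> cmod (f x) * D"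
        using ae by eventually_elim (simp add: norm_mult mult_left_mono)
      have "0 \<le> (\<integral>x. cmod (f x) \<partial>lborel)" by simp
      then show "(\<integral>x. cmod (f x) * D \<partial>lborel) \<le> Lr_norm r f * D" by (simp add: Lr_norm_def r)
    qed
  next
    assume r: "r > 1" "q = ennreal (r / (r - 1))"
    define s where "s = r / (r - 1)"
    have s: "s > 1" "1 / r + 1 / s = 1" using r by (auto simp: s_def field_simps)
    have gs: "Lr s g"
      using g s Lr_iff_Lp_fnorm[OF assms(3), of s] by (auto simp: r s_def[symmetric] le_less_trans)
    have gD: "Lr_norm s g \<le> D"
      using g D s by (simp add: r s_def[symmetric] Lp_fnorm_eq_Lr_norm[OF gs] ennreal_le_iff)
    show ?thesis
    proof (cases "Lr_norm r f = 0 \<or> Lr_norm s g = 0")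
      case True
      then have "(AE x in lborel. f x = 0) \<or> (AE x in lborel. g x = 0)"
        using Lr_norm_zero_AE[OF f] Lr_norm_zero_AE[OF gs] r s by auto
      then have "AE x in lborel. cmod (f x * g x) \<le> 0"
        by (auto elim!: eventually_mono)
      then show ?thesis using D by (intro *[of "\<lambda>_. 0"]) auto
    next
      case False
      let ?a = "Lr_norm r f" and ?b = "Lr_norm s g"
      have pos: "?a > 0" "?b > 0" using False Lr_norm_nonneg by (auto simp: less_le)
      have ar: "?a powr r = (\<integral>x. cmod (f x) powr r \<partial>lborel)" and bs: "?b powr s = (\<integral>x. cmod (g x) powr s \<partial>lborel)"
        using r s by (simp_all add: Lr_norm_powr)
      let ?G = "\<lambda>x. ?a * ?b * (cmod (f x) powr r / ?a powr r / r + cmod (g x) powr s / ?b powr s / s)"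
      show ?thesis
      proof (rule *[of ?G])
        show "integrable lborel ?G" using Lr_integrable[OF f] Lr_integrable[OF gs] by simp
        show "AE x in lborel. cmod (f x * g x) \<le> ?G x"
        proof (rule AE_I2)
          fix x
          have "(cmod (f x) / ?a) * (cmod (g x) / ?b) \<le> (cmod (f x) / ?a) powr r / r + (cmod (g x) / ?b) powr s / s"
            using pos r s by (intro Youngs_inequality) auto
          then have "?a * ?b * ((cmod (f x) / ?a) * (cmod (g x) / ?b)) \<le> ?a * ?b * ((cmod (f x) / ?a) powr r / r + (cmod (g x) / ?b) powr s / s)"
            using pos by (intro mult_left_mono) auto
          then show "cmod (f x * g x) \<le> ?G x" using pos by (simp add: norm_mult powr_divide)
        qed
        have "integral\<^sup>L lborel ?G = ?a * ?b * ((\<integral>x. cmod (f x) powr r \<partial>lborel) / ?a powr r / r + (\<integral>x. cmod (g x) powr s \<partial>lborel) / ?b powr s / s)"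
          using Lr_integrable[OF f] Lr_integrable[OF gs] by simp
        also have "\<dots> = ?a * ?b * (1 / r + 1 / s)"
          using pos by (simp only: ar[symmetric] bs[symmetric]) simp
        also have "\<dots> \<le> ?a * D" using gD s pos by simp
        finally show "integral\<^sup>L lborel ?G \<le> ?a * D" .
      qed
    qed
  qed
  then show "integrable lborel (\<lambda>x. f x * g x)" "cmod (\<integral>x. f x * g x \<partial>lborel) \<le> Lr_norm r f * D" by auto
qed

subsection \<open>The norm as a supremum of pairings\<close>

text \<open>A strictly positive function in the Lebesgue space. The functions dominated by multiples of \<open>w\<close> take the
role of bounded functions on a space of finite measure and serve as test functions.\<close>

lemma positive_weight:
  assumes r: "r > 0"
  obtains w :: "'a::euclidean_space \<Rightarrow> real" where "w \<in> borel_measurable borel" "\<And>x. w x > 0"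
    "integrable lborel (\<lambda>x. w x powr r)"
proof -
  obtain u :: "'a \<Rightarrow> real" where u: "u \<in> borel_measurable lborel" "\<And>x. u x > 0" "integrable lborel u"
    using sigma_finite_measure.obtain_positive_integrable_function[OF sigma_finite_lborel] by metis
  show thesis
  proof (rule that[of "\<lambda>x. u x powr (1 / r)"])
    show "(\<lambda>x. u x powr (1 / r)) \<in> borel_measurable borel" using u(1) by simp
    show "u x powr (1 / r) > 0" for x using u(2)[of x] by simp
    have "(\<lambda>x. (u x powr (1 / r)) powr r) = u" using u(2) r by (auto simp: powr_powr less_imp_le)
    then show "integrable lborel (\<lambda>x. (u x powr (1 / r)) powr r)" using u(3) by simp
  qed
qed

text \<open>For finite \<open>q\<close> the extremal partner \<open>cnj g * |g|\<^bsup>s-2\<^esup>\<close> of \<open>g\<close> is cut off to the sets \<open>S n\<close> on which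
it is dominated by \<open>n * w\<close>. These sets increase to the whole space because \<open>w > 0\<close>, so monotone convergence
applies. For \<open>q = \<infinity>\<close> the partner is \<open>w\<close> times the conjugate phase of \<open>g\<close> on the set where \<open>|g| > C\<close>; the test
inequality makes the integral of \<open>w * (|g| - C)\<close> over this set nonpositive.\<close>

theorem Lp_fnorm_le_of_pairing:
  fixes g :: "'a::euclidean_space \<Rightarrow> complex"
  assumes conj: "conj_exp r q" and g [measurable]: "g \<in> borel_measurable borel"
    and w [measurable]: "w \<in> borel_measurable borel" and w0: "\<And>x. w x > 0"
    and wr: "integrable lborel (\<lambda>x. w x powr r)" and wg: "integrable lborel (\<lambda>x. w x *\<^sub>R g x)" and C: "C \<ge> 0"
    and test: "\<And>f N. Lr r f \<Longrightarrow> (\<And>x. cmod (f x) \<le> N * w x) \<Longrightarrow>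
      cmod (\<integral>x. f x * g x \<partial>lborel) \<le> C * Lr_norm r f"
  shows "Lp_fnorm q g \<le> ennreal C"
proof -
  have r0: "r > 0" using conj by (auto simp: conj_exp_def)
  have Lr_test: "Lr r f" if [measurable]: "f \<in> borel_measurable borel" and le: "\<And>x. cmod (f x) \<le> N * w x" and N: "N \<ge> 0" for f N
  proof (rule Lr_bounded)
    have "integrable lborel (\<lambda>x. N powr r * w x powr r)" using wr by simp
    then show "integrable lborel (\<lambda>x. (N * w x) powr r)" by (simp add: powr_mult)
  qed (use le r0 in auto)
  have wg': "integrable lborel (\<lambda>x. w x * cmod (g x))"
    using integrable_norm[OF wg] w0 by (simp add: less_imp_le)
  show ?thesis
    using conj unfolding conj_exp_def
  proof (elim disjE conjE)
    assume r: "r = 1" "q = \<infinity>"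
    define S where "S = {x. cmod (g x) > C}"
    have [measurable]: "S \<in> sets borel" unfolding S_def by measurable
    define f where "f x = cnj (g x) * complex_of_real (w x / cmod (g x)) * indicator S x" for x
    have [measurable]: "f \<in> borel_measurable borel" unfolding f_def by measurable
    have nf: "cmod (f x) = w x * indicator S x" for x
    proof (cases "x \<in> S")
      case True
      then have "cmod (g x) \<noteq> 0" using C by (auto simp: S_def)
      with True w0[of x] show ?thesis by (simp add: f_def norm_mult norm_divide)
    qed (simp add: f_def)
    have Lf: "Lr r f" by (rule Lr_test[of f 1]) (use w0 in \<open>auto simp: nf indicator_def less_imp_le\<close>)
    have fg: "f x * g x = complex_of_real (w x * cmod (g x) * indicator S x)" for x
    proof (cases "x \<in> S")
      case True
      then have "g x \<noteq> 0" using C by (auto simp: S_def)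
      have "f x * g x = (g x * cnj (g x)) * complex_of_real (w x / cmod (g x))" using True by (simp add: f_def)
      also have "\<dots> = complex_of_real ((cmod (g x))\<^sup>2 * (w x / cmod (g x)))"
        by (simp only: of_real_mult complex_norm_square)
      finally show ?thesis using True \<open>g x \<noteq> 0\<close> by (simp add: power2_eq_square mult.commute)
    qed (simp add: f_def)
    have iw: "integrable lborel (\<lambda>x. w x * indicator S x)"
      using Lr_integrable[OF Lf] w0 by (simp add: r nf abs_of_pos less_imp_le)
    have iwg: "integrable lborel (\<lambda>x. w x * cmod (g x) * indicator S x)"
      using integrable_mult_indicator[OF _ wg', of S] by (simp add: mult.commute)
    have "cmod (\<integral>x. f x * g x \<partial>lborel) \<le> C * Lr_norm r f"
      by (rule test[OF Lf, of 1]) (use w0 in \<open>auto simp: nf indicator_def less_imp_le\<close>)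
    moreover have "(\<integral>x. f x * g x \<partial>lborel) = complex_of_real (\<integral>x. w x * cmod (g x) * indicator S x \<partial>lborel)"
      by (simp only: fg integral_complex_of_real)
    moreover have "0 \<le> (\<integral>x. w x * cmod (g x) * indicator S x \<partial>lborel)"
      using w0 by (intro integral_nonneg_AE AE_I2) (simp add: less_imp_le)
    moreover have "Lr_norm r f = (\<integral>x. w x * indicator S x \<partial>lborel)"
    proof -
      have "0 \<le> (\<integral>x. w x * indicator S x \<partial>lborel)"
        using w0 by (intro integral_nonneg_AE AE_I2) (simp add: less_imp_le)
      then show ?thesis using w0 by (simp add: Lr_norm_def r nf less_imp_le)
    qed
    ultimately have le: "(\<integral>x. w x * cmod (g x) * indicator S x \<partial>lborel) \<le> C * (\<integral>x. w x * indicator S x \<partial>lborel)"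
      by simp
    let ?d = "\<lambda>x. w x * cmod (g x) * indicator S x - C * (w x * indicator S x)"
    have d0: "0 \<le> ?d x" for x
      using w0[of x] by (auto simp: S_def indicator_def)
    have di: "integrable lborel ?d" using iw iwg by simp
    have "integral\<^sup>L lborel ?d \<le> 0" using le iw iwg by simp
    moreover have "0 \<le> integral\<^sup>L lborel ?d" using d0 by (intro integral_nonneg_AE AE_I2)
    ultimately have "integral\<^sup>L lborel ?d = 0" by simp
    then have "AE x in lborel. ?d x = 0"
      using di d0 by (subst (asm) integral_nonneg_eq_0_iff_AE) auto
    then have "AE x in lborel. cmod (g x) \<le> C"
    proof eventually_elim
      case (elim x)
      then show ?case using w0[of x] by (cases "x \<in> S") (auto simp: S_def algebra_simps)
    qed
    then show ?thesis unfolding r using Lp_fnorm_top_le_iff[OF g C] by simp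
  next
    assume r: "r > 1" "q = ennreal (r / (r - 1))"
    define s where "s = r / (r - 1)"
    have s: "s > 1" "(s - 1) * r = s" using r by (auto simp: s_def field_simps)
    define S where "S n = {x. cmod (g x) powr (s - 1) \<le> real n * w x}" for n
    have [measurable]: "S n \<in> sets borel" for n unfolding S_def by measurable
    have bound: "(\<integral>\<^sup>+ x. ennreal (cmod (g x) powr s) * indicator (S n) x \<partial>lborel) \<le> ennreal (C powr s)" for n
    proof -
      define f where "f x = cnj (g x) * complex_of_real (cmod (g x) powr (s - 2)) * indicator (S n) x" for x
      have [measurable]: "f \<in> borel_measurable borel" unfolding f_def by measurable
      have nf: "cmod (f x) = cmod (g x) powr (s - 1) * indicator (S n) x" for x
      proof (cases "g x = 0")
        case False
        then have "cmod (g x) * cmod (g x) powr (s - 2) = cmod (g x) powr (s - 1)"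
          by (simp add: powr_diff power2_eq_square)
        then show ?thesis by (simp add: f_def norm_mult indicator_def)
      qed (simp add: f_def)
      have fg: "f x * g x = complex_of_real (cmod (g x) powr s * indicator (S n) x)" for x
      proof (cases "g x = 0")
        case False
        have "f x * g x = (g x * cnj (g x)) * complex_of_real (cmod (g x) powr (s - 2)) * indicator (S n) x"
          by (simp add: f_def mult_ac)
        also have "\<dots> = complex_of_real ((cmod (g x))\<^sup>2 * cmod (g x) powr (s - 2)) * indicator (S n) x"
          by (simp only: of_real_mult complex_norm_square)
        also have "(cmod (g x))\<^sup>2 * cmod (g x) powr (s - 2) = cmod (g x) powr s"
          using False by (simp add: powr_diff powr_numeral)
        finally show ?thesis by (simp add: indicator_def)
      qed (simp add: f_def)
      have f_le: "cmod (f x) \<le> real n * w x" for x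
        using w0[of x] by (auto simp: nf indicator_def S_def less_imp_le)
      have Lf: "Lr r f" by (rule Lr_test[OF _ f_le]) auto
      have fr: "cmod (f x) powr r = cmod (g x) powr s * indicator (S n) x" for x
        by (cases "x \<in> S n") (simp_all add: nf powr_powr s(2))
      define I where "I = (\<integral>x. cmod (g x) powr s * indicator (S n) x \<partial>lborel)"
      have I0: "I \<ge> 0" unfolding I_def by (intro integral_nonneg_AE AE_I2) simp
      have ii: "integrable lborel (\<lambda>x. cmod (g x) powr s * indicator (S n) x)"
        using Lr_integrable[OF Lf] by (simp only: fr)
      have "cmod (\<integral>x. f x * g x \<partial>lborel) \<le> C * Lr_norm r f" by (rule test[OF Lf f_le])
      then have "I \<le> C * I powr (1 / r)"
        using I0 by (simp only: fg integral_complex_of_real Lr_norm_def fr I_def[symmetric]) simp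
      then have "I \<le> C powr s" by (rule powr_self_bound[OF r(1) s_def I0])
      moreover have "(\<integral>\<^sup>+ x. ennreal (cmod (g x) powr s) * indicator (S n) x \<partial>lborel) = ennreal I"
      proof -
        have "(\<integral>\<^sup>+ x. ennreal (cmod (g x) powr s * indicator (S n) x) \<partial>lborel) = ennreal I"
          unfolding I_def by (rule nn_integral_eq_integral[OF ii]) simp
        moreover have "ennreal (cmod (g x) powr s * indicator (S n) x) = ennreal (cmod (g x) powr s) * indicator (S n) x" for x
          by (simp add: indicator_def)
        ultimately show ?thesis by simp
      qed
      ultimately show ?thesis by (simp add: ennreal_leI)
    qed
    have inc: "incseq (\<lambda>n x. ennreal (cmod (g x) powr s) * indicator (S n) x)"
    proof (intro incseq_SucI le_funI mult_left_mono)
      fix n x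
      have "real n * w x \<le> real (Suc n) * w x" using w0[of x] by simp
      then show "indicator (S n) x \<le> (indicator (S (Suc n)) x :: ennreal)"
        by (auto simp: indicator_def S_def intro: order_trans)
    qed simp
    have sup: "(SUP n. ennreal (cmod (g x) powr s) * indicator (S n) x) = ennreal (cmod (g x) powr s)" for x
    proof (rule antisym)
      show "(SUP n. ennreal (cmod (g x) powr s) * indicator (S n) x) \<le> ennreal (cmod (g x) powr s)"
        by (intro SUP_least) (simp add: indicator_def)
      obtain n where "cmod (g x) powr (s - 1) / w x \<le> real n" using real_arch_simple by blast
      then have "x \<in> S n" using w0[of x] by (simp add: S_def divide_le_eq)
      then show "ennreal (cmod (g x) powr s) \<le> (SUP n. ennreal (cmod (g x) powr s) * indicator (S n) x)"
        by (intro SUP_upper2[of n]) auto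
    qed
    have "(\<integral>\<^sup>+ x. ennreal (cmod (g x) powr s) \<partial>lborel) = (SUP n. \<integral>\<^sup>+ x. ennreal (cmod (g x) powr s) * indicator (S n) x \<partial>lborel)"
      using nn_integral_monotone_convergence_SUP[OF inc, of lborel] by (simp add: sup)
    also have "\<dots> \<le> ennreal (C powr s)" by (intro SUP_least bound)
    finally have "Lp_fnorm (ennreal s) g \<le> ennreal C" using s C by (simp add: Lp_fnorm_le_iff)
    then show ?thesis by (simp add: r s_def)
  qed
qed


subsection \<open>Densities of additive set functions\<close>

text \<open>The bound by the finite measure with density \<open>u\<close> gives continuity at the empty set, hence
countable additivity, as well as absolute continuity; the Radon-Nikodym theorem does the rest.\<close>

lemma nonneg_additive_density:
  fixes lam :: "'a::euclidean_space set \<Rightarrow> real"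
  assumes nn: "\<And>A. A \<in> sets borel \<Longrightarrow> 0 \<le> lam A"
    and add: "\<And>A B. A \<in> sets borel \<Longrightarrow> B \<in> sets borel \<Longrightarrow> A \<inter> B = {} \<Longrightarrow> lam (A \<union> B) = lam A + lam B"
    and u: "integrable lborel u" "\<And>x. 0 \<le> u x" and a: "a > 0"
    and bound: "\<And>A. A \<in> sets borel \<Longrightarrow> lam A \<le> C * (\<integral>x. indicator A x * u x \<partial>lborel) powr a"
  obtains k :: "'a \<Rightarrow> real" where "integrable lborel k"
    "\<And>A. A \<in> sets borel \<Longrightarrow> lam A = (\<integral>x. indicator A x * k x \<partial>lborel)"
proof -
  note [measurable] = borel_measurable_integrable[OF u(1)]
  let ?m = "\<lambda>A. ennreal (lam A)"
  have lam0: "lam {} = 0" using add[of "{}" "{}"] by simp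
  have pos: "positive (sets borel) ?m" by (simp add: positive_def lam0)
  have additive: "additive (sets borel) ?m"
    by (auto simp: additive_def add nn ennreal_plus)
  have ca: "countably_additive (sets borel) ?m"
  proof (rule ring_of_sets.empty_continuous_imp_countably_additive[OF _ pos additive])
    show "ring_of_sets UNIV (sets (borel :: 'a measure))"
      using sets.ring_of_sets_axioms[of "borel :: 'a measure"] by simp
    fix A :: "nat \<Rightarrow> 'a set"
    assume A: "range A \<subseteq> sets borel" "decseq A" "(\<Inter>i. A i) = {}"
    then have [measurable]: "A i \<in> sets borel" for i by auto
    have "(\<lambda>i. \<integral>x. indicator (A i) x * u x \<partial>lborel) \<longlonglongrightarrow> (\<integral>x. 0 \<partial>(lborel :: 'a measure))"
    proof (rule integral_dominated_convergence[where w = u])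
      show "AE x in lborel. (\<lambda>i. indicator (A i) x * u x) \<longlonglongrightarrow> 0"
      proof (rule AE_I2)
        fix x
        have "(\<lambda>i. indicator (A i) x :: real) \<longlonglongrightarrow> indicator (\<Inter>i. A i) x"
          by (rule LIMSEQ_indicator_decseq[OF A(2)])
        then have "(\<lambda>i. indicator (A i) x * u x) \<longlonglongrightarrow> 0 * u x"
          using A(3) by (intro tendsto_mult tendsto_const) simp
        then show "(\<lambda>i. indicator (A i) x * u x) \<longlonglongrightarrow> 0" by simp
      qed
    qed (use u in \<open>auto simp: indicator_def\<close>)
    then have I: "(\<lambda>i. \<integral>x. indicator (A i) x * u x \<partial>lborel) \<longlonglongrightarrow> 0" by simp
    have "(\<lambda>i. C * (\<integral>x. indicator (A i) x * u x \<partial>lborel) powr a) \<longlonglongrightarrow> C * 0 powr a"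
      using a u(2) by (intro tendsto_mult tendsto_const tendsto_powr'[OF I tendsto_const])
        (auto intro!: always_eventually integral_nonneg_AE AE_I2)
    then have lim0: "(\<lambda>i. C * (\<integral>x. indicator (A i) x * u x \<partial>lborel) powr a) \<longlonglongrightarrow> 0" by simp
    have "(\<lambda>i. lam (A i)) \<longlonglongrightarrow> 0"
      by (rule tendsto_sandwich[OF _ _ tendsto_const lim0]) (auto intro!: always_eventually nn bound)
    then show "(\<lambda>i. ennreal (lam (A i))) \<longlonglongrightarrow> 0"
      using tendsto_ennrealI by fastforce
  qed simp
  define N where "N = measure_of UNIV (sets (borel :: 'a measure)) ?m"
  have sN [simp]: "sets N = sets lborel"
    unfolding N_def using sets.sigma_sets_eq[of "borel :: 'a measure"] by (simp add: sets_measure_of_conv)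
  have em: "emeasure N A = ennreal (lam A)" if "A \<in> sets borel" for A
    unfolding N_def
    by (rule emeasure_measure_of_sigma[OF _ pos ca that])
      (use sets.sigma_algebra_axioms[of "borel :: 'a measure"] in simp)
  have "absolutely_continuous lborel N"
    unfolding absolutely_continuous_def
  proof
    fix A :: "'a set" assume A: "A \<in> null_sets lborel"
    then have [measurable]: "A \<in> sets borel" by auto
    have "AE x in lborel. indicator A x * u x = 0"
      using AE_not_in[OF A] by eventually_elim simp
    then have "(\<integral>x. indicator A x * u x \<partial>lborel) = 0"
      by (simp add: integral_eq_zero_AE)
    then have "lam A \<le> 0" using bound[of A] a by simp
    then have "lam A = 0" using nn[of A] by simp
    then show "A \<in> null_sets N" using em[of A] by (auto simp: null_sets_def)
  qed
  then obtain f where f [measurable]: "f \<in> borel_measurable lborel" and dens: "density lborel f = N"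
    using sigma_finite_measure.Radon_Nikodym[OF sigma_finite_lborel _ sN] by blast
  have lam_f: "ennreal (lam A) = (\<integral>\<^sup>+ x. f x * indicator A x \<partial>lborel)" if "A \<in> sets borel" for A
    using emeasure_density[OF f, of A] that by (simp add: dens em)
  have "(\<integral>\<^sup>+ x. f x \<partial>lborel) = ennreal (lam UNIV)" using lam_f[of UNIV] by simp
  then have fin: "AE x in lborel. f x < \<infinity>"
    using nn_integral_PInf_AE[OF f] by (auto simp: less_top)
  have int_eq: "(\<integral>\<^sup>+ x. ennreal (indicator A x * enn2real (f x)) \<partial>lborel) = ennreal (lam A)" if A: "A \<in> sets borel" for A
    unfolding lam_f[OF A]
    by (rule nn_integral_cong_AE) (use fin in \<open>eventually_elim, auto simp: indicator_def less_top\<close>)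
  show thesis
  proof (rule that)
    show "integrable lborel (\<lambda>x. enn2real (f x))"
      using int_eq[of UNIV] by (intro integrableI_nonneg) auto
    fix A :: "'a set" assume A [measurable]: "A \<in> sets borel"
    have "(\<integral>x. indicator A x * enn2real (f x) \<partial>lborel) = enn2real (\<integral>\<^sup>+ x. ennreal (indicator A x * enn2real (f x)) \<partial>lborel)"
      by (rule integral_eq_nn_integral) (auto simp: indicator_def)
    also have "\<dots> = lam A" using nn[OF A] by (simp only: int_eq[OF A]) simp
    finally show "lam A = (\<integral>x. indicator A x * enn2real (f x) \<partial>lborel)" ..
  qed
qed

text \<open>The Jordan decomposition: \<open>p A\<close>, the supremum of \<open>\<mu>\<close> over the measurable subsets of \<open>A\<close>, and
\<open>p - \<mu>\<close> are additive and nonnegative, and they satisfy a bound of the same kind as \<open>\<mu>\<close>.\<close>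

lemma additive_density:
  fixes \<mu> :: "'a::euclidean_space set \<Rightarrow> real"
  assumes add: "\<And>A B. A \<in> sets borel \<Longrightarrow> B \<in> sets borel \<Longrightarrow> A \<inter> B = {} \<Longrightarrow> \<mu> (A \<union> B) = \<mu> A + \<mu> B"
    and u: "integrable lborel u" "\<And>x. 0 \<le> u x" and a: "a > 0" and C: "C \<ge> 0"
    and bound: "\<And>A. A \<in> sets borel \<Longrightarrow> \<bar>\<mu> A\<bar> \<le> C * (\<integral>x. indicator A x * u x \<partial>lborel) powr a"
  obtains k :: "'a \<Rightarrow> real" where "integrable lborel k"
    "\<And>A. A \<in> sets borel \<Longrightarrow> \<mu> A = (\<integral>x. indicator A x * k x \<partial>lborel)"
proof -
  note [measurable] = borel_measurable_integrable[OF u(1)]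
  let ?N = "\<lambda>A. \<integral>x. indicator A x * u x \<partial>lborel"
  have N_mono: "?N B \<le> ?N A" if "A \<in> sets borel" "B \<in> sets borel" "B \<subseteq> A" for A B
  proof (intro integral_mono_AE AE_I2)
    show "integrable lborel (\<lambda>x. indicator B x * u x)" "integrable lborel (\<lambda>x. indicator A x * u x)"
      using integrable_mult_indicator[OF _ u(1), of A] integrable_mult_indicator[OF _ u(1), of B] that by auto
  qed (use that u in \<open>auto simp: indicator_def\<close>)
  have N0: "0 \<le> ?N A" for A using u by (intro integral_nonneg_AE AE_I2) auto
  have mu0: "\<mu> {} = 0" using add[of "{}" "{}"] by simp
  define S where "S A = {\<mu> B |B. B \<in> sets borel \<and> B \<subseteq> A}" for A
  define p where "p A = Sup (S A)" for A
  have S_le: "x \<le> C * ?N A powr a" if x: "x \<in> S A" and A: "A \<in> sets borel" for x A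
  proof -
    obtain B where B: "x = \<mu> B" "B \<in> sets borel" "B \<subseteq> A" using x by (auto simp: S_def)
    have "x \<le> C * ?N B powr a" using bound[OF B(2)] B(1) by simp
    also have "\<dots> \<le> C * ?N A powr a"
      using a C N0 N_mono[OF A B(2,3)] by (intro mult_left_mono powr_mono2) auto
    finally show ?thesis .
  qed
  have S_ne: "S A \<noteq> {}" for A unfolding S_def by (auto intro!: exI[of _ "{}"])
  have bdd: "bdd_above (S A)" if "A \<in> sets borel" for A
    using S_le that by (auto intro!: bdd_aboveI)
  have p_up: "\<mu> B \<le> p A" if "A \<in> sets borel" "B \<in> sets borel" "B \<subseteq> A" for A B
    unfolding p_def by (rule cSup_upper[OF _ bdd[OF that(1)]]) (use that in \<open>auto simp: S_def\<close>)
  have p_le: "p A \<le> z" if "\<And>B. B \<in> sets borel \<Longrightarrow> B \<subseteq> A \<Longrightarrow> \<mu> B \<le> z" for A z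
    unfolding p_def by (rule cSup_least[OF S_ne]) (use that in \<open>auto simp: S_def\<close>)
  have p_bound: "p A \<le> C * ?N A powr a" if "A \<in> sets borel" for A
    by (rule p_le) (rule S_le[OF _ that], auto simp: S_def)
  have p_add: "p (A \<union> B) = p A + p B" if A: "A \<in> sets borel" and B: "B \<in> sets borel" and d: "A \<inter> B = {}" for A B
  proof (rule antisym)
    show "p (A \<union> B) \<le> p A + p B"
    proof (rule p_le)
      fix D assume D: "D \<in> sets borel" "D \<subseteq> A \<union> B"
      have "\<mu> ((D \<inter> A) \<union> (D \<inter> B)) = \<mu> (D \<inter> A) + \<mu> (D \<inter> B)"
        using D A B d by (intro add) auto
      moreover have "(D \<inter> A) \<union> (D \<inter> B) = D" using D(2) by auto
      ultimately show "\<mu> D \<le> p A + p B"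
        using p_up[OF A, of "D \<inter> A"] p_up[OF B, of "D \<inter> B"] D A B by auto
    qed
    have 1: "\<mu> D + \<mu> G \<le> p (A \<union> B)" if "D \<in> sets borel" "D \<subseteq> A" "G \<in> sets borel" "G \<subseteq> B" for D G
    proof -
      have "\<mu> (D \<union> G) = \<mu> D + \<mu> G" using that d by (intro add) auto
      moreover have "\<mu> (D \<union> G) \<le> p (A \<union> B)" using that A B by (intro p_up) auto
      ultimately show ?thesis by simp
    qed
    have "\<mu> D \<le> p (A \<union> B) - p B" if D: "D \<in> sets borel" "D \<subseteq> A" for D
    proof -
      have "p B \<le> p (A \<union> B) - \<mu> D" by (rule p_le) (use 1[OF D] in \<open>simp add: algebra_simps\<close>)
      then show ?thesis by simp
    qed
    then have "p A \<le> p (A \<union> B) - p B" by (rule p_le)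
    then show "p A + p B \<le> p (A \<union> B)" by simp
  qed
  obtain k1 where k1: "integrable lborel k1" "\<And>A. A \<in> sets borel \<Longrightarrow> p A = (\<integral>x. indicator A x * k1 x \<partial>lborel)"
  proof (rule nonneg_additive_density[of p u a C])
    show "0 \<le> p A" if "A \<in> sets borel" for A using p_up[OF that, of "{}"] mu0 by simp
  qed (use p_add u a p_bound in auto)
  obtain k2 where k2: "integrable lborel k2" "\<And>A. A \<in> sets borel \<Longrightarrow> p A - \<mu> A = (\<integral>x. indicator A x * k2 x \<partial>lborel)"
  proof (rule nonneg_additive_density[of "\<lambda>A. p A - \<mu> A" u a "2 * C"])
    show "0 \<le> p A - \<mu> A" if "A \<in> sets borel" for A using p_up[OF that that] by simp
    show "p A - \<mu> A \<le> 2 * C * ?N A powr a" if "A \<in> sets borel" for A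
      using p_bound[OF that] bound[OF that] by (simp add: abs_le_iff)
  qed (use p_add add u a in auto)
  show thesis
  proof (rule that[of "\<lambda>x. k1 x - k2 x"])
    show "integrable lborel (\<lambda>x. k1 x - k2 x)" using k1(1) k2(1) by simp
    fix A :: "'a set" assume A [measurable]: "A \<in> sets borel"
    have "integrable lborel (\<lambda>x. indicator A x * k x)" if "integrable lborel k" for k :: "'a \<Rightarrow> real"
      using integrable_mult_indicator[OF _ that, of A] by simp
    then have "(\<integral>x. indicator A x * (k1 x - k2 x) \<partial>lborel) = p A - (p A - \<mu> A)"
      using k1 k2 A by (simp add: right_diff_distrib)
    then show "\<mu> A = (\<integral>x. indicator A x * (k1 x - k2 x) \<partial>lborel)" by simp
  qed
qed

subsection \<open>Representation of bounded functionals\<close>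

definition Lr_functional :: "real \<Rightarrow> real \<Rightarrow> (('a::euclidean_space \<Rightarrow> complex) \<Rightarrow> complex) \<Rightarrow> bool" where
  "Lr_functional r C \<Phi> \<longleftrightarrow>
    (\<forall>f g. Lr r f \<longrightarrow> Lr r g \<longrightarrow> \<Phi> (\<lambda>x. f x + g x) = \<Phi> f + \<Phi> g) \<and>
    (\<forall>c f. Lr r f \<longrightarrow> \<Phi> (\<lambda>x. c * f x) = c * \<Phi> f) \<and>
    (\<forall>f. Lr r f \<longrightarrow> cmod (\<Phi> f) \<le> C * Lr_norm r f)"

lemma Lr_functional_sum:
  assumes \<Phi>: "Lr_functional r C \<Phi>" and I: "finite I" and f: "\<And>i. i \<in> I \<Longrightarrow> Lr r (f i)" and r: "r > 0"
  shows "Lr r (\<lambda>x. \<Sum>i\<in>I. f i x) \<and> \<Phi> (\<lambda>x. \<Sum>i\<in>I. f i x) = (\<Sum>i\<in>I. \<Phi> (f i))"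
  using I f
proof induction
  case empty
  have "Lr r (\<lambda>_ :: 'a. 0)" by (simp add: Lr_def)
  moreover from this have "\<Phi> (\<lambda>x. 0 * 0) = 0 * \<Phi> (\<lambda>_. 0)" using \<Phi> unfolding Lr_functional_def by blast
  ultimately show ?case by simp
next
  case (insert i I)
  then have "Lr r (f i)" "Lr r (\<lambda>x. \<Sum>i\<in>I. f i x)" by auto
  then have "\<Phi> (\<lambda>x. f i x + (\<Sum>i\<in>I. f i x)) = \<Phi> (f i) + \<Phi> (\<lambda>x. \<Sum>i\<in>I. f i x)"
    using \<Phi> unfolding Lr_functional_def by blast
  moreover have "Lr r (\<lambda>x. f i x + (\<Sum>i\<in>I. f i x))" using insert r by (intro Lr_add) auto
  ultimately show ?case using insert by simp
qed

lemma Lr_functional_diff: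
  assumes \<Phi>: "Lr_functional r C \<Phi>" and f: "Lr r f" and g: "Lr r g"
  shows "\<Phi> (\<lambda>x. f x - g x) = \<Phi> f - \<Phi> g"
proof -
  have "\<Phi> (\<lambda>x. f x + - 1 * g x) = \<Phi> f + \<Phi> (\<lambda>x. - 1 * g x)"
    using \<Phi> f Lr_cmult[OF g, of "- 1"] unfolding Lr_functional_def by blast
  also have "\<Phi> (\<lambda>x. - 1 * g x) = - 1 * \<Phi> g" using \<Phi> g unfolding Lr_functional_def by blast
  finally show ?thesis by simp
qed

text \<open>Dominated convergence for \<open>\<Phi>\<close>: pointwise convergence under a majorant in the Lebesgue space is
convergence in norm.\<close>

lemma Lr_functional_continuous:
  assumes \<Phi>: "Lr_functional r C \<Phi>" and r: "r > 0" and [measurable]: "\<And>i. f i \<in> borel_measurable borel" "h \<in> borel_measurable borel"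
    and G: "integrable lborel (\<lambda>x. G x powr r)" and fG: "\<And>i x. cmod (f i x) \<le> G x" and hG: "\<And>x. cmod (h x) \<le> G x"
    and lim: "\<And>x. (\<lambda>i. f i x) \<longlonglongrightarrow> h x"
  shows "(\<lambda>i. \<Phi> (f i)) \<longlonglongrightarrow> \<Phi> h"
proof -
  have Lf: "Lr r (f i)" for i using G fG r by (intro Lr_bounded) auto
  have Lh: "Lr r h" using G hG r by (intro Lr_bounded) auto
  have "(\<lambda>i. \<integral>x. cmod (f i x - h x) powr r \<partial>lborel) \<longlonglongrightarrow> (\<integral>x. 0 \<partial>(lborel :: 'a measure))"
  proof (rule integral_dominated_convergence[where w = "\<lambda>x. 2 powr r * G x powr r"])
    show "AE x in lborel. (\<lambda>i. cmod (f i x - h x) powr r) \<longlonglongrightarrow> 0"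
    proof (rule AE_I2)
      fix x
      have "(\<lambda>i. cmod (f i x - h x)) \<longlonglongrightarrow> 0"
        using lim[of x] by (intro tendsto_norm_zero) (simp add: LIM_zero_iff)
      from tendsto_powr'[OF this tendsto_const, of r] r
      show "(\<lambda>i. cmod (f i x - h x) powr r) \<longlonglongrightarrow> 0" by simp
    qed
    show "AE x in lborel. norm (cmod (f i x - h x) powr r) \<le> 2 powr r * G x powr r" for i
    proof (rule AE_I2)
      fix x
      have G0: "0 \<le> G x" using hG[of x] norm_ge_zero order_trans by blast
      have "cmod (f i x - h x) \<le> 2 * G x"
        using norm_triangle_ineq4[of "f i x" "h x"] fG[of i x] hG[of x] by linarith
      then have "cmod (f i x - h x) powr r \<le> (2 * G x) powr r" using r by (intro powr_mono2) auto
      then show "norm (cmod (f i x - h x) powr r) \<le> 2 powr r * G x powr r" using G0 by (simp add: powr_mult)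
    qed
  qed (use G in auto)
  then have I: "(\<lambda>i. \<integral>x. cmod (f i x - h x) powr r \<partial>lborel) \<longlonglongrightarrow> 0" by simp
  have "(\<lambda>i. C * Lr_norm r (\<lambda>x. f i x - h x)) \<longlonglongrightarrow> C * 0 powr (1 / r)"
    unfolding Lr_norm_def using r
    by (intro tendsto_mult tendsto_const tendsto_powr'[OF I tendsto_const]) auto
  then have 0: "(\<lambda>i. C * Lr_norm r (\<lambda>x. f i x - h x)) \<longlonglongrightarrow> 0" by simp
  have "(\<lambda>i. \<Phi> (f i) - \<Phi> h) \<longlonglongrightarrow> 0"
  proof (rule Lim_null_comparison[OF always_eventually 0], intro allI)
    fix i
    have "cmod (\<Phi> (\<lambda>x. f i x - h x)) \<le> C * Lr_norm r (\<lambda>x. f i x - h x)"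
      using \<Phi> Lr_diff[OF Lf Lh, of i] r unfolding Lr_functional_def by simp
    then show "norm (\<Phi> (f i) - \<Phi> h) \<le> C * Lr_norm r (\<lambda>x. f i x - h x)"
      by (simp add: Lr_functional_diff[OF \<Phi> Lf Lh])
  qed
  then show ?thesis by (simp add: LIM_zero_iff)
qed

text \<open>The set function \<open>A \<mapsto> \<Phi> (w * indicator A)\<close> has a density \<open>k\<close>, and \<open>g = k / w\<close> represents \<open>\<Phi>\<close> on
\<open>w\<close> times simple functions, then by dominated convergence on all functions dominated by a multiple of \<open>w\<close>. By the
sharpness of Hoelder's inequality \<open>g\<close> has finite \<open>q\<close>-norm, and truncation extends the representation to the whole
space.\<close>

theorem Lr_functional_density:
  fixes \<Phi> :: "('a::euclidean_space \<Rightarrow> complex) \<Rightarrow> complex"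
  assumes conj: "conj_exp r q" and \<Phi>: "Lr_functional r C \<Phi>" and C: "C \<ge> 0"
  shows "\<exists>g\<in>borel_measurable borel. Lp_fnorm q g \<le> ennreal C \<and>
    (\<forall>f. Lr r f \<longrightarrow> \<Phi> f = (\<integral>x. f x * g x \<partial>lborel))"
proof -
  have r: "r \<ge> 1" by (rule conj_exp_ge1[OF conj])
  then have r0: "r > 0" by simp
  have \<Phi>_add: "\<Phi> (\<lambda>x. f x + g x) = \<Phi> f + \<Phi> g" if "Lr r f" "Lr r g" for f g
    using \<Phi> that unfolding Lr_functional_def by blast
  have \<Phi>_scale: "\<Phi> (\<lambda>x. c * f x) = c * \<Phi> f" if "Lr r f" for c f
    using \<Phi> that unfolding Lr_functional_def by blast
  have \<Phi>_bound: "cmod (\<Phi> f) \<le> C * Lr_norm r f" if "Lr r f" for f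
    using \<Phi> that unfolding Lr_functional_def by blast
  obtain w :: "'a \<Rightarrow> real" where w [measurable]: "w \<in> borel_measurable borel" and w0: "\<And>x. w x > 0"
    and wr: "integrable lborel (\<lambda>x. w x powr r)"
    by (rule positive_weight[OF r0]) blast
  have wle: "0 \<le> w x" for x using w0[of x] by simp
  have Gi: "integrable lborel (\<lambda>x. (N * w x) powr r)" if "N \<ge> 0" for N
    using wr that wle by (simp add: powr_mult)
  have Lw: "Lr r (\<lambda>x. complex_of_real (w x) * h x)"
    if [measurable]: "h \<in> borel_measurable borel" and h: "\<And>x. cmod (h x) \<le> N" for h N
  proof (rule Lr_bounded)
    have "N \<ge> 0" using h norm_ge_zero order_trans by blast
    then show "integrable lborel (\<lambda>x. (N * w x) powr r)" by (rule Gi)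
    show "cmod (complex_of_real (w x) * h x) \<le> N * w x" for x
      using h[of x] w0[of x] by (simp add: norm_mult mult.commute)
  qed (use r in auto)
  define S where "S A = \<Phi> (\<lambda>x. complex_of_real (w x) * indicator A x)" for A
  have LA: "Lr r (\<lambda>x. complex_of_real (w x) * indicator A x)" if "A \<in> sets borel" for A
    using that by (intro Lw[of _ 1]) (auto simp: indicator_def)
  have S_add: "S (A \<union> B) = S A + S B" if "A \<in> sets borel" "B \<in> sets borel" "A \<inter> B = {}" for A B
  proof -
    have "(\<lambda>x. complex_of_real (w x) * indicator (A \<union> B) x)
        = (\<lambda>x. complex_of_real (w x) * indicator A x + complex_of_real (w x) * indicator B x)"
      using that(3) by (auto simp: indicator_def fun_eq_iff)
    then show ?thesis using \<Phi>_add[OF LA[OF that(1)] LA[OF that(2)]] by (simp add: S_def)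
  qed
  have S_bound: "cmod (S A) \<le> C * (\<integral>x. indicator A x * w x powr r \<partial>lborel) powr (1 / r)" if "A \<in> sets borel" for A
  proof -
    have "cmod (complex_of_real (w x) * indicator A x) powr r = indicator A x * w x powr r" for x
      using wle by (simp add: norm_mult indicator_def)
    then show ?thesis using \<Phi>_bound[OF LA[OF that]] by (simp add: S_def Lr_norm_def)
  qed
  have ir: "1 / r > 0" using r0 by simp
  obtain k1 where k1: "integrable lborel k1" "\<And>A. A \<in> sets borel \<Longrightarrow> Re (S A) = (\<integral>x. indicator A x * k1 x \<partial>lborel)"
    by (rule additive_density[of "\<lambda>A. Re (S A)" "\<lambda>x. w x powr r" "1 / r" C])
      (use S_add wr ir C in \<open>auto intro: order_trans[OF abs_Re_le_cmod S_bound]\<close>)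
  obtain k2 where k2: "integrable lborel k2" "\<And>A. A \<in> sets borel \<Longrightarrow> Im (S A) = (\<integral>x. indicator A x * k2 x \<partial>lborel)"
    by (rule additive_density[of "\<lambda>A. Im (S A)" "\<lambda>x. w x powr r" "1 / r" C])
      (use S_add wr ir C in \<open>auto intro: order_trans[OF abs_Im_le_cmod S_bound]\<close>)
  define k where "k x = complex_of_real (k1 x) + \<i> * complex_of_real (k2 x)" for x
  have k: "integrable lborel k" unfolding k_def using k1(1) k2(1) by simp
  note [measurable] = borel_measurable_integrable[OF k]
  have ind_k: "integrable lborel (\<lambda>x. indicator A x * k x)" if "A \<in> sets borel" for A
  proof -
    have "(\<lambda>x. indicator A x * k x) = (\<lambda>x. indicator A x *\<^sub>R k x)" by (auto simp: indicator_def fun_eq_iff)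
    then show ?thesis using integrable_mult_indicator[OF _ k, of A] that by simp
  qed
  have Sk: "S A = (\<integral>x. indicator A x * k x \<partial>lborel)" if A: "A \<in> sets borel" for A
  proof -
    have "(\<integral>x. indicator A x * k x \<partial>lborel)
        = (\<integral>x. complex_of_real (indicator A x * k1 x) + \<i> * complex_of_real (indicator A x * k2 x) \<partial>lborel)"
      by (rule Bochner_Integration.integral_cong) (auto simp: k_def indicator_def)
    also have "\<dots> = complex_of_real (Re (S A)) + \<i> * complex_of_real (Im (S A))"
      using integrable_mult_indicator[OF _ k1(1), of A] integrable_mult_indicator[OF _ k2(1), of A] A
      by (simp add: k1(2)[OF A] k2(2)[OF A] del: of_real_mult)
    finally show ?thesis by (simp add: complex_eq_iff)
  qed
  have simple: "\<Phi> (\<lambda>x. complex_of_real (w x) * s x) = (\<integral>x. s x * k x \<partial>lborel)"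
    if s: "simple_function lborel s" for s :: "'a \<Rightarrow> complex"
  proof -
    have fin: "finite (range s)" using s by (simp add: simple_function_def)
    have sets: "s -` {y} \<in> sets borel" for y
      using simple_functionD(2)[OF s, of "{y}"] by simp
    have rep: "s x = (\<Sum>y\<in>range s. y * indicator (s -` {y}) x)" for x
    proof -
      have "(\<Sum>y\<in>range s. y * indicator (s -` {y}) x) = (\<Sum>y\<in>range s. if y = s x then y else 0)"
        by (rule sum.cong) (auto simp: indicator_def)
      then show ?thesis using fin by simp
    qed
    have "\<Phi> (\<lambda>x. complex_of_real (w x) * s x)
        = \<Phi> (\<lambda>x. \<Sum>y\<in>range s. y * (complex_of_real (w x) * indicator (s -` {y}) x))"
      by (subst rep) (simp add: sum_distrib_left mult_ac)
    also have "\<dots> = (\<Sum>y\<in>range s. \<Phi> (\<lambda>x. y * (complex_of_real (w x) * indicator (s -` {y}) x)))"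
      using Lr_functional_sum[OF \<Phi> fin _ r0, of "\<lambda>y x. y * (complex_of_real (w x) * indicator (s -` {y}) x)"]
        Lr_cmult[OF LA[OF sets]] by blast
    also have "\<dots> = (\<Sum>y\<in>range s. y * S (s -` {y}))"
      by (simp only: \<Phi>_scale[OF LA[OF sets]] S_def)
    also have "\<dots> = (\<Sum>y\<in>range s. \<integral>x. y * (indicator (s -` {y}) x * k x) \<partial>lborel)"
      by (simp add: Sk[OF sets])
    also have "\<dots> = (\<integral>x. (\<Sum>y\<in>range s. y * (indicator (s -` {y}) x * k x)) \<partial>lborel)"
      by (rule Bochner_Integration.integral_sum[symmetric]) (intro integrable_mult_right ind_k sets)
    also have "\<dots> = (\<integral>x. s x * k x \<partial>lborel)"
      by (simp only: mult.assoc[symmetric] sum_distrib_right[symmetric] rep[symmetric])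
    finally show ?thesis .
  qed
  have bdd: "\<Phi> (\<lambda>x. complex_of_real (w x) * h x) = (\<integral>x. h x * k x \<partial>lborel)"
    if h [measurable]: "h \<in> borel_measurable borel" and hN: "\<And>x. cmod (h x) \<le> N" for h N
  proof -
    have N: "N \<ge> 0" using hN norm_ge_zero order_trans by blast
    obtain F where F: "\<And>i. simple_function lborel (F i)" "\<And>x. (\<lambda>i. F i x) \<longlonglongrightarrow> h x"
      "\<And>i x. cmod (F i x) \<le> 2 * cmod (h x)"
      using borel_measurable_implies_sequence_metric[of h lborel 0] h by auto
    have [measurable]: "F i \<in> borel_measurable borel" for i
      using borel_measurable_simple_function[OF F(1), of i] by simp
    have FN: "cmod (F i x) \<le> 2 * N" for i x using F(3)[of i x] hN[of x] by linarith
    have "(\<lambda>i. \<Phi> (\<lambda>x. complex_of_real (w x) * F i x)) \<longlonglongrightarrow> \<Phi> (\<lambda>x. complex_of_real (w x) * h x)"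
    proof (rule Lr_functional_continuous[OF \<Phi> r0])
      show "integrable lborel (\<lambda>x. (2 * N * w x) powr r)" using N by (intro Gi) simp
      show "cmod (complex_of_real (w x) * F i x) \<le> 2 * N * w x" for i x
        using mult_right_mono[OF FN[of i x] wle[of x]] wle[of x] by (simp add: norm_mult mult.commute)
      have "cmod (h x) \<le> 2 * N" for x using hN[of x] N by linarith
      then show "cmod (complex_of_real (w x) * h x) \<le> 2 * N * w x" for x
        using mult_right_mono[of "cmod (h x)" "2 * N" "w x"] wle[of x] by (simp add: norm_mult mult.commute)
      show "(\<lambda>i. complex_of_real (w x) * F i x) \<longlonglongrightarrow> complex_of_real (w x) * h x" for x
        by (intro tendsto_intros F)
    qed auto
    then have 1: "(\<lambda>i. \<integral>x. F i x * k x \<partial>lborel) \<longlonglongrightarrow> \<Phi> (\<lambda>x. complex_of_real (w x) * h x)"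
      by (simp only: simple[OF F(1)])
    have 2: "(\<lambda>i. \<integral>x. F i x * k x \<partial>lborel) \<longlonglongrightarrow> (\<integral>x. h x * k x \<partial>lborel)"
    proof (rule integral_dominated_convergence[where w = "\<lambda>x. 2 * N * cmod (k x)"])
      show "integrable lborel (\<lambda>x. 2 * N * cmod (k x))" using k by simp
      show "AE x in lborel. (\<lambda>i. F i x * k x) \<longlonglongrightarrow> h x * k x" by (intro AE_I2 tendsto_intros F)
      show "AE x in lborel. norm (F i x * k x) \<le> 2 * N * cmod (k x)" for i
        using FN[of i] by (intro AE_I2) (simp add: norm_mult mult_right_mono)
    qed simp_all
    show ?thesis by (rule LIMSEQ_unique[OF 1 2])
  qed
  define g where "g x = k x / complex_of_real (w x)" for x
  have g [measurable]: "g \<in> borel_measurable borel" unfolding g_def by measurable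
  have wle_case: "\<Phi> f = (\<integral>x. f x * g x \<partial>lborel)" if f: "Lr r f" and fN: "\<And>x. cmod (f x) \<le> N * w x" for f N
  proof -
    note [measurable] = LrD[OF f]
    have wne: "complex_of_real (w x) \<noteq> 0" for x using w0[of x] by simp
    have "\<Phi> (\<lambda>x. complex_of_real (w x) * (f x / complex_of_real (w x))) = (\<integral>x. f x / complex_of_real (w x) * k x \<partial>lborel)"
    proof (rule bdd[of _ N])
      show "cmod (f x / complex_of_real (w x)) \<le> N" for x
        using fN[of x] w0[of x] by (simp add: norm_divide divide_le_eq)
    qed simp
    then show ?thesis using wne by (simp add: g_def)
  qed
  have gq: "Lp_fnorm q g \<le> ennreal C"
  proof (rule Lp_fnorm_le_of_pairing[OF conj g w w0 wr _ C])
    have "(\<lambda>x. w x *\<^sub>R g x) = k" using w0 by (auto simp: g_def scaleR_conv_of_real fun_eq_iff less_imp_neq[symmetric])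
    then show "integrable lborel (\<lambda>x. w x *\<^sub>R g x)" using k by simp
    show "cmod (\<integral>x. f x * g x \<partial>lborel) \<le> C * Lr_norm r f"
      if "Lr r f" "\<And>x. cmod (f x) \<le> N * w x" for f N
      using \<Phi>_bound[OF that(1)] wle_case[OF that] by simp
  qed
  have "\<Phi> f = (\<integral>x. f x * g x \<partial>lborel)" if f: "Lr r f" for f
  proof -
    note [measurable] = LrD[OF f]
    define F where "F n x = f x * indicator {x. cmod (f x) \<le> real n * w x} x" for n x
    have [measurable]: "F n \<in> borel_measurable borel" for n unfolding F_def by measurable
    have Fle: "cmod (F n x) \<le> cmod (f x)" and FN: "cmod (F n x) \<le> real n * w x" for n x
      using wle[of x] by (auto simp: F_def indicator_def)
    have lim: "(\<lambda>n. F n x) \<longlonglongrightarrow> f x" for x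
    proof (rule tendsto_eventually)
      obtain n where n: "cmod (f x) / w x \<le> real n" using real_arch_simple by blast
      have "F m x = f x" if "m \<ge> n" for m
      proof -
        have "cmod (f x) / w x \<le> real m" using n that by linarith
        then have "cmod (f x) \<le> real m * w x" using w0[of x] by (simp add: divide_le_eq)
        then show ?thesis by (simp add: F_def)
      qed
      then show "\<forall>\<^sub>F n in sequentially. F n x = f x" by (auto simp: eventually_sequentially)
    qed
    have LF: "Lr r (F n)" for n
      using Fle r by (intro Lr_bounded[OF _ Lr_integrable[OF f]]) auto
    have "(\<lambda>n. \<Phi> (F n)) \<longlonglongrightarrow> \<Phi> f"
      by (rule Lr_functional_continuous[OF \<Phi> r0 _ _ Lr_integrable[OF f] Fle order_refl lim]) simp_all
    then have 1: "(\<lambda>n. \<integral>x. F n x * g x \<partial>lborel) \<longlonglongrightarrow> \<Phi> f"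
      by (simp only: wle_case[OF LF FN])
    have 2: "(\<lambda>n. \<integral>x. F n x * g x \<partial>lborel) \<longlonglongrightarrow> (\<integral>x. f x * g x \<partial>lborel)"
    proof (rule integral_dominated_convergence[where w = "\<lambda>x. cmod (f x * g x)"])
      show "integrable lborel (\<lambda>x. cmod (f x * g x))"
        by (rule integrable_norm[OF Lr_Holder(1)[OF conj f g gq C]])
      show "AE x in lborel. (\<lambda>n. F n x * g x) \<longlonglongrightarrow> f x * g x" by (intro AE_I2 tendsto_intros lim)
      show "AE x in lborel. norm (F n x * g x) \<le> cmod (f x * g x)" for n
        using Fle by (intro AE_I2) (simp add: norm_mult mult_right_mono)
    qed simp_all
    show ?thesis by (rule LIMSEQ_unique[OF 1 2])
  qed
  with g gq show ?thesis by blast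
qed

subsection \<open>Functions modulo equality almost everywhere\<close>

lemma ae_eq_refl: "f \<in> borel_measurable borel \<Longrightarrow> ae_eq f f"
  by (simp add: ae_eq_def)

lemma ae_fun_cases [cases type: ae_fun]:
  obtains f where "f \<in> borel_measurable borel" "F = abs_ae_fun f"
proof -
  have "ae_eq (rep_ae_fun F) (rep_ae_fun F)" by (rule Quotient_rep_reflp[OF Quotient_ae_fun])
  then show thesis
    using that[of "rep_ae_fun F"] Quotient_abs_rep[OF Quotient_ae_fun, of F] by (simp add: ae_eq_def)
qed

lemma abs_ae_fun_eq_iff:
  "f \<in> borel_measurable borel \<Longrightarrow> g \<in> borel_measurable borel \<Longrightarrow>
    abs_ae_fun f = abs_ae_fun g \<longleftrightarrow> (AE x in lborel. f x = g x)"
  using Quotient_rel[OF Quotient_ae_fun, of f g] by (auto simp: ae_eq_def)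

lemma Lp_norm_abs: "f \<in> borel_measurable borel \<Longrightarrow> Lp_norm p (abs_ae_fun f) = Lp_fnorm p f"
  by (simp add: Lp_norm.abs_eq ae_eq_refl Lp_fnorm_def)

lemma abs_ae_fun_arith:
  assumes "f \<in> borel_measurable borel" "g \<in> borel_measurable borel"
  shows "abs_ae_fun f + abs_ae_fun g = abs_ae_fun (\<lambda>x. f x + g x)"
    "abs_ae_fun f - abs_ae_fun g = abs_ae_fun (\<lambda>x. f x - g x)"
    "ae_mult (abs_ae_fun f) (abs_ae_fun g) = abs_ae_fun (\<lambda>x. f x * g x)"
    "c *\<^sub>C abs_ae_fun f = abs_ae_fun (\<lambda>x. c * f x)"
    "ae_cnj (abs_ae_fun f) = abs_ae_fun (\<lambda>x. cnj (f x))"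
  using assms
  by (simp_all add: plus_ae_fun.abs_eq minus_ae_fun.abs_eq ae_mult.abs_eq scaleC_ae_fun.abs_eq
      ae_cnj.abs_eq ae_eq_refl)

lemma ae_integral_abs: "f \<in> borel_measurable borel \<Longrightarrow> ae_integral (abs_ae_fun f) = integral\<^sup>L lborel f"
  by (simp add: ae_integral.abs_eq ae_eq_refl)

lemma ae_integrable_abs: "f \<in> borel_measurable borel \<Longrightarrow> ae_integrable (abs_ae_fun f) \<longleftrightarrow> integrable lborel f"
  by (simp add: ae_integrable.abs_eq ae_eq_refl)

lemma Lp_norm_add_finite:
  assumes r: "r > 0" and "Lp_norm (ennreal r) F < \<infinity>" "Lp_norm (ennreal r) G < \<infinity>"
  shows "Lp_norm (ennreal r) (F + G) < \<infinity>"
proof -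
  obtain f g where f: "f \<in> borel_measurable borel" "F = abs_ae_fun f" and g: "g \<in> borel_measurable borel" "G = abs_ae_fun g"
    by (metis ae_fun_cases)
  have "Lr r f" "Lr r g" using assms f g by (simp_all add: Lp_norm_abs Lr_iff_Lp_fnorm)
  then have "Lr r (\<lambda>x. f x + g x)" using r by (intro Lr_add) auto
  moreover have "(\<lambda>x. f x + g x) \<in> borel_measurable borel" using f g by simp
  ultimately show ?thesis using f g r by (simp add: abs_ae_fun_arith Lp_norm_abs Lr_iff_Lp_fnorm)
qed

lemma Lp_norm_scaleC:
  assumes r: "r > 0" and F: "Lp_norm (ennreal r) F \<le> ennreal C" "C \<ge> 0"
  shows "Lp_norm (ennreal r) (c *\<^sub>C F) \<le> ennreal (cmod c * C)"
proof -
  obtain f where f [measurable]: "f \<in> borel_measurable borel" and Ff: "F = abs_ae_fun f" by (metis ae_fun_cases)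
  have "Lp_norm (ennreal r) F < \<infinity>" using F by (simp add: le_less_trans)
  then have Lf: "Lr r f" using f r by (simp add: Ff Lp_norm_abs Lr_iff_Lp_fnorm)
  have le: "Lr_norm r f \<le> C" using F f r by (simp add: Ff Lp_norm_abs Lp_fnorm_eq_Lr_norm[OF Lf] ennreal_le_iff)
  have "Lp_norm (ennreal r) (c *\<^sub>C F) = ennreal (cmod c * Lr_norm r f)"
    by (simp add: Ff abs_ae_fun_arith[OF f f] Lp_norm_abs Lp_fnorm_eq_Lr_norm[OF Lr_cmult[OF Lf] r] Lr_norm_cmult r)
  also have "\<dots> \<le> ennreal (cmod c * C)" using le by (intro ennreal_leI mult_left_mono) auto
  finally show ?thesis .
qed

lemma Lp_norm_zero: "Lp_norm (ennreal r) 0 = 0" if "r > 0"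
  using that by (simp add: zero_ae_fun_def Lp_norm_abs Lp_fnorm_def ennreal_powr_def)

lemma Lp_Holder:
  assumes conj: "conj_exp r q" and F: "Lp_norm (ennreal r) F \<le> ennreal C" "C \<ge> 0" and G: "Lp_norm q G \<le> ennreal D" "D \<ge> 0"
  shows "ae_integrable (ae_mult F G)" "cmod (ae_integral (ae_mult F G)) \<le> C * D"
proof -
  have r: "r > 0" using conj_exp_ge1[OF conj] by simp
  obtain f g where f [measurable]: "f \<in> borel_measurable borel" and Ff: "F = abs_ae_fun f"
    and g [measurable]: "g \<in> borel_measurable borel" and Gg: "G = abs_ae_fun g"
    by (metis ae_fun_cases)
  have "Lp_norm (ennreal r) F < \<infinity>" using F by (simp add: le_less_trans)
  then have Lf: "Lr r f" using f r by (simp add: Ff Lp_norm_abs Lr_iff_Lp_fnorm)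
  have le: "Lr_norm r f \<le> C" using F f r by (simp add: Ff Lp_norm_abs Lp_fnorm_eq_Lr_norm[OF Lf] ennreal_le_iff)
  have gD: "Lp_fnorm q g \<le> ennreal D" using G g by (simp add: Gg Lp_norm_abs)
  note H = Lr_Holder[OF conj Lf g gD G(2)]
  show "ae_integrable (ae_mult F G)" using H(1) by (simp add: Ff Gg abs_ae_fun_arith ae_integrable_abs)
  have "cmod (ae_integral (ae_mult F G)) \<le> Lr_norm r f * D"
    using H(2) by (simp add: Ff Gg abs_ae_fun_arith ae_integral_abs)
  also have "\<dots> \<le> C * D" using le G(2) by (rule mult_right_mono)
  finally show "cmod (ae_integral (ae_mult F G)) \<le> C * D" .
qed

lemma Lp_norm_le_of_pairing:
  fixes G :: "'a::euclidean_space ae_fun"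
  assumes conj: "conj_exp r q" and C: "C \<ge> 0"
    and integ: "\<And>F. Lp_norm (ennreal r) F < \<infinity> \<Longrightarrow> ae_integrable (ae_mult F G)"
    and bound: "\<And>F K. Lp_norm (ennreal r) F \<le> ennreal K \<Longrightarrow> K \<ge> 0 \<Longrightarrow> cmod (ae_integral (ae_mult F G)) \<le> C * K"
  shows "Lp_norm q G \<le> ennreal C"
proof -
  have r: "r > 0" using conj_exp_ge1[OF conj] by simp
  obtain g where g [measurable]: "g \<in> borel_measurable borel" and Gg: "G = abs_ae_fun g" by (metis ae_fun_cases)
  obtain w :: "'a \<Rightarrow> real" where w [measurable]: "w \<in> borel_measurable borel" and w0: "\<And>x. w x > 0"
    and wr: "integrable lborel (\<lambda>x. w x powr r)"
    by (rule positive_weight[OF r]) blast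
  have fin: "Lp_norm (ennreal r) (abs_ae_fun f) < \<infinity>" if "Lr r f" for f :: "'a \<Rightarrow> complex"
    using that Lr_iff_Lp_fnorm[OF LrD[OF that] r] by (simp add: Lp_norm_abs LrD)
  have "Lp_fnorm q g \<le> ennreal C"
  proof (rule Lp_fnorm_le_of_pairing[OF conj g w w0 wr _ C])
    have "Lr r (\<lambda>x. complex_of_real (w x))" using wr w0 by (simp add: Lr_def less_imp_le)
    then have "ae_integrable (ae_mult (abs_ae_fun (\<lambda>x. complex_of_real (w x))) G)" by (intro integ fin)
    then show "integrable lborel (\<lambda>x. w x *\<^sub>R g x)"
      by (simp add: Gg abs_ae_fun_arith ae_integrable_abs scaleR_conv_of_real)
    fix f :: "'a \<Rightarrow> complex" and N :: real assume f: "Lr r f"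
    note [measurable] = LrD[OF f]
    have "cmod (ae_integral (ae_mult (abs_ae_fun f) G)) \<le> C * Lr_norm r f"
      by (rule bound) (simp_all add: Lp_norm_abs Lp_fnorm_eq_Lr_norm[OF f r])
    then show "cmod (\<integral>x. f x * g x \<partial>lborel) \<le> C * Lr_norm r f"
      by (simp add: Gg abs_ae_fun_arith ae_integral_abs)
  qed
  then show ?thesis by (simp add: Gg Lp_norm_abs)
qed

lemma Lp_norm_eq_0D:
  assumes conj: "conj_exp r q" and "Lp_norm q G \<le> 0"
  shows "G = 0"
proof -
  obtain g where g [measurable]: "g \<in> borel_measurable borel" and Gg: "G = abs_ae_fun g" by (metis ae_fun_cases)
  have gq: "Lp_fnorm q g \<le> ennreal 0" using assms(2) by (simp add: Gg Lp_norm_abs)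
  have "AE x in lborel. g x = 0"
    using conj unfolding conj_exp_def
  proof (elim disjE conjE)
    assume "r = 1" "q = \<infinity>"
    with gq have "AE x in lborel. cmod (g x) \<le> 0" using Lp_fnorm_top_le_iff[OF g, of 0] by simp
    then show ?thesis by eventually_elim simp
  next
    assume r: "r > 1" "q = ennreal (r / (r - 1))"
    let ?s = "r / (r - 1)"
    have s: "?s > 0" using r by simp
    have "Lp_fnorm (ennreal ?s) g < \<infinity>" using gq r by (auto simp: le_less_trans)
    then have Lg: "Lr ?s g" using Lr_iff_Lp_fnorm[OF g s] by simp
    have "Lr_norm ?s g \<le> 0" using gq by (simp add: r Lp_fnorm_eq_Lr_norm[OF Lg s] ennreal_eq_0_iff)
    then have "Lr_norm ?s g = 0" using Lr_norm_nonneg[of ?s g] by linarith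
    then show ?thesis by (rule Lr_norm_zero_AE[OF Lg _ s])
  qed
  then show ?thesis by (simp add: Gg zero_ae_fun_def abs_ae_fun_eq_iff)
qed

theorem Lp_functional_representation:
  fixes \<phi> :: "'a::euclidean_space ae_fun \<Rightarrow> complex"
  assumes conj: "conj_exp r q" and C: "C \<ge> 0"
    and add: "\<And>F G. Lp_norm (ennreal r) F < \<infinity> \<Longrightarrow> Lp_norm (ennreal r) G < \<infinity> \<Longrightarrow> \<phi> (F + G) = \<phi> F + \<phi> G"
    and scale: "\<And>c F. Lp_norm (ennreal r) F < \<infinity> \<Longrightarrow> \<phi> (c *\<^sub>C F) = c * \<phi> F"
    and bound: "\<And>F K. Lp_norm (ennreal r) F \<le> ennreal K \<Longrightarrow> K \<ge> 0 \<Longrightarrow> cmod (\<phi> F) \<le> C * K"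
  shows "\<exists>G. Lp_norm q G \<le> ennreal C \<and>
    (\<forall>F. Lp_norm (ennreal r) F < \<infinity> \<longrightarrow> \<phi> F = ae_integral (ae_mult F G))"
proof -
  have r: "r > 0" using conj_exp_ge1[OF conj] by simp
  have fin: "Lp_norm (ennreal r) (abs_ae_fun f) < \<infinity>" if "Lr r f" for f :: "'a \<Rightarrow> complex"
    using that Lr_iff_Lp_fnorm[OF LrD[OF that] r] by (simp add: Lp_norm_abs LrD)
  have "Lr_functional r C (\<lambda>f. \<phi> (abs_ae_fun f))"
    unfolding Lr_functional_def
  proof (intro conjI allI impI)
    fix f g :: "'a \<Rightarrow> complex" assume "Lr r f" "Lr r g"
    then show "\<phi> (abs_ae_fun (\<lambda>x. f x + g x)) = \<phi> (abs_ae_fun f) + \<phi> (abs_ae_fun g)"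
      using add[OF fin fin, of f g] by (simp add: abs_ae_fun_arith LrD)
  next
    fix c and f :: "'a \<Rightarrow> complex" assume f: "Lr r f"
    then show "\<phi> (abs_ae_fun (\<lambda>x. c * f x)) = c * \<phi> (abs_ae_fun f)"
      using scale[OF fin, of f c] by (simp add: abs_ae_fun_arith[OF LrD LrD] LrD)
  next
    fix f :: "'a \<Rightarrow> complex" assume f: "Lr r f"
    then show "cmod (\<phi> (abs_ae_fun f)) \<le> C * Lr_norm r f"
      by (intro bound) (simp_all add: Lp_norm_abs LrD Lp_fnorm_eq_Lr_norm[OF f r])
  qed
  from Lr_functional_density[OF conj this C]
  obtain g where g [measurable]: "g \<in> borel_measurable borel" and gC: "Lp_fnorm q g \<le> ennreal C"
    and rep: "\<And>f. Lr r f \<Longrightarrow> \<phi> (abs_ae_fun f) = (\<integral>x. f x * g x \<partial>lborel)" by blast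
  show ?thesis
  proof (intro exI[of _ "abs_ae_fun g"] conjI allI impI)
    show "Lp_norm q (abs_ae_fun g) \<le> ennreal C" using gC by (simp add: Lp_norm_abs)
    fix F :: "'a ae_fun" assume F: "Lp_norm (ennreal r) F < \<infinity>"
    obtain f where f [measurable]: "f \<in> borel_measurable borel" and Ff: "F = abs_ae_fun f" by (metis ae_fun_cases)
    have "Lr r f" using F r by (simp add: Ff Lp_norm_abs Lr_iff_Lp_fnorm)
    then show "\<phi> F = ae_integral (ae_mult F (abs_ae_fun g))"
      by (simp add: Ff rep abs_ae_fun_arith ae_integral_abs)
  qed
qed

section \<open>Completeness of the space of square integrable functions\<close>

lemma conj_exp_2: "conj_exp 2 2"
  by (simp add: conj_exp_def)

lemma L2_cases:
  obtains F where "Lp_norm 2 F < \<infinity>" "v = Abs_L2 F"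
  by (metis Abs_L2_cases mem_Collect_eq)

lemma Lp_norm_cnj: "Lp_norm p (ae_cnj F) = Lp_norm p F"
proof -
  obtain f where f [measurable]: "f \<in> borel_measurable borel" and Ff: "F = abs_ae_fun f" by (metis ae_fun_cases)
  show ?thesis by (simp add: Ff abs_ae_fun_arith[OF f f] Lp_norm_abs Lp_fnorm_def)
qed

lemma Abs_L2_add: "Lp_norm 2 F < \<infinity> \<Longrightarrow> Lp_norm 2 G < \<infinity> \<Longrightarrow> Abs_L2 (F + G) = Abs_L2 F + Abs_L2 G"
  by (simp add: plus_L2.abs_eq eq_onp_same_args)

lemma Abs_L2_scaleC: "Lp_norm 2 F < \<infinity> \<Longrightarrow> Abs_L2 (c *\<^sub>C F) = c *\<^sub>C Abs_L2 F"
  by (simp add: scaleC_L2.abs_eq eq_onp_same_args)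

lemma cinner_Abs_L2: "Lp_norm 2 F < \<infinity> \<Longrightarrow> Lp_norm 2 G < \<infinity> \<Longrightarrow>
    cinner (Abs_L2 F) (Abs_L2 G) = ae_integral (ae_mult F (ae_cnj G))"
  by (simp add: cinner_L2.abs_eq eq_onp_same_args)

lemma norm_Abs_L2_le:
  assumes F: "Lp_norm 2 F \<le> ennreal K" "K \<ge> 0"
  shows "norm (Abs_L2 F) \<le> K"
proof -
  have fin: "Lp_norm 2 F < \<infinity>" using F by (simp add: le_less_trans)
  have "cmod (ae_integral (ae_mult F (ae_cnj F))) \<le> K * K"
    using Lp_Holder(2)[OF conj_exp_2, of F K "ae_cnj F" K] F by (simp add: Lp_norm_cnj)
  then have "cmod (cinner (Abs_L2 F) (Abs_L2 F)) \<le> K * K" using cinner_Abs_L2[OF fin fin] by simp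
  then have "(norm (Abs_L2 F))\<^sup>2 \<le> K\<^sup>2" by (simp only: cmod_cinner_same power2_eq_square)
  then show ?thesis using F(2) by (rule power2_le_imp_le)
qed

text \<open>The inner products with the terms of a Cauchy sequence converge to a bounded functional, which is
the inner product with some \<open>L\<close> by the duality of Lebesgue spaces at \<open>p = 2\<close>. A Cauchy sequence that converges weakly
converges in norm.\<close>

lemma L2_Cauchy_convergent:
  fixes X :: "nat \<Rightarrow> 'a::euclidean_space L2"
  assumes X: "Cauchy X"
  shows "convergent X"
proof -
  obtain K where K: "\<And>n. norm (X n) \<le> K" and K0: "K \<ge> 0"
    using cauchy_imp_bounded[OF X] unfolding bounded_iff by (meson norm_ge_zero order_trans rangeI)
  have lim: "(\<lambda>n. cinner v (X n)) \<longlonglongrightarrow> lim (\<lambda>n. cinner v (X n))" for v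
  proof -
    have "Cauchy (\<lambda>n. cinner v (X n))"
      by (rule bounded_linear.Cauchy[OF cinner.bounded_linear_right X])
    then show ?thesis by (simp add: Cauchy_convergent_iff convergent_LIMSEQ_iff)
  qed
  define \<phi> where "\<phi> F = lim (\<lambda>n. cinner (Abs_L2 F) (X n))" for F
  have "\<exists>G. Lp_norm 2 G \<le> ennreal K \<and>
    (\<forall>F. Lp_norm (ennreal 2) F < \<infinity> \<longrightarrow> \<phi> F = ae_integral (ae_mult F G))"
  proof (rule Lp_functional_representation[OF conj_exp_2 K0])
    fix F G :: "'a ae_fun" assume FG: "Lp_norm (ennreal 2) F < \<infinity>" "Lp_norm (ennreal 2) G < \<infinity>"
    have "(\<lambda>n. cinner (Abs_L2 (F + G)) (X n)) \<longlonglongrightarrow> \<phi> F + \<phi> G"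
      using FG tendsto_add[OF lim[of "Abs_L2 F"] lim[of "Abs_L2 G"]]
      by (simp add: Abs_L2_add cinner_add_left \<phi>_def)
    then show "\<phi> (F + G) = \<phi> F + \<phi> G" unfolding \<phi>_def by (rule limI)
  next
    fix c and F :: "'a ae_fun" assume F: "Lp_norm (ennreal 2) F < \<infinity>"
    have "(\<lambda>n. cinner (Abs_L2 (c *\<^sub>C F)) (X n)) \<longlonglongrightarrow> c * \<phi> F"
      using F tendsto_mult[OF tendsto_const[of c] lim[of "Abs_L2 F"]]
      by (simp add: Abs_L2_scaleC cinner_scaleC_left \<phi>_def)
    then show "\<phi> (c *\<^sub>C F) = c * \<phi> F" unfolding \<phi>_def by (rule limI)
  next
    fix F :: "'a ae_fun" and M assume F: "Lp_norm (ennreal 2) F \<le> ennreal M" "M \<ge> 0"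
    have "norm (Abs_L2 F) \<le> M" using F by (intro norm_Abs_L2_le) auto
    then have "cmod (cinner (Abs_L2 F) (X n)) \<le> M * K" for n
      by (intro order_trans[OF cmod_cinner_le] mult_mono K) (use F in auto)
    then show "cmod (\<phi> F) \<le> K * M"
      unfolding \<phi>_def
      by (intro Lim_norm_ubound[OF sequentially_bot lim] always_eventually allI) (simp add: mult.commute)
  qed
  then obtain G where G: "Lp_norm 2 G \<le> ennreal K"
    and \<phi>G: "\<And>F. Lp_norm 2 F < \<infinity> \<Longrightarrow> \<phi> F = ae_integral (ae_mult F G)" by auto
  define L where "L = Abs_L2 (ae_cnj G)"
  have Gfin: "Lp_norm 2 (ae_cnj G) < \<infinity>" using G by (simp add: Lp_norm_cnj le_less_trans)
  have weak: "(\<lambda>n. cinner v (X n)) \<longlonglongrightarrow> cinner v L" for v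
  proof -
    obtain F where F: "Lp_norm 2 F < \<infinity>" "v = Abs_L2 F" by (rule L2_cases)
    have "cinner v L = \<phi> F"
      using \<phi>G[OF F(1)] cinner_Abs_L2[OF F(1) Gfin] by (simp add: F(2) L_def ae_mult_simps(8))
    then show ?thesis using lim[of v] by (simp add: \<phi>_def F(2))
  qed
  have "X \<longlonglongrightarrow> L"
  proof (rule LIMSEQ_I)
    fix e :: real assume e: "e > 0"
    then obtain N where N: "\<And>m n. m \<ge> N \<Longrightarrow> n \<ge> N \<Longrightarrow> norm (X m - X n) < e / 2"
      using CauchyD[OF X, of "e / 2"] by auto
    have "norm (X n - L) < e" if n: "n \<ge> N" for n
    proof -
      let ?d = "X n - L"
      have "(\<lambda>m. cinner ?d (X n - X m)) \<longlonglongrightarrow> cinner ?d (X n - L)"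
        unfolding cinner.diff_right by (intro tendsto_diff tendsto_const weak)
      moreover have "\<forall>\<^sub>F m in sequentially. cmod (cinner ?d (X n - X m)) \<le> norm ?d * (e / 2)"
        unfolding eventually_sequentially
      proof (intro exI[of _ N] allI impI)
        fix m assume "m \<ge> N"
        from order_trans[OF cmod_cinner_le mult_left_mono[OF less_imp_le[OF N[OF n this]] norm_ge_zero]]
        show "cmod (cinner ?d (X n - X m)) \<le> norm ?d * (e / 2)" .
      qed
      ultimately have "cmod (cinner ?d ?d) \<le> norm ?d * (e / 2)"
        by (rule Lim_norm_ubound[OF sequentially_bot])
      then have "norm ?d * norm ?d \<le> norm ?d * (e / 2)"
        by (simp add: cmod_cinner_same power2_eq_square)
      then have "norm ?d \<le> e / 2" using e by (cases "norm ?d = 0") auto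
      then show ?thesis using e by simp
    qed
    then show "\<exists>N. \<forall>n\<ge>N. norm (X n - L) < e" by blast
  qed
  then show ?thesis by (auto simp: convergent_def)
qed

instance L2 :: (euclidean_space) banach
  by standard (rule L2_Cauchy_convergent)

section \<open>Duality of the quantum noncommutative Lebesgue spaces\<close>

lemma conj_exp_of_ennreal:
  fixes p q :: ennreal
  assumes "1 \<le> p" "p < \<infinity>" "1 / p + 1 / q = 1"
  obtains r where "p = ennreal r" "conj_exp r q"
proof -
  obtain r where r: "p = ennreal r" "r \<ge> 0" using assms(2) by (cases p) auto
  have r1: "r \<ge> 1" using assms(1) r by (metis ennreal_1 ennreal_le_iff)
  have pr: "1 / p = ennreal (1 / r)" using r1 divide_ennreal[of 1 r] r by simp
  have "conj_exp r q"
  proof (cases q)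
    case top
    then have "ennreal (1 / r) = ennreal 1" using assms(3) pr by simp
    then have "1 / r = 1" using r1 by (metis ennreal_inj less_eq_real_def zero_le_divide_1_iff zero_le_one r(2))
    then show ?thesis using top r1 by (simp add: conj_exp_def)
  next
    case (real s)
    \<comment> \<open>Here \<open>q = 0\<close> is excluded, since \<open>1 / 0 = \<infinity>\<close> for extended nonnegative reals.\<close>
    show ?thesis
    proof (cases "s = 0")
      case True
      then have "1 / q = top" using real by simp
      then show ?thesis using assms(3) by simp
    next
      case False
      then have s: "s > 0" using real by simp
      then have "1 / q = ennreal (1 / s)" using divide_ennreal[of 1 s] real by simp
      then have "ennreal (1 / r + 1 / s) = ennreal 1"
        using assms(3) pr r1 s by (simp add: ennreal_plus[symmetric] del: ennreal_plus)
      then have eq: "1 / r + 1 / s = 1" using r1 s by (subst (asm) ennreal_inj) auto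
      have "1 / s > 0" using s by simp
      with eq have "1 / r < 1" by linarith
      then have "r > 1" using r1 by (simp add: divide_less_eq)
      moreover have "s = r / (r - 1)" using eq s r1 \<open>r > 1\<close> by (simp add: field_simps)
      ultimately show ?thesis using real by (simp add: conj_exp_def)
    qed
  qed
  with that r show thesis by blast
qed

lemma Lp_QHA_iff:
  "(F, A) \<in> Lp_QHA p \<longleftrightarrow> A \<in> bounded_ops \<and> Lp_norm p F < \<infinity> \<and> schatten_norm p A < \<infinity>"
  by (auto simp: Lp_QHA_def qha_norm_def)

lemma qha_norm_le_obtains:
  assumes "x \<in> Lp_QHA p"
  obtains a b where "a \<ge> 0" "b \<ge> 0" "Lp_norm p (fst x) = ennreal a" "schatten_norm p (snd x) = ennreal b"
    "qha_norm p x = ennreal (a + b)"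
proof -
  have "Lp_norm p (fst x) < \<infinity>" "schatten_norm p (snd x) < \<infinity>" using assms by (auto simp: Lp_QHA_iff[of "fst x" "snd x", simplified])
  then obtain a b where "a \<ge> 0" "b \<ge> 0" "Lp_norm p (fst x) = ennreal a" "schatten_norm p (snd x) = ennreal b"
    by (cases "Lp_norm p (fst x)"; cases "schatten_norm p (snd x)") auto
  then show thesis using that by (simp add: qha_norm_def)
qed

context
  fixes p q :: ennreal and r :: real
  assumes p: "p = ennreal r" and conj: "conj_exp r q"
begin

lemma conj_exp_pos: "r > 0" "r \<ge> 1"
  using conj_exp_ge1[OF conj] by auto

lemma Lp_QHA_add: "x \<in> Lp_QHA p \<Longrightarrow> y \<in> Lp_QHA p \<Longrightarrow> x + y \<in> Lp_QHA p"
  using conj_exp_pos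
  by (cases x; cases y)
    (auto simp: Lp_QHA_iff p simp del: infinity_ennreal_def intro: Lp_norm_add_finite schatten_norm_add_finite bounded_ops_add)

lemma Lp_QHA_scaleC:
  assumes x: "x \<in> Lp_QHA p"
  shows "c *\<^sub>C x \<in> Lp_QHA p" "qha_norm p (c *\<^sub>C x) \<le> ennreal (cmod c) * qha_norm p x"
proof -
  obtain a b where ab: "a \<ge> 0" "b \<ge> 0" "Lp_norm p (fst x) = ennreal a" "schatten_norm p (snd x) = ennreal b"
    "qha_norm p x = ennreal (a + b)" by (rule qha_norm_le_obtains[OF x])
  have A: "snd x \<in> bounded_ops" using x by (cases x) (simp add: Lp_QHA_iff)
  have 1: "Lp_norm p (c *\<^sub>C fst x) \<le> ennreal (cmod c * a)"
    using ab conj_exp_pos unfolding p by (intro Lp_norm_scaleC) auto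
  have 2: "schatten_norm p (c *\<^sub>C snd x) \<le> ennreal (cmod c * b)"
    using ab conj_exp_pos A unfolding p by (intro schatten_norm_scaleC_le) auto
  show "c *\<^sub>C x \<in> Lp_QHA p"
    using 1 2 A by (auto simp: scaleC_prod_def Lp_QHA_iff bounded_ops_scaleC le_less_trans)
  have "qha_norm p (c *\<^sub>C x) \<le> ennreal (cmod c * a) + ennreal (cmod c * b)"
    using 1 2 by (simp add: qha_norm_def scaleC_prod_def add_mono)
  also have "\<dots> = ennreal (cmod c) * qha_norm p x"
    using ab by (simp add: ennreal_mult[symmetric] ennreal_plus[symmetric] distrib_left del: ennreal_plus)
  finally show "qha_norm p (c *\<^sub>C x) \<le> ennreal (cmod c) * qha_norm p x" .
qed

lemma qha_defined:
  assumes x: "(F, A) \<in> Lp_QHA p" and y: "(G, B) \<in> Lp_QHA q"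
  shows "ae_integrable (ae_mult F G)" "A o\<^sub>L B \<in> schatten_class 1"
proof -
  obtain a b where ab: "a \<ge> 0" "Lp_norm p F = ennreal a" by (rule qha_norm_le_obtains[OF x]) simp
  obtain c d where cd: "c \<ge> 0" "Lp_norm q G = ennreal c" by (rule qha_norm_le_obtains[OF y]) simp
  show "ae_integrable (ae_mult F G)"
    using ab cd by (intro Lp_Holder(1)[OF conj, of F a G c]) (simp_all add: p)
  show "A o\<^sub>L B \<in> schatten_class 1"
    using x y schatten_compose_finite[OF conj, of A B]
    by (simp add: Lp_QHA_iff p schatten_class_def bounded_ops_compose)
qed

lemma qha_pairing_bound:
  assumes x: "x \<in> Lp_QHA p" and y: "y \<in> Lp_QHA q"
  shows "ennreal (cmod (qha_pairing x y)) \<le> qha_norm p x * qha_norm q y"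
proof -
  obtain a b where ab: "a \<ge> 0" "b \<ge> 0" "Lp_norm p (fst x) = ennreal a" "schatten_norm p (snd x) = ennreal b"
    "qha_norm p x = ennreal (a + b)" by (rule qha_norm_le_obtains[OF x])
  obtain c d where cd: "c \<ge> 0" "d \<ge> 0" "Lp_norm q (fst y) = ennreal c" "schatten_norm q (snd y) = ennreal d"
    "qha_norm q y = ennreal (c + d)" by (rule qha_norm_le_obtains[OF y])
  have A: "snd x \<in> bounded_ops" "snd y \<in> bounded_ops" using x y by (cases x; cases y; simp add: Lp_QHA_iff)+
  have "cmod (ae_integral (ae_mult (fst x) (fst y))) \<le> a * c"
    using ab cd by (intro Lp_Holder(2)[OF conj]) (simp_all add: p)
  moreover have "cmod (op_trace (snd x o\<^sub>L snd y)) \<le> b * d"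
    using ab cd A by (intro schatten_trace_bound[OF conj]) (simp_all add: p)
  ultimately have "cmod (qha_pairing x y) \<le> a * c + b * d"
    unfolding qha_pairing_def by (rule norm_triangle_mono)
  also have "\<dots> \<le> (a + b) * (c + d)" using ab cd by (simp add: algebra_simps)
  finally show ?thesis using ab cd by (simp add: ennreal_mult[symmetric] ennreal_leI del: ennreal_plus)
qed

lemma qha_pairing_add_left:
  assumes x: "x \<in> Lp_QHA p" and x': "x' \<in> Lp_QHA p" and y: "y \<in> Lp_QHA q"
  shows "qha_pairing (x + x') y = qha_pairing x y + qha_pairing x' y"
proof -
  have 1: "ae_integrable (ae_mult (fst z) (fst y))" "snd z o\<^sub>L snd y \<in> schatten_class 1" if "z \<in> Lp_QHA p" for z
    using qha_defined[of "fst z" "snd z" "fst y" "snd y"] that y by auto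
  have "(snd x + snd x') o\<^sub>L snd y = (snd x o\<^sub>L snd y) + (snd x' o\<^sub>L snd y)"
    by (rule blinfun_eqI) (simp add: blinfun.add_left)
  then show ?thesis
    using 1[OF x] 1[OF x']
    by (simp add: qha_pairing_def ae_mult_simps(1) ae_integral_add schatten_class_def op_trace_add)
qed

lemma qha_pairing_add_right:
  assumes x: "x \<in> Lp_QHA p" and y: "y \<in> Lp_QHA q" and y': "y' \<in> Lp_QHA q"
  shows "qha_pairing x (y + y') = qha_pairing x y + qha_pairing x y'"
proof -
  have 1: "ae_integrable (ae_mult (fst x) (fst z))" "snd x o\<^sub>L snd z \<in> schatten_class 1" if "z \<in> Lp_QHA q" for z
    using qha_defined[of "fst x" "snd x" "fst z" "snd z"] that x by auto
  have "snd x o\<^sub>L (snd y + snd y') = (snd x o\<^sub>L snd y) + (snd x o\<^sub>L snd y')"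
    by (rule blinfun_eqI) (simp add: blinfun.add_left blinfun.add_right)
  then show ?thesis
    using 1[OF y] 1[OF y']
    by (simp add: qha_pairing_def ae_mult_simps(2) ae_integral_add schatten_class_def op_trace_add)
qed

lemma qha_pairing_scaleC_left: "qha_pairing (c *\<^sub>C x) y = c * qha_pairing x y"
proof -
  have "(c *\<^sub>C snd x) o\<^sub>L snd y = c *\<^sub>C (snd x o\<^sub>L snd y)"
    by (rule blinfun_eqI) (simp add: scaleC_blinfun.rep_eq)
  then show ?thesis
    by (simp add: qha_pairing_def scaleC_prod_def ae_mult_simps(3) ae_integral_scaleC op_trace_scaleC distrib_left)
qed

lemma qha_pairing_scaleC_right:
  assumes "x \<in> Lp_QHA p"
  shows "qha_pairing x (c *\<^sub>C y) = c * qha_pairing x y"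
proof -
  have "snd x \<in> bounded_ops" using assms by (cases x) (simp add: Lp_QHA_iff)
  then have "snd x o\<^sub>L (c *\<^sub>C snd y) = c *\<^sub>C (snd x o\<^sub>L snd y)"
    by (intro blinfun_eqI) (simp add: scaleC_blinfun.rep_eq bounded_opsD)
  then show ?thesis
    by (simp add: qha_pairing_def scaleC_prod_def ae_mult_simps(4) ae_integral_scaleC op_trace_scaleC distrib_left)
qed

lemma Lp_QHA_fst:
  fixes F :: "(real ^ ('n::finite + 'n)) ae_fun"
  shows "Lp_norm p F < \<infinity> \<Longrightarrow> (F, 0) \<in> Lp_QHA p" "qha_norm p (F, 0) = Lp_norm p F"
  using schatten_norm_zero[OF conj_exp_pos(1), where 'a = "(real ^ 'n) L2"] by (auto simp: Lp_QHA_iff qha_norm_def p)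

lemma Lp_QHA_snd:
  fixes A :: "(real ^ 'n::finite) L2 \<Rightarrow>\<^sub>L (real ^ 'n) L2"
  shows "A \<in> bounded_ops \<Longrightarrow> schatten_norm p A < \<infinity> \<Longrightarrow> (0, A) \<in> Lp_QHA p" "qha_norm p (0, A) = schatten_norm p A"
  using Lp_norm_zero[OF conj_exp_pos(1), where 'a = "real ^ ('n + 'n)"] by (auto simp: Lp_QHA_iff qha_norm_def p)

lemma qha_pairing_fst: "qha_pairing (F, 0) y = ae_integral (ae_mult F (fst y))"
  by (simp add: qha_pairing_def op_trace_def blinfun.zero_left)

lemma qha_pairing_snd:
  fixes A :: "(real ^ 'n::finite) L2 \<Rightarrow>\<^sub>L (real ^ 'n) L2"
  shows "qha_pairing (0, A) y = op_trace (A o\<^sub>L snd y)"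
proof -
  have "ae_mult 0 (fst y) = 0"
    using ae_mult_simps(3)[of 0 0 "fst y"] by simp
  moreover have "ae_integral (0 :: (real ^ ('n + 'n)) ae_fun) = 0" by (simp add: zero_ae_fun_def ae_integral_abs)
  ultimately show ?thesis by (simp add: qha_pairing_def)
qed

text \<open>Test pairs \<open>(F, 0)\<close> bound the function part and test pairs \<open>(0, A)\<close> the operator part.\<close>

lemma qha_norm_le_of_pairing:
  fixes y :: "'n::finite qha"
  assumes y: "y \<in> Lp_QHA q" and D: "D \<ge> 0"
    and bound: "\<And>x K. x \<in> Lp_QHA p \<Longrightarrow> qha_norm p x \<le> ennreal K \<Longrightarrow> K \<ge> 0 \<Longrightarrow> cmod (qha_pairing x y) \<le> D * K"
  shows "qha_norm q y \<le> ennreal (2 * D)"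
proof -
  note r = conj_exp_pos
  have B: "snd y \<in> bounded_ops" using y by (cases y) (simp add: Lp_QHA_iff)
  have "Lp_norm q (fst y) \<le> ennreal D"
  proof (rule Lp_norm_le_of_pairing[OF conj D])
    fix F :: "(real ^ ('n + 'n)) ae_fun" assume "Lp_norm (ennreal r) F < \<infinity>"
    then have "(F, 0) \<in> Lp_QHA p" using Lp_QHA_fst(1)[of F] by (simp add: p)
    then show "ae_integrable (ae_mult F (fst y))"
      using qha_defined(1)[of F 0 "fst y" "snd y"] y by simp
  next
    fix F :: "(real ^ ('n + 'n)) ae_fun" and K :: real assume F: "Lp_norm (ennreal r) F \<le> ennreal K" "K \<ge> 0"
    have "Lp_norm p F < \<infinity>" using F by (simp add: p le_less_trans)
    then have "cmod (qha_pairing (F, 0) y) \<le> D * K"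
      using F by (intro bound Lp_QHA_fst(1)) (simp_all add: Lp_QHA_fst(2) flip: p)
    then show "cmod (ae_integral (ae_mult F (fst y))) \<le> D * K"
      by (simp add: qha_pairing_fst)
  qed
  moreover have "schatten_norm q (snd y) \<le> ennreal D"
  proof (rule schatten_norm_le_of_pairing[OF conj B D])
    fix Y :: "(real ^ 'n) L2 set" and g :: "(real ^ 'n) L2 \<Rightarrow> (real ^ 'n) L2" and a K
    assume Y: "finite Y" "ortho_set Y" "inj_on g Y" "ortho_set (g ` Y)" and K: "K \<ge> 0"
      "(\<Sum>y\<in>Y. cmod (a y) powr r) \<le> K powr r"
    let ?A = "\<Sum>y\<in>Y. a y *\<^sub>C rank_one (g y) y"
    have A: "?A \<in> bounded_ops" by (intro bounded_ops_sum bounded_ops_scaleC rank_one_bounded_ops)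
    have AK: "schatten_norm p ?A \<le> ennreal K"
      unfolding p by (rule schatten_norm_finite_rank[OF Y r(1) K(2,1)])
    then have "schatten_norm p ?A < \<infinity>" by (simp add: le_less_trans)
    then have "cmod (qha_pairing (0, ?A) y) \<le> D * K"
      using AK K by (intro bound Lp_QHA_snd(1) A) (simp_all add: Lp_QHA_snd(2))
    then show "cmod (\<Sum>x\<in>Y. a x * cinner (snd y (g x)) x) \<le> D * K"
      by (simp only: qha_pairing_snd op_trace_rank_one[OF B Y(1)])
  qed
  ultimately have "qha_norm q y \<le> ennreal D + ennreal D"
    unfolding qha_norm_def by (rule add_mono)
  also have "\<dots> = ennreal (2 * D)" using D by (simp add: ennreal_plus[symmetric] del: ennreal_plus)
  finally show ?thesis .
qed

lemma qha_dual_map_apply: "x \<in> Lp_QHA p \<Longrightarrow> qha_dual_map p y x = qha_pairing x y"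
  by (simp add: qha_dual_map_def)

lemma qha_dual_map_in_dual:
  fixes y :: "'n::finite qha"
  assumes y: "y \<in> Lp_QHA q"
  shows "qha_dual_map p y \<in> qha_dual p"
  unfolding qha_dual_def
proof (intro CollectI conjI ballI allI exI[of _ "enn2real (qha_norm q y)"])
  show "qha_dual_map p y \<in> extensional (Lp_QHA p)" by (simp add: qha_dual_map_def)
  fix x :: "'n qha" assume x: "x \<in> Lp_QHA p"
  show "qha_dual_map p y (x + z) = qha_dual_map p y x + qha_dual_map p y z" if z: "z \<in> Lp_QHA p" for z
    using x z Lp_QHA_add[OF x z] qha_pairing_add_left[OF x z y] by (simp add: qha_dual_map_apply)
  show "qha_dual_map p y (c *\<^sub>C x) = c * qha_dual_map p y x" for c
    using x Lp_QHA_scaleC(1)[OF x] qha_pairing_scaleC_left by (simp add: qha_dual_map_apply)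
  obtain a b where ab: "a \<ge> 0" "b \<ge> 0" "qha_norm p x = ennreal (a + b)" by (rule qha_norm_le_obtains[OF x])
  obtain c d where cd: "c \<ge> 0" "d \<ge> 0" "qha_norm q y = ennreal (c + d)" by (rule qha_norm_le_obtains[OF y])
  have "ennreal (cmod (qha_pairing x y)) \<le> ennreal ((a + b) * (c + d))"
    using qha_pairing_bound[OF x y] ab cd by (simp add: ennreal_mult del: ennreal_plus)
  then show "cmod (qha_dual_map p y x) \<le> enn2real (qha_norm q y) * enn2real (qha_norm p x)"
    using ab cd x by (simp add: qha_dual_map_apply mult.commute ennreal_le_iff del: ennreal_plus)
qed

text \<open>The operator part is determined by its pairings with rank one operators. For the function part the
difference of two representatives pairs to zero with everything, so its norm is at most \<open>0\<close>.\<close>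

lemma qha_dual_map_inj: "inj_on (qha_dual_map p) (Lp_QHA q :: 'n::finite qha set)"
proof (rule inj_onI)
  fix y z :: "'n qha" assume y: "y \<in> Lp_QHA q" and z: "z \<in> Lp_QHA q" and eq: "qha_dual_map p y = qha_dual_map p z"
  have pair: "qha_pairing x y = qha_pairing x z" if "x \<in> Lp_QHA p" for x
    using fun_cong[OF eq, of x] that by (simp add: qha_dual_map_apply)
  have B: "snd y \<in> bounded_ops" "snd z \<in> bounded_ops" using y z by (cases y; cases z; simp add: Lp_QHA_iff)+
  have "snd y = snd z"
  proof (rule blinfun_eqI, rule cinner_ext)
    fix u v :: "(real ^ 'n) L2"
    have "schatten_norm p (rank_one u v) < \<infinity>"
      unfolding p using schatten_norm_rank_one[OF conj_exp_pos(1), of u v] by (simp add: le_less_trans)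
    then have "qha_pairing (0, rank_one u v) y = qha_pairing (0, rank_one u v) z"
      by (intro pair Lp_QHA_snd(1) rank_one_bounded_ops)
    moreover have "op_trace (rank_one u v o\<^sub>L T) = cinner (T u) v" if "T \<in> bounded_ops" for T
      using op_trace_rank_one[OF that, of "{v}" "\<lambda>_. 1" "\<lambda>_. u" "\<lambda>v. v"] by simp
    ultimately show "cinner (snd y u) v = cinner (snd z u) v"
      using B by (simp add: qha_pairing_snd)
  qed
  moreover have "fst y = fst z"
  proof -
    let ?G = "fst y + (- 1) *\<^sub>C fst z"
    have mult: "ae_mult F ?G = ae_mult F (fst y) + (- 1) *\<^sub>C ae_mult F (fst z)" for F
      by (simp only: ae_mult_simps(2,4))
    have integ: "ae_integrable (ae_mult F (fst y))" "ae_integrable ((- 1) *\<^sub>C ae_mult F (fst z))"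
      "ae_integral (ae_mult F ?G) = 0" if F: "Lp_norm (ennreal r) F < \<infinity>" for F
    proof -
      have F0: "(F, 0) \<in> Lp_QHA p" using Lp_QHA_fst(1)[of F] F by (simp add: p)
      show 1: "ae_integrable (ae_mult F (fst y))" "ae_integrable ((- 1) *\<^sub>C ae_mult F (fst z))"
        using qha_defined(1)[of F 0 "fst y" "snd y"] qha_defined(1)[of F 0 "fst z" "snd z"]
          y z F0 by (auto intro: ae_integrable_scaleC)
      have "ae_integral (ae_mult F (fst y)) = ae_integral (ae_mult F (fst z))"
        using pair[OF F0] by (simp add: qha_pairing_fst)
      then show "ae_integral (ae_mult F ?G) = 0"
        unfolding mult ae_integral_add[OF 1] by (simp only: ae_integral_scaleC) simp
    qed
    have "Lp_norm q ?G \<le> ennreal 0"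
    proof (rule Lp_norm_le_of_pairing[OF conj order_refl])
      show "ae_integrable (ae_mult F ?G)" if "Lp_norm (ennreal r) F < \<infinity>" for F
        unfolding mult by (rule ae_integrable_add[OF integ(1,2)[OF that]])
      show "cmod (ae_integral (ae_mult F ?G)) \<le> 0 * K" if "Lp_norm (ennreal r) F \<le> ennreal K" for F K
      proof -
        have "Lp_norm (ennreal r) F < \<infinity>" using that by (simp add: le_less_trans)
        then show ?thesis using integ(3) by simp
      qed
    qed
    then have "?G = 0" by (intro Lp_norm_eq_0D[OF conj]) simp
    then show ?thesis by (simp add: scaleC_minus1)
  qed
  ultimately show "y = z" by (simp add: prod_eq_iff)
qed

text \<open>The restrictions of \<open>\<phi>\<close> to the two summands are represented separately.\<close>

lemma qha_dual_map_surj: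
  fixes \<phi> :: "'n::finite qha \<Rightarrow> complex"
  assumes \<phi>: "\<phi> \<in> qha_dual p"
  shows "\<exists>y\<in>Lp_QHA q. \<phi> = qha_dual_map p y"
proof -
  note r = conj_exp_pos
  have ext: "\<phi> \<in> extensional (Lp_QHA p)"
    and add: "\<And>x y. x \<in> Lp_QHA p \<Longrightarrow> y \<in> Lp_QHA p \<Longrightarrow> \<phi> (x + y) = \<phi> x + \<phi> y"
    and scale: "\<And>c x. x \<in> Lp_QHA p \<Longrightarrow> \<phi> (c *\<^sub>C x) = c * \<phi> x"
    using \<phi> unfolding qha_dual_def by blast+
  obtain C where C: "\<And>x. x \<in> Lp_QHA p \<Longrightarrow> cmod (\<phi> x) \<le> C * enn2real (qha_norm p x)"
    using \<phi> unfolding qha_dual_def by blast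
  \<comment> \<open>Nothing in the definition of \<open>qha_dual\<close> fixes the sign of its constant.\<close>
  define D where "D = max C 0"
  have D: "D \<ge> 0" by (simp add: D_def)
  have bound: "cmod (\<phi> x) \<le> D * K" if x: "x \<in> Lp_QHA p" and K: "qha_norm p x \<le> ennreal K" "K \<ge> 0" for x K
  proof -
    have "cmod (\<phi> x) \<le> C * enn2real (qha_norm p x)" by (rule C[OF x])
    also have "\<dots> \<le> D * enn2real (qha_norm p x)" by (intro mult_right_mono) (auto simp: D_def)
    also have "\<dots> \<le> D * K"
      using enn2real_mono[OF K(1)] K(2) D by (intro mult_left_mono) auto
    finally show ?thesis .
  qed
  have F0: "(F, 0) \<in> Lp_QHA p" if "Lp_norm (ennreal r) F < \<infinity>" for F :: "(real ^ ('n + 'n)) ae_fun"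
    using Lp_QHA_fst(1)[of F] that by (simp add: p)
  have A0: "(0, A) \<in> Lp_QHA p" if "A \<in> bounded_ops" "schatten_norm (ennreal r) A < \<infinity>"
    for A :: "(real ^ 'n) L2 \<Rightarrow>\<^sub>L (real ^ 'n) L2"
    using Lp_QHA_snd(1)[of A] that by (simp add: p)
  obtain G where G: "Lp_norm q G \<le> ennreal D"
    and \<phi>G: "\<And>F. Lp_norm (ennreal r) F < \<infinity> \<Longrightarrow> \<phi> (F, 0) = ae_integral (ae_mult F G)"
  proof -
    have "\<exists>G. Lp_norm q G \<le> ennreal D \<and>
      (\<forall>F. Lp_norm (ennreal r) F < \<infinity> \<longrightarrow> \<phi> (F, 0) = ae_integral (ae_mult F G))"
    proof (rule Lp_functional_representation[OF conj D])
      fix F H :: "(real ^ ('n + 'n)) ae_fun" assume "Lp_norm (ennreal r) F < \<infinity>" "Lp_norm (ennreal r) H < \<infinity>"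
      then show "\<phi> (F + H, 0) = \<phi> (F, 0) + \<phi> (H, 0)" using add[OF F0 F0, of F H] by simp
    next
      fix c and F :: "(real ^ ('n + 'n)) ae_fun" assume "Lp_norm (ennreal r) F < \<infinity>"
      then show "\<phi> (c *\<^sub>C F, 0) = c * \<phi> (F, 0)" using scale[OF F0, of F c] by (simp add: scaleC_prod_def)
    next
      fix F :: "(real ^ ('n + 'n)) ae_fun" and K :: real assume F: "Lp_norm (ennreal r) F \<le> ennreal K" "K \<ge> 0"
      then have "Lp_norm (ennreal r) F < \<infinity>" by (simp add: le_less_trans)
      then show "cmod (\<phi> (F, 0)) \<le> D * K"
        using F by (intro bound F0) (simp_all add: Lp_QHA_fst(2) flip: p)
    qed
    with that show thesis by blast
  qed
  obtain B where B: "B \<in> bounded_ops" "schatten_norm q B \<le> ennreal D"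
    and \<phi>B: "\<And>A. A \<in> bounded_ops \<Longrightarrow> schatten_norm (ennreal r) A < \<infinity> \<Longrightarrow> \<phi> (0, A) = op_trace (A o\<^sub>L B)"
  proof -
    have "\<exists>B\<in>bounded_ops. schatten_norm q B \<le> ennreal D \<and>
      (\<forall>A\<in>bounded_ops. schatten_norm (ennreal r) A < \<infinity> \<longrightarrow> \<phi> (0, A) = op_trace (A o\<^sub>L B))"
    proof (rule schatten_functional_representation[OF conj _ _ _ D])
      fix A A' :: "(real ^ 'n) L2 \<Rightarrow>\<^sub>L (real ^ 'n) L2"
      assume "A \<in> bounded_ops" "A' \<in> bounded_ops" "schatten_norm (ennreal r) A < \<infinity>" "schatten_norm (ennreal r) A' < \<infinity>"
      then show "\<phi> (0, A + A') = \<phi> (0, A) + \<phi> (0, A')" using add[OF A0 A0, of A A'] by simp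
    next
      fix c and A :: "(real ^ 'n) L2 \<Rightarrow>\<^sub>L (real ^ 'n) L2"
      assume "A \<in> bounded_ops" "schatten_norm (ennreal r) A < \<infinity>"
      then show "\<phi> (0, c *\<^sub>C A) = c * \<phi> (0, A)" using scale[OF A0, of A c] by (simp add: scaleC_prod_def)
    next
      fix A :: "(real ^ 'n) L2 \<Rightarrow>\<^sub>L (real ^ 'n) L2" and K :: real
      assume A: "A \<in> bounded_ops" "schatten_norm (ennreal r) A \<le> ennreal K" "K \<ge> 0"
      then have "schatten_norm (ennreal r) A < \<infinity>" by (simp add: le_less_trans)
      then show "cmod (\<phi> (0, A)) \<le> D * K"
        using A by (intro bound A0) (simp_all add: Lp_QHA_snd(2) flip: p)
    qed
    with that show thesis by blast
  qed
  have y: "(G, B) \<in> Lp_QHA q" using G B by (simp add: Lp_QHA_iff le_less_trans)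
  have "\<phi> = qha_dual_map p (G, B)"
  proof (rule extensionalityI[OF ext])
    show "qha_dual_map p (G, B) \<in> extensional (Lp_QHA p)" by (simp add: qha_dual_map_def)
    fix x :: "'n qha" assume x: "x \<in> Lp_QHA p"
    have f: "Lp_norm (ennreal r) (fst x) < \<infinity>" "snd x \<in> bounded_ops" "schatten_norm (ennreal r) (snd x) < \<infinity>"
      using x by (cases x; simp add: Lp_QHA_iff p)+
    have "\<phi> x = \<phi> (fst x, 0) + \<phi> (0, snd x)" using add[OF F0[OF f(1)] A0[OF f(2,3)]] by simp
    then show "\<phi> x = qha_dual_map p (G, B) x"
      using x by (simp add: \<phi>G[OF f(1)] \<phi>B[OF f(2,3)] qha_dual_map_apply qha_pairing_def)
  qed
  with y show ?thesis by blast
qed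

lemma qha_dual_norm_le:
  fixes y :: "'n::finite qha"
  assumes y: "y \<in> Lp_QHA q"
  shows "qha_dual_norm p (qha_dual_map p y) \<le> qha_norm q y"
  unfolding qha_dual_norm_def
proof (rule SUP_least)
  fix x :: "'n qha" assume x: "x \<in> {x \<in> Lp_QHA p. qha_norm p x \<le> 1}"
  then have "ennreal (cmod (qha_pairing x y)) \<le> qha_norm p x * qha_norm q y"
    by (intro qha_pairing_bound[OF _ y]) simp
  also have "\<dots> \<le> 1 * qha_norm q y" using x by (intro mult_right_mono) auto
  finally show "ennreal (cmod (qha_dual_map p y x)) \<le> qha_norm q y" using x by (simp add: qha_dual_map_apply)
qed

text \<open>By homogeneity the dual norm bounds the pairing with every \<open>x\<close> by \<open>D\<close> times the norm of \<open>x\<close>. Both summands of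
\<open>y\<close> then have norm at most \<open>D\<close>.\<close>

lemma qha_norm_le_dual_norm:
  fixes y :: "'n::finite qha"
  assumes y: "y \<in> Lp_QHA q"
  shows "ennreal (1 / 2) * qha_norm q y \<le> qha_dual_norm p (qha_dual_map p y)"
proof -
  let ?n = "qha_dual_norm p (qha_dual_map p y)"
  have "qha_norm q y < \<infinity>" using y by (simp add: Lp_QHA_def split: prod.splits)
  then have "?n < \<infinity>" by (rule le_less_trans[OF qha_dual_norm_le[OF y]])
  then obtain D where D: "?n = ennreal D" "D \<ge> 0" by (cases ?n) auto
  have unit: "cmod (qha_pairing x y) \<le> D" if x: "x \<in> Lp_QHA p" "qha_norm p x \<le> 1" for x :: "'n qha"
  proof -
    have "ennreal (cmod (qha_dual_map p y x)) \<le> ?n"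
      unfolding qha_dual_norm_def by (rule SUP_upper) (use x in simp)
    then show ?thesis using x D by (simp add: qha_dual_map_apply ennreal_le_iff)
  qed
  have "qha_norm q y \<le> ennreal (2 * D)"
  proof (rule qha_norm_le_of_pairing[OF y D(2)])
    fix x :: "'n qha" and K assume x: "x \<in> Lp_QHA p" "qha_norm p x \<le> ennreal K" "K \<ge> 0"
    show "cmod (qha_pairing x y) \<le> D * K"
    proof (cases "K = 0")
      case True
      then have "qha_norm p x = 0" using x(2) by simp
      then show ?thesis using qha_pairing_bound[OF x(1) y] True by simp
    next
      case False
      let ?c = "complex_of_real (1 / K)"
      have "qha_norm p (?c *\<^sub>C x) \<le> ennreal (cmod ?c) * qha_norm p x"
        by (rule Lp_QHA_scaleC(2)[OF x(1)])
      also have "\<dots> \<le> ennreal (1 / K) * ennreal K"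
        using x False by (intro mult_mono) (simp_all add: norm_divide)
      also have "\<dots> = 1" using x False by (simp add: ennreal_mult[symmetric])
      finally have "cmod (qha_pairing (?c *\<^sub>C x) y) \<le> D"
        by (rule unit[OF Lp_QHA_scaleC(1)[OF x(1)]])
      then show ?thesis
        using x False by (simp add: qha_pairing_scaleC_left norm_mult norm_divide divide_le_eq)
    qed
  qed
  then have "ennreal (1 / 2) * qha_norm q y \<le> ennreal (1 / 2) * ennreal (2 * D)" by (rule mult_left_mono) simp
  also have "\<dots> = ennreal (1 / 2 * (2 * D))" using D by (intro ennreal_mult[symmetric]) auto
  also have "\<dots> = ?n" using D by simp
  finally show ?thesis .
qed

end

theorem theorem3p5:
  fixes p q :: ennreal
  assumes "1 \<le> p" and "p < \<infinity>" and "1 / p + 1 / q = 1"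
  shows "(\<forall>(f, A)\<in>Lp_QHA p. \<forall>(g, B)\<in>(Lp_QHA q :: 'n::finite qha set).
      ae_integrable (ae_mult f g) \<and> A o\<^sub>L B \<in> schatten_class 1) \<and>
    bij_betw (qha_dual_map p) (Lp_QHA q :: 'n qha set) (qha_dual p) \<and>
    (\<forall>y\<in>(Lp_QHA q :: 'n qha set). \<forall>z\<in>Lp_QHA q. \<forall>x\<in>Lp_QHA p.
      qha_dual_map p (y + z) x = qha_dual_map p y x + qha_dual_map p z x) \<and>
    (\<forall>c. \<forall>y\<in>(Lp_QHA q :: 'n qha set). \<forall>x\<in>Lp_QHA p.
      qha_dual_map p (c *\<^sub>C y) x = c * qha_dual_map p y x) \<and>
    (\<exists>m M. 0 < m \<and> (\<forall>y\<in>(Lp_QHA q :: 'n qha set).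
      ennreal m * qha_norm q y \<le> qha_dual_norm p (qha_dual_map p y) \<and>
      qha_dual_norm p (qha_dual_map p y) \<le> ennreal M * qha_norm q y))"
proof -
  obtain r where p: "p = ennreal r" and conj: "conj_exp r q"
    by (rule conj_exp_of_ennreal[OF assms])
  show ?thesis
  proof (intro conjI)
    show "\<forall>(f, A)\<in>Lp_QHA p. \<forall>(g, B)\<in>(Lp_QHA q :: 'n qha set).
        ae_integrable (ae_mult f g) \<and> A o\<^sub>L B \<in> schatten_class 1"
      using qha_defined[OF p conj] by fast
    show "bij_betw (qha_dual_map p) (Lp_QHA q :: 'n qha set) (qha_dual p)"
      unfolding bij_betw_def
      using qha_dual_map_inj[OF p conj] qha_dual_map_in_dual[OF p conj] qha_dual_map_surj[OF p conj]
      by blast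
    show "\<forall>y\<in>(Lp_QHA q :: 'n qha set). \<forall>z\<in>Lp_QHA q. \<forall>x\<in>Lp_QHA p.
        qha_dual_map p (y + z) x = qha_dual_map p y x + qha_dual_map p z x"
      by (simp add: qha_dual_map_apply[OF p conj] qha_pairing_add_right[OF p conj])
    show "\<forall>c. \<forall>y\<in>(Lp_QHA q :: 'n qha set). \<forall>x\<in>Lp_QHA p.
        qha_dual_map p (c *\<^sub>C y) x = c * qha_dual_map p y x"
      by (simp add: qha_dual_map_apply[OF p conj] qha_pairing_scaleC_right[OF p conj])
    show "\<exists>m M. 0 < m \<and> (\<forall>y\<in>(Lp_QHA q :: 'n qha set).
        ennreal m * qha_norm q y \<le> qha_dual_norm p (qha_dual_map p y) \<and>
        qha_dual_norm p (qha_dual_map p y) \<le> ennreal M * qha_norm q y)"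
      using qha_norm_le_dual_norm[OF p conj] qha_dual_norm_le[OF p conj]
      by (intro exI[of _ "1 / 2"] exI[of _ 1]) auto
  qed
qed

end
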